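(* Let $d\ge1$ and consider the nearest-neighbor ferromagnetic Ising model on $\mathbb{Z}^d$ with zero external field, with critical inverse temperature $\beta_c\in[0,\infty]$ as in the context. For every $0\le\beta<\beta_c$ there exists $c=c(\beta)>0$ such that for every $x\in\mathbb{Z}^d$, $$\langle\sigma_0\sigma_x\rangle_\beta\ \le\ \exp(-c|x|).$$
   Context: Fix a norm $|\cdot|$ on $\mathbb{Z}^d$ (the restriction of a norm on $\mathbb{R}^d$). Ising model. For a finite set $\Lambda\subset\mathbb{Z}^d$ and $\beta\ge0$, the Ising measure on $\Lambda$ with free boundary conditions is the probability measure on $\sigma\in\{-1,+1\}^{\Lambda}$ proportional to $\exp\big(\beta\sum_{\{x,y\}}\sigma_x\sigma_y\big)$, the sum being over nearest-neighbor edges with both endpoints in $\Lambda$; expectation is denoted $\langle\cdot\rangle_{\Lambda,\beta}$. The two-point correlation function is $\langle\sigma_0\sigma_x\rangle_\beta:=\lim_{\Lambda\uparrow\mathbb{Z}^d}\langle\sigma_0\sigma_x\rangle_{\Lambda,\beta}$. Critical point. For a finite subgraph $\Lambda=(V,E)$ of $\mathbb{Z}^d$ (with nearest-neighbor edges) and $p\in[0,1]$, the random-cluster measure with $q=2$ and free boundary conditions is the probability measure on $\omega\in\{0,1\}^E$ proportional to $2^{k(\omega)}p^{o(\omega)}(1-p)^{f(\omega)}$, where $o(\omega)$ and $f(\omega)$ are the numbers of open edges ($\omega_e=1$) and closed edges ($\omega_e=0$), and $k(\omega)$ is the number of connected components of the graph $(V,\{e:\omega_e=1\})$. Let $\mu_{\mathbb{Z}^d,p,2}$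 be its weak limit as $\Lambda\uparrow\mathbb{Z}^d$, and let $0\leftrightarrow\infty$ be the event that $0$ is joined by open paths to vertices of arbitrarily large norm. Let $p_c\in[0,1]$ be the parameter such that $\mu_{\mathbb{Z}^d,p,2}(0\leftrightarrow\infty)=0$ for $p<p_c$ and $>0$ for $p>p_c$. The Ising and random-cluster parameters are related by $p=1-e^{-2\beta}$ (Edwards--Sokal coupling), and $\beta_c:=-\tfrac12\log(1-p_c)$ (with $\beta_c=\infty$ if $p_c=1$). *)

theory Defs
  imports "HOL-Probability.Probability"
begin

definition is_norm :: "('v::real_vector \<Rightarrow> real) \<Rightarrow> bool" where
  "is_norm N \<longleftrightarrow>
     (\<forall>v. N v \<ge> 0) \<and> (\<forall>v. N v = 0 \<longleftrightarrow> v = 0) \<and>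
     (\<forall>a v. N (a *\<^sub>R v) = \<bar>a\<bar> * N v) \<and>
     (\<forall>v w. N (v + w) \<le> N v + N w)"

type_synonym 'd site = "(int, 'd) vec"

definition site_to_real :: "int ^ 'd \<Rightarrow> real ^ 'd" where
  "site_to_real x = (\<chi> i. real_of_int (x $ i))"

text \<open>The pair \<open>(x, i)\<close> stands for the edge joining \<open>x\<close> to \<open>x + e\<^sub>i\<close>. Every unoriented
  nearest-neighbor edge is represented by exactly one such pair.\<close>

type_synonym 'd edge = "'d site \<times> 'd"

definition endpoints :: "'d::finite edge \<Rightarrow> 'd site set" where
  "endpoints e = {fst e, fst e + axis (snd e) 1}"

text \<open>A probability measure whenever \<open>A\<close> is finite and \<open>w\<close> is nonnegative on \<open>A\<close> with positive sum.\<close>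

definition proportional_measure :: "'a set \<Rightarrow> ('a \<Rightarrow> real) \<Rightarrow> 'a measure" where
  "proportional_measure A w = point_measure A (\<lambda>a. ennreal (w a / (\<Sum>b\<in>A. w b)))"

definition ising_measure :: "'d::finite site set \<Rightarrow> real \<Rightarrow> ('d site \<Rightarrow> real) measure" where
  "ising_measure \<Lambda> \<beta> =
     proportional_measure (\<Lambda> \<rightarrow>\<^sub>E {-1, 1})
       (\<lambda>\<sigma>. exp (\<beta> * (\<Sum>e | endpoints e \<subseteq> \<Lambda>. \<Prod>x\<in>endpoints e. \<sigma> x)))"

definition two_point :: "real \<Rightarrow> 'd::finite site \<Rightarrow> 'd site \<Rightarrow> real" where
  "two_point \<beta> x y =
     Lim (finite_subsets_at_top UNIV) (\<lambda>\<Lambda>. \<integral>\<sigma>. \<sigma> x * \<sigma> y \<partial>ising_measure \<Lambda> \<beta>)"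

text \<open>Configurations are functions on all edges; those of a finite subgraph \<open>(V, E)\<close> are
  extended by declaring the edges outside \<open>E\<close> closed.\<close>

type_synonym 'd config = "'d edge \<Rightarrow> bool"

definition open_adj :: "'d::finite config \<Rightarrow> ('d site \<times> 'd site) set" where
  "open_adj \<omega> = {(x, y). \<exists>e. \<omega> e \<and> endpoints e = {x, y}}"

definition finite_subgraph :: "'d::finite site set \<times> 'd edge set \<Rightarrow> bool" where
  "finite_subgraph G \<longleftrightarrow>
     finite (fst G) \<and> finite (snd G) \<and> (\<forall>e\<in>snd G. endpoints e \<subseteq> fst G)"

text \<open>Since edges outside \<open>E\<close> are closed, the open cluster of a vertex of \<open>V\<close> stays in \<open>V\<close>.\<close>

definition num_clusters :: "'d::finite site set \<Rightarrow> 'd config \<Rightarrow> nat" where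
  "num_clusters V \<omega> = card (V // (open_adj \<omega>)\<^sup>*)"

definition random_cluster ::
  "real \<Rightarrow> 'd::finite site set \<times> 'd edge set \<Rightarrow> 'd config measure" where
  "random_cluster p = (\<lambda>(V, E).
     proportional_measure {\<omega>. \<forall>e. \<omega> e \<longrightarrow> e \<in> E}
       (\<lambda>\<omega>. 2 ^ num_clusters V \<omega> * p ^ card {e\<in>E. \<omega> e} * (1 - p) ^ card {e\<in>E. \<not> \<omega> e}))"

text \<open>The filter expressing that a finite subgraph increases to the whole lattice.\<close>

definition subgraphs_at_top :: "('d::finite site set \<times> 'd edge set) filter" where
  "subgraphs_at_top =
     (INF G\<in>Collect finite_subgraph.
        principal {H. finite_subgraph H \<and> fst G \<subseteq> fst H \<and> snd G \<subseteq> snd H})"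

text \<open>Weak convergence, with respect to the product topology on configurations. The
  sigma-algebras of the \<open>\<mu> a\<close> may be finer than the Borel one.\<close>

definition weakly_converges ::
  "('a \<Rightarrow> 'b::topological_space measure) \<Rightarrow> 'b measure \<Rightarrow> 'a filter \<Rightarrow> bool" where
  "weakly_converges \<mu> M F \<longleftrightarrow>
     (\<forall>f :: 'b \<Rightarrow> real. continuous_on UNIV f \<longrightarrow> bounded (range f) \<longrightarrow>
        ((\<lambda>a. \<integral>\<omega>. f \<omega> \<partial>\<mu> a) \<longlongrightarrow> (\<integral>\<omega>. f \<omega> \<partial>M)) F)"

definition infinite_random_cluster :: "real \<Rightarrow> 'd::finite config measure" where
  "infinite_random_cluster p =
     (THE M. prob_space M \<and> sets M = sets borel \<and>
        weakly_converges (random_cluster p) M subgraphs_at_top)"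

definition connected_to_infinity :: "(real ^ 'd \<Rightarrow> real) \<Rightarrow> 'd::finite config set" where
  "connected_to_infinity N =
     {\<omega>. \<forall>R. \<exists>x. N (site_to_real x) > R \<and> (0, x) \<in> (open_adj \<omega>)\<^sup>*}"

definition critical_p :: "(real ^ 'd::finite \<Rightarrow> real) \<Rightarrow> real" where
  "critical_p N =
     (THE pc. pc \<in> {0..1} \<and>
        (\<forall>p\<in>{0..1}.
           (p < pc \<longrightarrow> measure (infinite_random_cluster p) (connected_to_infinity N) = 0) \<and>
           (p > pc \<longrightarrow> measure (infinite_random_cluster p) (connected_to_infinity N) > 0)))"

text \<open>The Edwards--Sokal relation \<open>p = 1 - exp (- 2 \<beta>)\<close>, solved for \<open>\<beta>\<close>.\<close>

definition critical_beta :: "(real ^ 'd::finite \<Rightarrow> real) \<Rightarrow> ereal" where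
  "critical_beta N =
     (if critical_p N = 1 then \<infinity> else ereal (- (1 / 2) * ln (1 - critical_p N)))"

end

theory Submission
  imports Defs
begin

text \<open>By the Edwards--Sokal identity, the correlation of two spins in a finite volume is the probability
  that their sites are connected in the random-cluster measure. Connecting the origin to \<open>x\<close> needs
  a cluster whose size is at least a constant times the norm of \<open>x\<close>. So the theorem follows once
  the cluster of the origin is shown to have exponential tails below the critical point, uniformly
  over finite volumes.

  The idea is to pay for an exponential weight with a small decrease of the parameter; it follows
  Vanneuville's stochastic comparison argument for Bernoulli percolation. Take
  \<open>p1 < p2\<close> below the critical point, with odds \<open>r1 < r2\<close>, and give each configuration of the
  measure at \<open>p2\<close> the additional weight \<open>s ^ card C\<close>, where \<open>C\<close> is the cluster of the origin
  and \<open>s < 1\<close>. This amounts to conditioning the origin not to be connected to a random set that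
  contains each site with probability \<open>1 - s\<close>. Explore \<open>C\<close> edge by edge. Opening an edge from
  \<open>C\<close> to a site \<open>y\<close> outside it costs the factor \<open>s ^ card (cluster of y)\<close>. Given \<open>C\<close>, the
  configuration outside is a random-cluster configuration on a smaller graph with free boundary
  conditions, so this cost is at least some \<open>q\<close> on average, where \<open>q\<close> is a lower bound for the
  mean of \<open>s ^ card (cluster of y)\<close> over all finite graphs. Hence the weighted measure still
  dominates, as far as \<open>C\<close> is concerned, the random-cluster measure with odds \<open>r2 q\<close>
  (\<open>exploration_domination\<close>). But under the weighted measure \<open>C\<close> has size at least \<open>n\<close> with
  probability at most \<open>s ^ n / q\<close> (\<open>cluster_tail\<close>). Since there is no percolation at \<open>p2\<close>, a
  suitable \<open>s\<close> makes \<open>q\<close> as close to \<open>1\<close> as needed for \<open>r2 q = r1\<close>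
  (\<open>uniform_cluster_tail\<close>).

  All comparisons rest on the monotonicity of random-cluster measures in the parameter and in the
  volume, which follows from the four functions theorem and the supermodularity of the number of
  clusters (\<open>fk_sum_compare\<close>). It also yields the infinite-volume measure, as a projective limit,
  and the monotonicity of its percolation probability, so that the critical point exists. Finally,
  the constant \<open>1 / q\<close> in front of the exponential is removed with the help of
  \<open>isolation_probability\<close>: the origin is isolated with probability bounded below.\<close>

section \<open>Four functions and Holley's inequality\<close>

lemma sum_Pow_insert:
  fixes f :: "'a set \<Rightarrow> 'b::comm_monoid_add"
  assumes "finite S" "e \<notin> S"
  shows "(\<Sum>X\<in>Pow (insert e S). f X) = (\<Sum>X\<in>Pow S. f X + f (insert e X))"
proof -
  have "inj_on (insert e) (Pow S)"
    using assms(2) by (auto intro!: inj_onI)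
  moreover have "Pow S \<inter> insert e ` Pow S = {}"
    using assms(2) by auto
  ultimately show ?thesis
    using assms(1) by (simp add: Pow_insert sum.union_disjoint sum.reindex sum.distrib)
qed

text \<open>The four functions theorem for a one-element ground set: the indices \<open>0\<close> and \<open>1\<close> stand for
  the sets without and with the element.\<close>

lemma four_numbers:
  fixes a0 a1 b0 b1 c0 c1 d0 d1 :: real
  assumes nn: "0 \<le> a0" "0 \<le> a1" "0 \<le> b0" "0 \<le> b1" "0 \<le> c0" "0 \<le> c1" "0 \<le> d0" "0 \<le> d1"
    and h: "a0 * b0 \<le> c0 * d0" "a0 * b1 \<le> c1 * d0" "a1 * b0 \<le> c1 * d0" "a1 * b1 \<le> c1 * d1"
  shows "(a0 + a1) * (b0 + b1) \<le> (c0 + c1) * (d0 + d1)"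
proof -
  define u v t z where "u = a0 * b1" and "v = a1 * b0" and "t = c1 * d0" and "z = c0 * d1"
  have pos: "0 \<le> u" "0 \<le> v" "0 \<le> t" "0 \<le> z"
    using nn by (auto simp: u_def v_def t_def z_def)
  have ut: "u \<le> t" and vt: "v \<le> t"
    using h by (auto simp: u_def v_def t_def)
  have "u * v = (a0 * b0) * (a1 * b1)"
    by (simp add: u_def v_def)
  also have "\<dots> \<le> (c0 * d0) * (c1 * d1)"
    by (rule mult_mono) (use h nn in auto)
  finally have uv: "u * v \<le> t * z"
    by (simp add: t_def z_def mult_ac)
  \<comment> \<open>The two mixed terms: \<open>u, v \<le> t\<close> and \<open>u v \<le> t z\<close> force \<open>u + v \<le> t + z\<close>.\<close>
  have "u + v \<le> t + z"
  proof (cases "t = 0")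
    case True
    then show ?thesis using ut vt pos by linarith
  next
    case False
    have "0 \<le> (t - u) * (t - v)"
      using ut vt by simp
    then have "t * (u + v) \<le> t * (t + z)"
      using uv by (simp add: algebra_simps)
    then show ?thesis
      using False pos by (simp add: mult_le_cancel_left)
  qed
  then show ?thesis
    using h by (simp add: algebra_simps u_def v_def t_def z_def)
qed

text \<open>The theorem of Ahlswede and Daykin. Replacing each function by its sum over the two choices for
  one element of the ground set preserves the hypothesis, by \<open>four_numbers\<close>.\<close>

lemma four_functions:
  fixes \<alpha> \<beta> \<gamma> \<delta> :: "'a set \<Rightarrow> real"
  assumes "finite S"
    and "\<And>X. 0 \<le> \<alpha> X" "\<And>X. 0 \<le> \<beta> X" "\<And>X. 0 \<le> \<gamma> X" "\<And>X. 0 \<le> \<delta> X"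
    and "\<And>X Y. X \<subseteq> S \<Longrightarrow> Y \<subseteq> S \<Longrightarrow> \<alpha> X * \<beta> Y \<le> \<gamma> (X \<union> Y) * \<delta> (X \<inter> Y)"
  shows "(\<Sum>X\<in>Pow S. \<alpha> X) * (\<Sum>X\<in>Pow S. \<beta> X) \<le> (\<Sum>X\<in>Pow S. \<gamma> X) * (\<Sum>X\<in>Pow S. \<delta> X)"
  using assms
proof (induction S arbitrary: \<alpha> \<beta> \<gamma> \<delta> rule: finite_induct)
  case empty
  then show ?case by force
next
  case (insert e S)
  have "(\<Sum>X\<in>Pow S. \<alpha> X + \<alpha> (insert e X)) * (\<Sum>X\<in>Pow S. \<beta> X + \<beta> (insert e X))
      \<le> (\<Sum>X\<in>Pow S. \<gamma> X + \<gamma> (insert e X)) * (\<Sum>X\<in>Pow S. \<delta> X + \<delta> (insert e X))"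
  proof (rule insert.IH)
    fix X Y assume XY: "X \<subseteq> S" "Y \<subseteq> S"
    then have e: "e \<notin> X" "e \<notin> Y" using insert.hyps by auto
    note h = insert.prems(5)
    have "\<alpha> X * \<beta> Y \<le> \<gamma> (X \<union> Y) * \<delta> (X \<inter> Y)"
      by (rule h) (use XY in auto)
    moreover have "\<alpha> X * \<beta> (insert e Y) \<le> \<gamma> (insert e (X \<union> Y)) * \<delta> (X \<inter> Y)"
      using h[of X "insert e Y"] XY e by (auto simp: insert_commute)
    moreover have "\<alpha> (insert e X) * \<beta> Y \<le> \<gamma> (insert e (X \<union> Y)) * \<delta> (X \<inter> Y)"
      using h[of "insert e X" Y] XY e by auto
    moreover have "\<alpha> (insert e X) * \<beta> (insert e Y) \<le> \<gamma> (insert e (X \<union> Y)) * \<delta> (insert e (X \<inter> Y))"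
      using h[of "insert e X" "insert e Y"] XY e by auto
    ultimately show "(\<alpha> X + \<alpha> (insert e X)) * (\<beta> Y + \<beta> (insert e Y))
        \<le> (\<gamma> (X \<union> Y) + \<gamma> (insert e (X \<union> Y))) * (\<delta> (X \<inter> Y) + \<delta> (insert e (X \<inter> Y)))"
      by (intro four_numbers insert.prems(1-4))
  qed (use insert.prems in \<open>auto intro: add_nonneg_nonneg\<close>)
  then show ?case
    using insert.hyps by (simp add: sum_Pow_insert)
qed

text \<open>The four functions theorem for \<open>\<nu> f\<close>, \<open>\<mu>\<close>, \<open>\<mu> f\<close> and \<open>\<nu>\<close>. Without
  normalization it also covers weights that vanish somewhere, such as those of conditioned measures.\<close>

lemma holley:
  fixes \<mu> \<nu> f :: "'a set \<Rightarrow> real"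
  assumes "finite S" "\<And>X. 0 \<le> \<mu> X" "\<And>X. 0 \<le> \<nu> X" "\<And>X. 0 \<le> f X"
    and "\<And>X Y. X \<subseteq> S \<Longrightarrow> Y \<subseteq> S \<Longrightarrow> \<nu> X * \<mu> Y \<le> \<mu> (X \<union> Y) * \<nu> (X \<inter> Y)"
    and f: "\<And>X Y. X \<subseteq> Y \<Longrightarrow> f X \<le> f Y"
  shows "(\<Sum>X\<in>Pow S. \<nu> X * f X) * (\<Sum>X\<in>Pow S. \<mu> X)
    \<le> (\<Sum>X\<in>Pow S. \<mu> X * f X) * (\<Sum>X\<in>Pow S. \<nu> X)"
proof (rule four_functions)
  fix X Y assume XY: "X \<subseteq> S" "Y \<subseteq> S"
  have "\<nu> X * f X * \<mu> Y = f X * (\<nu> X * \<mu> Y)"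
    by simp
  also have "\<dots> \<le> f (X \<union> Y) * (\<mu> (X \<union> Y) * \<nu> (X \<inter> Y))"
    by (rule mult_mono) (use assms XY in auto)
  finally show "\<nu> X * f X * \<mu> Y \<le> \<mu> (X \<union> Y) * f (X \<union> Y) * \<nu> (X \<inter> Y)"
    by (simp add: mult_ac)
qed (use assms in auto)

section \<open>Connectivity and the number of clusters\<close>

definition conn :: "'d::finite edge set \<Rightarrow> ('d site \<times> 'd site) set" where
  "conn X = (open_adj (\<lambda>e. e \<in> X))\<^sup>*"

definition cluster :: "'d::finite edge set \<Rightarrow> 'd site \<Rightarrow> 'd site set" where
  "cluster X x = conn X `` {x}"

lemma mem_cluster: "y \<in> cluster X x \<longleftrightarrow> (x, y) \<in> conn X"
  by (simp add: cluster_def)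

lemma conn_refl [simp]: "(x, x) \<in> conn X"
  by (simp add: conn_def)

lemma sym_open_adj: "sym (open_adj \<omega>)"
  unfolding open_adj_def sym_def by (auto simp: insert_commute)

lemma conn_sym: "(x, y) \<in> conn X \<Longrightarrow> (y, x) \<in> conn X"
  unfolding conn_def by (meson sym_open_adj sym_rtrancl symE)

lemma conn_trans: "(x, y) \<in> conn X \<Longrightarrow> (y, z) \<in> conn X \<Longrightarrow> (x, z) \<in> conn X"
  unfolding conn_def by (rule rtrancl_trans)

lemma equiv_conn: "equiv UNIV (conn X)"
  by (rule equivI) (auto intro: refl_onI symI transI conn_sym conn_trans)

lemma conn_mono: "X \<subseteq> Y \<Longrightarrow> conn X \<subseteq> conn Y"
  unfolding conn_def by (rule rtrancl_mono) (auto simp: open_adj_def)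

lemma cluster_mono: "X \<subseteq> Y \<Longrightarrow> cluster X x \<subseteq> cluster Y x"
  using conn_mono[of X Y] by (auto simp: cluster_def)

lemma self_in_cluster [simp]: "x \<in> cluster X x"
  by (simp add: mem_cluster)

lemma conn_empty: "(x, y) \<in> conn {} \<longleftrightarrow> x = y"
  by (simp add: conn_def open_adj_def)

lemma conn_edge: "e \<in> X \<Longrightarrow> endpoints e = {x, y} \<Longrightarrow> (x, y) \<in> conn X"
  unfolding conn_def by (rule r_into_rtrancl) (auto simp: open_adj_def simp del: split_paired_Ex)

lemma conn_insert:
  assumes e: "endpoints e = {x, y}"
  shows "(u, v) \<in> conn (insert e X) \<longleftrightarrow> (u, v) \<in> conn X
    \<or> ((u, x) \<in> conn X \<and> (y, v) \<in> conn X) \<or> ((u, y) \<in> conn X \<and> (x, v) \<in> conn X)"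
proof -
  have "open_adj (\<lambda>f. f \<in> insert e X) = insert (x, y) (insert (y, x) (open_adj (\<lambda>f. f \<in> X)))"
    using e by (auto simp: open_adj_def doubleton_eq_iff simp del: split_paired_Ex)
  then have "conn (insert e X) = conn X \<union> {(a, b). (a, y) \<in> conn X \<and> (x, b) \<in> conn X}
      \<union> {(a, b). (a, x) \<in> conn X \<union> {(a, b). (a, y) \<in> conn X \<and> (x, b) \<in> conn X}
            \<and> (y, b) \<in> conn X \<union> {(a, b). (a, y) \<in> conn X \<and> (x, b) \<in> conn X}}"
    unfolding conn_def by (simp add: rtrancl_insert)
  then show ?thesis
    using conn_trans[of u x X v] conn_trans[of u y X v] by auto
qed

lemma cluster_insert:
  assumes e: "endpoints e = {x, y}" and x: "x \<in> cluster X z"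
  shows "cluster (insert e X) z = cluster X z \<union> cluster X y"
proof (intro set_eqI iffI)
  fix v assume "v \<in> cluster (insert e X) z"
  then show "v \<in> cluster X z \<union> cluster X y"
    using x by (auto simp: mem_cluster conn_insert[OF e] intro: conn_trans)
qed (use x in \<open>auto simp: mem_cluster conn_insert[OF e]\<close>)

lemma endpoints_doubleton: obtains x y where "endpoints e = {x, y}"
  by (simp add: endpoints_def)

definition clusters :: "'d::finite site set \<Rightarrow> 'd edge set \<Rightarrow> nat" where
  "clusters V X = card (V // conn X)"

lemma clusters_empty: "clusters V {} = card V"
proof -
  have "conn ({} :: 'a edge set) = Id"
    by (auto simp: conn_empty)
  then have "V // conn {} = (\<lambda>x. {x}) ` V"
    by (auto simp: quotient_def)
  then show ?thesis
    by (simp add: clusters_def card_image)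
qed

lemma clusters_insert:
  assumes V: "finite V" and e: "endpoints e = {x, y}" "endpoints e \<subseteq> V"
  shows "clusters V X = clusters V (insert e X) + (if (x, y) \<in> conn X then 0 else 1)"
proof (cases "(x, y) \<in> conn X")
  case True
  then have "(u, v) \<in> conn (insert e X) \<longleftrightarrow> (u, v) \<in> conn X" for u v
    using conn_insert[OF e(1), of u v X] conn_trans conn_sym by metis
  then have "conn (insert e X) = conn X"
    by auto
  with True show ?thesis by (simp add: clusters_def)
next
  case False
  let ?c = "\<lambda>z. conn X `` {z}"
  have xy: "x \<in> V" "y \<in> V" using e by auto
  have new: "conn (insert e X) `` {z} = (if z \<in> ?c x \<union> ?c y then ?c x \<union> ?c y else ?c z)" for z
  proof -
    have "(z, v) \<in> conn (insert e X) \<longleftrightarrow> (if (x, z) \<in> conn X \<or> (y, z) \<in> conn X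
        then (x, v) \<in> conn X \<or> (y, v) \<in> conn X else (z, v) \<in> conn X)" for v
    proof -
      have iff: "(z, v) \<in> conn X \<longleftrightarrow> (a, v) \<in> conn X" if "(a, z) \<in> conn X" for a v
        using that conn_trans conn_sym by metis
      consider "(x, z) \<in> conn X" | "(y, z) \<in> conn X" | "(z, x) \<notin> conn X" "(z, y) \<notin> conn X"
        using conn_sym by blast
      then show ?thesis
      proof cases
        case 1
        then show ?thesis
          using conn_insert[OF e(1), of z v X] iff[OF 1, of v] iff[OF 1, of x] iff[OF 1, of y] False
          by simp
      next
        case 2
        moreover have "(y, x) \<notin> conn X" using False conn_sym by blast
        ultimately show ?thesis
          using conn_insert[OF e(1), of z v X] iff[OF 2, of v] iff[OF 2, of x] iff[OF 2, of y]
          by auto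
      next
        case 3
        moreover have "(x, z) \<notin> conn X" "(y, z) \<notin> conn X" using 3 conn_sym by blast+
        ultimately show ?thesis
          using conn_insert[OF e(1), of z v X] by simp
      qed
    qed
    then show ?thesis by (simp add: set_eq_iff)
  qed
  have cls: "?c z = ?c x \<longleftrightarrow> z \<in> ?c x" "?c z = ?c y \<longleftrightarrow> z \<in> ?c y" for z
    using conn_sym[of x z X] conn_sym[of z x X] conn_sym[of y z X] conn_sym[of z y X]
    by (auto simp: eq_equiv_class_iff[OF equiv_conn])
  have ne: "?c x \<noteq> ?c y"
    using False by (simp add: eq_equiv_class_iff[OF equiv_conn])
  have "V // conn (insert e X) = insert (?c x \<union> ?c y) (V // conn X - {?c x, ?c y})"
  proof (intro set_eqI iffI)
    fix C assume "C \<in> V // conn (insert e X)"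
    then obtain z where "z \<in> V" "C = conn (insert e X) `` {z}"
      by (auto simp: quotient_def)
    then show "C \<in> insert (?c x \<union> ?c y) (V // conn X - {?c x, ?c y})"
      unfolding new using cls[of z] by (auto simp: quotient_def split: if_splits)
  next
    fix C assume "C \<in> insert (?c x \<union> ?c y) (V // conn X - {?c x, ?c y})"
    then consider "C = ?c x \<union> ?c y"
      | z where "z \<in> V" "C = ?c z" "?c z \<noteq> ?c x" "?c z \<noteq> ?c y"
      by (auto simp: quotient_def)
    then show "C \<in> V // conn (insert e X)"
    proof cases
      case 1
      then have "C = conn (insert e X) `` {x}" using new[of x] by auto
      then show ?thesis using xy by (auto simp: quotient_def)
    next
      case 2
      then have "C = conn (insert e X) `` {z}" using new[of z] cls[of z] by auto
      then show ?thesis using 2 by (auto simp: quotient_def)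
    qed
  qed
  moreover have "?c x \<union> ?c y \<notin> V // conn X"
  proof
    assume "?c x \<union> ?c y \<in> V // conn X"
    then obtain z where z: "?c x \<union> ?c y = ?c z" by (auto simp: quotient_def)
    have "x \<in> ?c x \<union> ?c y" "y \<in> ?c x \<union> ?c y" by simp_all
    then have "(z, x) \<in> conn X" "(z, y) \<in> conn X" unfolding z by simp_all
    then show False using False conn_sym conn_trans by blast
  qed
  moreover have fin: "finite (V // conn X)"
    using V by (simp add: quotient_def)
  moreover have sub: "{?c x, ?c y} \<subseteq> V // conn X"
    using xy by (auto simp: quotient_def)
  ultimately have "card (V // conn (insert e X)) = Suc (card (V // conn X) - 2)"
    using ne by (simp add: card_Diff_subset)
  moreover have "2 \<le> card (V // conn X)"
    using card_mono[OF fin sub] ne by simp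
  ultimately show ?thesis
    using False by (simp add: clusters_def)
qed

lemma clusters_insert_le:
  assumes "finite V" "endpoints e \<subseteq> V"
  shows "clusters V (insert e X) \<le> clusters V X"
proof -
  obtain x y where "endpoints e = {x, y}" by (rule endpoints_doubleton)
  then show ?thesis using clusters_insert[of V e x y X] assms by simp
qed

lemma clusters_antimono:
  assumes V: "finite V" and "finite D" and "\<And>e. e \<in> D \<Longrightarrow> endpoints e \<subseteq> V"
  shows "clusters V (X \<union> D) \<le> clusters V X"
  using assms(2,3)
proof (induction D rule: finite_induct)
  case (insert e D)
  then show ?case
    using clusters_insert_le[OF V, of e "X \<union> D"] by fastforce
qed simp

text \<open>Opening an edge merges two clusters unless its endpoints are already connected, and endpoints
  that are connected stay so in a larger configuration. So an edge reduces the number of clusters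
  of a larger configuration by at most as much.\<close>

lemma clusters_supermodular_aux:
  assumes V: "finite V" and "finite D" and "\<And>e. e \<in> D \<Longrightarrow> endpoints e \<subseteq> V" and "I \<subseteq> B"
  shows "clusters V (I \<union> D) + clusters V B \<le> clusters V (B \<union> D) + clusters V I"
  using assms(2,3)
proof (induction D rule: finite_induct)
  case (insert e D)
  obtain x y where e: "endpoints e = {x, y}" by (rule endpoints_doubleton)
  have eV: "endpoints e \<subseteq> V" using insert.prems by auto
  have "conn (I \<union> D) \<subseteq> conn (B \<union> D)"
    using \<open>I \<subseteq> B\<close> by (intro conn_mono) auto
  then show ?case
    using clusters_insert[OF V e eV, of "I \<union> D"] clusters_insert[OF V e eV, of "B \<union> D"] insert
    by (auto split: if_splits)
qed (use assms in simp)

lemma clusters_supermodular: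
  assumes V: "finite V" and "finite A" and "\<And>e. e \<in> A \<Longrightarrow> endpoints e \<subseteq> V"
  shows "clusters V A + clusters V B \<le> clusters V (A \<union> B) + clusters V (A \<inter> B)"
proof -
  have "clusters V ((A \<inter> B) \<union> (A - B)) + clusters V B
      \<le> clusters V (B \<union> (A - B)) + clusters V (A \<inter> B)"
    using assms by (intro clusters_supermodular_aux) auto
  moreover have "(A \<inter> B) \<union> (A - B) = A" "B \<union> (A - B) = A \<union> B" by auto
  ultimately show ?thesis by simp
qed

section \<open>Finite random-cluster averages\<close>

text \<open>A path from \<open>z\<close> can leave the smaller cluster only through an edge that touches it.\<close>

lemma cluster_eqI:
  assumes "L \<subseteq> X" and "\<And>e. e \<in> X - L \<Longrightarrow> endpoints e \<inter> cluster L z = {}"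
  shows "cluster X z = cluster L z"
proof
  show "cluster X z \<subseteq> cluster L z"
  proof
    fix v assume "v \<in> cluster X z"
    then have "(z, v) \<in> (open_adj (\<lambda>e. e \<in> X))\<^sup>*"
      by (simp add: mem_cluster conn_def)
    then show "v \<in> cluster L z"
    proof (induction rule: rtrancl_induct)
      case (step v w)
      then obtain e where e: "e \<in> X" "endpoints e = {v, w}"
        by (auto simp: open_adj_def)
      then have "e \<in> L" using assms(2)[of e] step.IH by auto
      then show ?case
        using conn_edge[of e L v w] e step.IH conn_trans by (auto simp: mem_cluster)
    qed simp
  qed
qed (rule cluster_mono[OF assms(1)])

lemma disjoint_clusters: "y \<notin> cluster X z \<Longrightarrow> cluster X z \<inter> cluster X y = {}"
  using conn_trans conn_sym by (fastforce simp: mem_cluster)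

text \<open>The random-cluster weight for \<open>q = 2\<close> in terms of the odds \<open>r = p / (1 - p)\<close>; the constant
  factor \<open>(1 - p) ^ card E\<close> cancels in all averages.\<close>

definition fk_weight :: "'d::finite site set \<Rightarrow> real \<Rightarrow> 'd edge set \<Rightarrow> real" where
  "fk_weight V r X = r ^ card X * 2 ^ clusters V X"

text \<open>Restricting the configurations to the interval \<open>{L..M}\<close> expresses partial information: the edges
  of \<open>L\<close> are known to be open, and those outside \<open>M\<close> are known to be closed.\<close>

definition fk_sum ::
  "'d::finite site set \<Rightarrow> real \<Rightarrow> 'd edge set \<Rightarrow> 'd edge set \<Rightarrow> ('d edge set \<Rightarrow> real) \<Rightarrow> real" where
  "fk_sum V r L M f = (\<Sum>X\<in>{L..M}. fk_weight V r X * f X)"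

definition fk_mean ::
  "'d::finite site set \<Rightarrow> real \<Rightarrow> 'd edge set \<Rightarrow> 'd edge set \<Rightarrow> ('d edge set \<Rightarrow> real) \<Rightarrow> real" where
  "fk_mean V r L M f = fk_sum V r L M f / fk_sum V r L M (\<lambda>_. 1)"

lemma fk_weight_nonneg: "0 \<le> r \<Longrightarrow> 0 \<le> fk_weight V r X"
  by (simp add: fk_weight_def)

lemma fk_weight_pos: "0 < r \<Longrightarrow> 0 < fk_weight V r X"
  by (simp add: fk_weight_def)

lemma fk_sum_mono:
  assumes "0 \<le> r" "\<And>X. L \<subseteq> X \<Longrightarrow> X \<subseteq> M \<Longrightarrow> f X \<le> g X"
  shows "fk_sum V r L M f \<le> fk_sum V r L M g"
  unfolding fk_sum_def using assms
  by (intro sum_mono mult_left_mono fk_weight_nonneg) auto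

lemma fk_sum_cong:
  "(\<And>X. L \<subseteq> X \<Longrightarrow> X \<subseteq> M \<Longrightarrow> f X = g X) \<Longrightarrow> fk_sum V r L M f = fk_sum V r L M g"
  unfolding fk_sum_def by (intro sum.cong) auto

lemma fk_sum_add: "fk_sum V r L M (\<lambda>X. f X + g X) = fk_sum V r L M f + fk_sum V r L M g"
  by (simp add: fk_sum_def distrib_left sum.distrib)

lemma fk_sum_cmult: "fk_sum V r L M (\<lambda>X. c * f X) = c * fk_sum V r L M f"
  by (simp add: fk_sum_def sum_distrib_left mult_ac)

lemma fk_sum_nonneg: "0 \<le> r \<Longrightarrow> (\<And>X. 0 \<le> f X) \<Longrightarrow> 0 \<le> fk_sum V r L M f"
  unfolding fk_sum_def by (intro sum_nonneg mult_nonneg_nonneg fk_weight_nonneg)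

locale finite_graph =
  fixes V :: "'d::finite site set" and E :: "'d edge set"
  assumes graph: "finite_subgraph (V, E)"
begin

lemma finite_V: "finite V" and finite_E: "finite E"
  and endpoints_V: "e \<in> E \<Longrightarrow> endpoints e \<subseteq> V"
  using graph by (auto simp: finite_subgraph_def)

lemma finite_sub: "X \<subseteq> E \<Longrightarrow> finite X"
  by (rule finite_subset[OF _ finite_E])

lemma interval_subset: "M \<subseteq> E \<Longrightarrow> {L..M} \<subseteq> Pow E"
  by (metis PowI atLeastAtMost_iff subsetI subset_trans)

lemma finite_interval: "M \<subseteq> E \<Longrightarrow> finite {L..M}"
  by (rule finite_subset[OF interval_subset]) (auto simp: finite_E)

lemma cluster_subset: "X \<subseteq> E \<Longrightarrow> z \<in> V \<Longrightarrow> cluster X z \<subseteq> V"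
proof
  fix v assume "X \<subseteq> E" "z \<in> V" "v \<in> cluster X z"
  then have "(z, v) \<in> (open_adj (\<lambda>e. e \<in> X))\<^sup>*" "z \<in> V"
    by (simp_all add: mem_cluster conn_def)
  then show "v \<in> V"
  proof (induction rule: rtrancl_induct)
    case (step v w)
    then obtain e where "e \<in> X" "endpoints e = {v, w}"
      by (auto simp: open_adj_def)
    then show ?case
      using endpoints_V[of e] \<open>X \<subseteq> E\<close> by auto
  qed
qed

lemma finite_cluster: "X \<subseteq> E \<Longrightarrow> z \<in> V \<Longrightarrow> finite (cluster X z)"
  by (rule finite_subset[OF cluster_subset finite_V])

lemma fk_sum_pos:
  assumes "M \<subseteq> E" "L \<subseteq> M" "0 < r" "\<And>X. 0 < f X"
  shows "0 < fk_sum V r L M f"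
  unfolding fk_sum_def using assms
  by (intro sum_pos finite_interval mult_pos_pos fk_weight_pos) auto

lemma fk_sum_pos_empty:
  assumes "M \<subseteq> E" "0 \<le> r"
  shows "0 < fk_sum V r {} M (\<lambda>_. 1)"
proof -
  have "0 < fk_weight V r {}" by (simp add: fk_weight_def)
  also have "\<dots> \<le> fk_sum V r {} M (\<lambda>_. 1)"
    unfolding fk_sum_def using assms finite_interval[of M "{}"]
    by (auto intro!: member_le_sum[of "{}" "{{}..M}" "\<lambda>X. fk_weight V r X"] fk_weight_nonneg)
  finally show ?thesis .
qed

lemma fk_weight_insert:
  assumes "e \<in> E" "X \<subseteq> E" "e \<notin> X" and e: "endpoints e = {x, y}"
  shows "fk_weight V r (insert e X) = r * (if (x, y) \<in> conn X then 1 else 1 / 2) * fk_weight V r X"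
proof -
  have "endpoints e \<subseteq> V" using assms endpoints_V by blast
  then show ?thesis
    using clusters_insert[OF finite_V e, of X] assms finite_sub[of X]
    by (auto simp: fk_weight_def)
qed

text \<open>The edges of \<open>X - Y\<close> move from the measure with odds \<open>r'\<close> to the one with the larger
  odds \<open>r\<close>, and the number of clusters is supermodular.\<close>

lemma fk_weight_lattice:
  assumes "0 \<le> r'" "r' \<le> r" "X \<subseteq> E" "Y \<subseteq> E"
  shows "fk_weight V r' X * fk_weight V r Y \<le> fk_weight V r (X \<union> Y) * fk_weight V r' (X \<inter> Y)"
proof -
  have fin: "finite X" "finite Y" using assms finite_sub by auto
  have "card X = card ((X \<inter> Y) \<union> (X - Y))" "card (X \<union> Y) = card (Y \<union> (X - Y))"
    by (auto intro: arg_cong[where f = card])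
  then have cards: "card X = card (X \<inter> Y) + card (X - Y)" "card (X \<union> Y) = card Y + card (X - Y)"
    using fin by (simp_all only:) (intro card_Un_disjoint; auto)+
  have "r' ^ card (X - Y) \<le> r ^ card (X - Y)"
    using assms by (intro power_mono)
  then have "r' ^ card X * r ^ card Y \<le> r ^ card (X \<union> Y) * r' ^ card (X \<inter> Y)"
    using assms unfolding cards by (simp add: power_add mult_ac mult_left_mono mult_right_mono)
  moreover have "clusters V X + clusters V Y \<le> clusters V (X \<union> Y) + clusters V (X \<inter> Y)"
    using fin(1) finite_V endpoints_V subsetD[OF assms(3)] by (intro clusters_supermodular) simp_all
  then have "(2::real) ^ (clusters V X + clusters V Y) \<le> 2 ^ (clusters V (X \<union> Y) + clusters V (X \<inter> Y))"
    by (intro power_increasing) auto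
  ultimately have "(r' ^ card X * r ^ card Y) * (2::real) ^ (clusters V X + clusters V Y)
      \<le> (r ^ card (X \<union> Y) * r' ^ card (X \<inter> Y)) * 2 ^ (clusters V (X \<union> Y) + clusters V (X \<inter> Y))"
    by (rule mult_mono) (use assms in auto)
  then show ?thesis
    by (simp add: fk_weight_def power_add mult_ac)
qed

lemma fk_sum_Pow:
  assumes "M \<subseteq> E"
  shows "fk_sum V r L M f = (\<Sum>X\<in>Pow E. (if L \<subseteq> X \<and> X \<subseteq> M then fk_weight V r X else 0) * f X)"
  unfolding fk_sum_def using interval_subset[OF assms] finite_E
  by (intro sum.mono_neutral_cong_left) auto

text \<open>Larger odds, more edges known to be open and fewer edges known to be closed all favour increasing
  functions. One application of Holley's inequality covers the three: a restriction to an interval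
  is a weight that vanishes outside it, and \<open>{L'..M'}\<close> lies below \<open>{L..M}\<close> in the lattice order.\<close>

lemma fk_sum_compare:
  assumes "M \<subseteq> E" "M' \<subseteq> M" "L' \<subseteq> L" "0 \<le> r'" "r' \<le> r"
    and "\<And>X. 0 \<le> f X" and "\<And>X Y. X \<subseteq> Y \<Longrightarrow> f X \<le> f Y"
  shows "fk_sum V r' L' M' f * fk_sum V r L M (\<lambda>_. 1)
    \<le> fk_sum V r L M f * fk_sum V r' L' M' (\<lambda>_. 1)"
proof -
  have M': "M' \<subseteq> E" using assms by auto
  show ?thesis
    unfolding fk_sum_Pow[OF assms(1)] fk_sum_Pow[OF M'] mult_1_right
  proof (rule holley)
    fix X Y assume "X \<subseteq> E" "Y \<subseteq> E"
    then show "(if L' \<subseteq> X \<and> X \<subseteq> M' then fk_weight V r' X else 0)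
          * (if L \<subseteq> Y \<and> Y \<subseteq> M then fk_weight V r Y else 0)
        \<le> (if L \<subseteq> X \<union> Y \<and> X \<union> Y \<subseteq> M then fk_weight V r (X \<union> Y) else 0)
          * (if L' \<subseteq> X \<inter> Y \<and> X \<inter> Y \<subseteq> M' then fk_weight V r' (X \<inter> Y) else 0)"
      using fk_weight_lattice[of r' r X Y] assms
      by (auto intro!: mult_nonneg_nonneg fk_weight_nonneg)
  qed (use assms finite_E in \<open>auto intro: fk_weight_nonneg\<close>)
qed

lemma fk_mean_mono:
  assumes "M \<subseteq> E" "M' \<subseteq> M" "L' \<subseteq> L" "0 \<le> r'" "r' \<le> r"
    and "\<And>X. 0 \<le> f X" and "\<And>X Y. X \<subseteq> Y \<Longrightarrow> f X \<le> f Y"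
    and "0 < fk_sum V r L M (\<lambda>_. 1)" "0 < fk_sum V r' L' M' (\<lambda>_. 1)"
  shows "fk_mean V r' L' M' f \<le> fk_mean V r L M f"
  using fk_sum_compare[where f = f, OF assms(1-7)] assms(8,9)
  by (simp add: fk_mean_def divide_simps mult_ac)

lemma fk_mean_le_max:
  assumes "M \<subseteq> E" "0 \<le> r" "0 < fk_sum V r L M (\<lambda>_. 1)"
    and "\<And>X. L \<subseteq> X \<Longrightarrow> X \<subseteq> M \<Longrightarrow> f X \<le> c"
  shows "fk_mean V r L M f \<le> c"
proof -
  have "fk_sum V r L M f \<le> fk_sum V r L M (\<lambda>X. c * 1)"
    using assms by (intro fk_sum_mono) auto
  then show ?thesis
    using assms(3) by (simp add: fk_mean_def fk_sum_cmult divide_simps del: mult_1_right)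
qed

section \<open>Exploring a cluster\<close>

text \<open>The open edges that are found when the cluster of \<open>z\<close> is explored.\<close>

definition core :: "'d site \<Rightarrow> 'd edge set \<Rightarrow> 'd edge set" where
  "core z X = {f \<in> X. endpoints f \<inter> cluster X z \<noteq> {}}"

lemma cluster_core: "cluster (core z X) z = cluster X z"
proof (rule cluster_eqI[symmetric])
  show sub: "core z X \<subseteq> X" by (auto simp: core_def)
  show "endpoints e \<inter> cluster (core z X) z = {}" if "e \<in> X - core z X" for e
    using that cluster_mono[OF sub, of z] by (auto simp: core_def)
qed

lemma endpoints_core: "e \<in> core z X \<Longrightarrow> endpoints e \<subseteq> cluster X z"
proof -
  assume "e \<in> core z X"
  then have e: "e \<in> X" "endpoints e \<inter> cluster X z \<noteq> {}" by (auto simp: core_def)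
  obtain x y where xy: "endpoints e = {x, y}" by (rule endpoints_doubleton)
  have "(x, y) \<in> conn X" "(y, x) \<in> conn X"
    using conn_edge[OF e(1)] xy by (auto intro: conn_sym)
  then show ?thesis
    using e(2) conn_trans unfolding xy by (auto simp: mem_cluster)
qed

text \<open>Here \<open>T\<close> is a possible value of the core of \<open>z\<close>, and \<open>U\<close> contains the edges whose state
  is not determined by the event that the core is \<open>T\<close>.\<close>

context
  fixes z :: "'d site" and T U :: "'d edge set"
  assumes T_E: "T \<subseteq> E" and U_E: "U \<subseteq> E"
    and T_in: "\<And>e. e \<in> T \<Longrightarrow> endpoints e \<subseteq> cluster T z"
    and U_out: "\<And>e. e \<in> U \<Longrightarrow> endpoints e \<inter> cluster T z = {}"
begin

lemma cluster_inside: "B \<subseteq> U \<Longrightarrow> cluster (T \<union> B) z = cluster T z"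
  using U_out by (intro cluster_eqI) auto

lemma cluster_outside:
  assumes B: "B \<subseteq> U" and u: "u \<notin> cluster T z"
  shows "cluster (T \<union> B) u = cluster B u"
proof (rule cluster_eqI)
  fix e assume "e \<in> T \<union> B - B"
  then have "endpoints e \<subseteq> cluster T z" using T_in[of e] by blast
  moreover have "cluster T z \<inter> cluster (T \<union> B) u = {}"
    using disjoint_clusters[of u "T \<union> B" z] cluster_inside[OF B] u by simp
  moreover have "cluster B u \<subseteq> cluster (T \<union> B) u"
    by (rule cluster_mono) auto
  ultimately show "endpoints e \<inter> cluster B u = {}" by blast
qed auto

lemma T_U_disjoint: "T \<inter> U = {}"
proof -
  have False if "e \<in> T" "e \<in> U" for e
    using T_in[OF that(1)] U_out[OF that(2)] by (auto simp: endpoints_def)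
  then show ?thesis by auto
qed

lemma clusters_union:
  assumes "B \<subseteq> U"
  shows "clusters V (T \<union> B) + card V = clusters V T + clusters V B"
proof -
  have "finite B" using assms U_E finite_sub by blast
  then show ?thesis using assms
  proof (induction B rule: finite_induct)
    case (insert e B)
    obtain x y where e: "endpoints e = {x, y}" by (rule endpoints_doubleton)
    have eV: "endpoints e \<subseteq> V" using insert.prems U_E endpoints_V[of e] by auto
    have "x \<notin> cluster T z" using U_out[of e] e insert.prems by auto
    then have "(x, y) \<in> conn (T \<union> B) \<longleftrightarrow> (x, y) \<in> conn B"
      using cluster_outside[of B x] insert.prems by (auto simp: mem_cluster[symmetric])
    then show ?case
      using clusters_insert[OF finite_V e eV, of "T \<union> B"] clusters_insert[OF finite_V e eV, of B] insert
      by (auto split: if_splits)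
  qed (simp add: clusters_empty)
qed

text \<open>The spatial Markov property: given the core, the other edges carry the random-cluster weight of the
  graph outside the cluster, with free boundary conditions.\<close>

lemma fk_weight_union:
  assumes "B \<subseteq> U"
  shows "fk_weight V r (T \<union> B) = fk_weight V r T / 2 ^ card V * fk_weight V r B"
proof -
  have "card (T \<union> B) = card T + card B"
    using T_U_disjoint assms finite_sub[OF T_E] finite_sub[of B] U_E by (intro card_Un_disjoint) auto
  moreover have "(2::real) ^ clusters V (T \<union> B) * 2 ^ card V = 2 ^ clusters V T * 2 ^ clusters V B"
    unfolding power_add[symmetric] clusters_union[OF assms] ..
  ultimately show ?thesis
    by (simp add: fk_weight_def power_add field_simps)
qed

end

text \<open>Grouping the configurations by the core of \<open>z\<close> fixes the cluster of \<open>z\<close>. If \<open>y\<close> is outside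
  it, then the cluster of \<open>y\<close> is that of a free random-cluster measure on a smaller graph, so
  the hypothesis on \<open>q\<close> applies in each group.\<close>

lemma tilt_outside_cluster:
  assumes LM: "L \<subseteq> M" "M \<subseteq> E" and L: "\<And>e. e \<in> L \<Longrightarrow> endpoints e \<subseteq> cluster L z"
    and r: "0 < r" and s: "0 < s" and y: "y \<in> V"
    and q: "\<And>U. U \<subseteq> E \<Longrightarrow>
      q * fk_sum V r {} U (\<lambda>_. 1) \<le> fk_sum V r {} U (\<lambda>X. s ^ card (cluster X y))"
  shows "q * fk_sum V r L M (\<lambda>X. of_bool (y \<notin> cluster X z) * s ^ card (cluster X z))
    \<le> fk_sum V r L M
         (\<lambda>X. of_bool (y \<notin> cluster X z) * s ^ card (cluster X z) * s ^ card (cluster X y))"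
proof -
  define S where "S = {X \<in> {L..M}. y \<notin> cluster X z}"
  have finS: "finite S"
    by (rule finite_subset[OF _ finite_interval[OF LM(2), of L]]) (auto simp: S_def)
  have as_sum: "fk_sum V r L M (\<lambda>X. of_bool (y \<notin> cluster X z) * g X)
      = (\<Sum>T\<in>core z ` S. \<Sum>X | X \<in> S \<and> core z X = T. fk_weight V r X * g X)" for g
  proof -
    have "fk_sum V r L M (\<lambda>X. of_bool (y \<notin> cluster X z) * g X) = (\<Sum>X\<in>S. fk_weight V r X * g X)"
      unfolding fk_sum_def S_def using finite_interval[OF LM(2)]
      by (intro sum.mono_neutral_cong_right) auto
    also have "\<dots> = (\<Sum>T\<in>core z ` S. \<Sum>X | X \<in> S \<and> core z X = T. fk_weight V r X * g X)"
      by (rule sum.image_gen[OF finS])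
    finally show ?thesis .
  qed
  have fiber: "q * (\<Sum>X | X \<in> S \<and> core z X = T. fk_weight V r X * s ^ card (cluster X z))
      \<le> (\<Sum>X | X \<in> S \<and> core z X = T.
            fk_weight V r X * (s ^ card (cluster X z) * s ^ card (cluster X y)))"
    if T_core: "T \<in> core z ` S" for T
  proof -
    obtain X0 where "X0 \<in> S" and T: "T = core z X0"
      using T_core by blast
    then have X0: "L \<subseteq> X0" "X0 \<subseteq> M" "y \<notin> cluster X0 z"
      by (simp_all add: S_def)
    have cT: "cluster T z = cluster X0 z" unfolding T by (rule cluster_core)
    define U where "U = {f \<in> M. endpoints f \<inter> cluster T z = {}}"
    have T_E: "T \<subseteq> E" and T_M: "T \<subseteq> M" using X0 LM unfolding T core_def by auto
    have U_E: "U \<subseteq> E" using LM unfolding U_def by auto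
    have T_in: "endpoints e \<subseteq> cluster T z" if "e \<in> T" for e
      using endpoints_core that cT unfolding T by auto
    have U_out: "endpoints e \<inter> cluster T z = {}" if "e \<in> U" for e
      using that by (simp add: U_def)
    note ctx = T_E U_E T_in U_out
    have L_T: "L \<subseteq> T"
    proof
      fix e assume "e \<in> L"
      then have "endpoints e \<subseteq> cluster X0 z" "e \<in> X0"
        using L[of e] X0(1) cluster_mono[OF X0(1), of z] by auto
      then show "e \<in> T" unfolding T core_def by (auto simp: endpoints_def)
    qed
    have yT: "y \<notin> cluster T z" using X0 cT by simp
    have bij: "bij_betw (\<lambda>B. T \<union> B) (Pow U) {X. X \<in> S \<and> core z X = T}"
    proof (rule bij_betw_byWitness[where f' = "\<lambda>X. X - T"])
      show "\<forall>B\<in>Pow U. T \<union> B - T = B"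
        using T_U_disjoint[OF ctx] by auto
      show "\<forall>X\<in>{X. X \<in> S \<and> core z X = T}. T \<union> (X - T) = X"
        by (auto simp: core_def)
      show "(\<lambda>B. T \<union> B) ` Pow U \<subseteq> {X. X \<in> S \<and> core z X = T}"
      proof safe
        fix B assume B: "B \<subseteq> U"
        have c: "cluster (T \<union> B) z = cluster T z" by (rule cluster_inside[OF ctx B])
        then show "T \<union> B \<in> S"
          using L_T T_M B yT by (auto simp: S_def U_def)
        have "endpoints e \<noteq> {}" for e :: "'d edge" by (simp add: endpoints_def)
        then show "e \<in> T" if "e \<in> core z (T \<union> B)" for e
          using that B U_out[of e] unfolding core_def c by blast
        show "e \<in> core z (T \<union> B)" if "e \<in> T" for e
          using T_in[OF that] that \<open>endpoints e \<noteq> {}\<close> unfolding core_def c by blast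
      qed
      show "(\<lambda>X. X - T) ` {X. X \<in> S \<and> core z X = T} \<subseteq> Pow U"
      proof safe
        fix X e assume X: "X \<in> S" "T = core z X" "e \<in> X" "e \<notin> core z X"
        then have "endpoints e \<inter> cluster X z = {}" "e \<in> M" by (auto simp: core_def S_def)
        then show "e \<in> U" unfolding U_def X(2) cluster_core by simp
      qed
    qed
    define c where "c = fk_weight V r T / 2 ^ card V * s ^ card (cluster T z)"
    have sums: "(\<Sum>X | X \<in> S \<and> core z X = T. fk_weight V r X * (s ^ card (cluster X z) * h (cluster X y)))
        = c * fk_sum V r {} U (\<lambda>X. h (cluster X y))" for h
    proof -
      have "(\<Sum>X | X \<in> S \<and> core z X = T. fk_weight V r X * (s ^ card (cluster X z) * h (cluster X y)))
          = (\<Sum>B\<in>Pow U. fk_weight V r (T \<union> B) * (s ^ card (cluster (T \<union> B) z) * h (cluster (T \<union> B) y)))"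
        by (rule sum.reindex_bij_betw[OF bij, symmetric])
      also have "\<dots> = (\<Sum>B\<in>Pow U. c * (fk_weight V r B * h (cluster B y)))"
        by (intro sum.cong refl)
          (simp add: c_def fk_weight_union[OF ctx] cluster_inside[OF ctx] cluster_outside[OF ctx _ yT])
      also have "\<dots> = c * fk_sum V r {} U (\<lambda>X. h (cluster X y))"
        by (simp add: fk_sum_def sum_distrib_left Pow_def atLeastAtMost_def atLeast_def atMost_def)
      finally show ?thesis .
    qed
    have "0 \<le> c" using r s by (simp add: c_def fk_weight_nonneg)
    have "c * (q * fk_sum V r {} U (\<lambda>_. 1)) \<le> c * fk_sum V r {} U (\<lambda>X. s ^ card (cluster X y))"
      using \<open>0 \<le> c\<close> q[OF U_E] by (rule mult_left_mono[rotated])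
    then show ?thesis
      using sums[of "\<lambda>_. 1"] sums[of "\<lambda>C. s ^ card C"] by (simp add: mult_ac)
  qed
  show ?thesis
    unfolding mult.assoc as_sum
    by (subst sum_distrib_left) (intro sum_mono fiber)
qed

end

text \<open>The index tells whether an edge is closed or open, the small letters are unnormalized means and
  the capital letters are total weights. If the second measure has the larger conditional means and
  gives larger odds to the case with the larger mean, then it has the larger mean.\<close>

lemma weighted_average_le:
  fixes a0 a1 A0 A1 b0 b1 B0 B1 :: real
  assumes pos: "0 < A0" "0 < A1" "0 < B0" "0 < B1"
    and "a0 / A0 \<le> b0 / B0" "a1 / A1 \<le> b1 / B1" "a0 / A0 \<le> a1 / A1" "A1 / A0 \<le> B1 / B0"
  shows "(a0 + a1) / (A0 + A1) \<le> (b0 + b1) / (B0 + B1)"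
proof -
  define m0 m1 where "m0 = a0 / A0" and "m1 = a1 / A1"
  have a: "a0 = m0 * A0" "a1 = m1 * A1"
    using pos by (simp_all add: m0_def m1_def)
  have "m0 * B0 \<le> b0" "m1 * B1 \<le> b1"
    using assms by (simp_all add: m0_def m1_def le_divide_eq)
  then have b: "m0 * B0 + m1 * B1 \<le> b0 + b1"
    by simp
  have AB: "A1 * B0 \<le> B1 * A0"
    using assms by (simp add: divide_simps)
  have "(m1 - m0) * (A1 * B0) \<le> (m1 - m0) * (B1 * A0)"
    using AB assms by (intro mult_left_mono) (auto simp: m0_def m1_def)
  then have "(m0 * A0 + m1 * A1) * (B0 + B1) \<le> (m0 * B0 + m1 * B1) * (A0 + A1)"
    by (simp add: algebra_simps)
  also have "\<dots> \<le> (b0 + b1) * (A0 + A1)"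
    using b pos by (intro mult_right_mono) auto
  finally show ?thesis
    using pos by (simp add: a divide_simps)
qed

context finite_graph
begin

lemma fk_sum_split:
  assumes "L \<subseteq> M" "M \<subseteq> E" "e \<in> M" "e \<notin> L"
  shows "fk_sum V r L M f = fk_sum V r L (M - {e}) f + fk_sum V r (insert e L) M f"
proof -
  have un: "{L..M} = {L..M - {e}} \<union> {insert e L..M}"
    and dj: "{L..M - {e}} \<inter> {insert e L..M} = {}"
    using assms by auto
  have "M - {e} \<subseteq> E" using assms by auto
  then show ?thesis
    unfolding fk_sum_def un by (intro sum.union_disjoint finite_interval assms dj)
qed

lemma fk_sum_open:
  assumes "M \<subseteq> E" "e \<in> M" "e \<notin> L" and e: "endpoints e = {x, y}"
  shows "fk_sum V r (insert e L) M f
    = r * fk_sum V r L (M - {e}) (\<lambda>X. (if (x, y) \<in> conn X then 1 else 1 / 2) * f (insert e X))"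
proof -
  have bij: "bij_betw (insert e) {L..M - {e}} {insert e L..M}"
    by (rule bij_betw_byWitness[where f' = "\<lambda>X. X - {e}"]) (use assms in auto)
  have "fk_sum V r (insert e L) M f = (\<Sum>X\<in>{L..M - {e}}. fk_weight V r (insert e X) * f (insert e X))"
    unfolding fk_sum_def by (rule sum.reindex_bij_betw[OF bij, symmetric])
  also have "\<dots> = (\<Sum>X\<in>{L..M - {e}}.
      r * (fk_weight V r X * ((if (x, y) \<in> conn X then 1 else 1 / 2) * f (insert e X))))"
  proof (rule sum.cong)
    fix X assume "X \<in> {L..M - {e}}"
    then have "X \<subseteq> E" "e \<notin> X" "e \<in> E" using assms by auto
    then show "fk_weight V r (insert e X) * f (insert e X)
        = r * (fk_weight V r X * ((if (x, y) \<in> conn X then 1 else 1 / 2) * f (insert e X)))"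
      using fk_weight_insert[OF _ _ _ e] by simp
  qed simp
  finally show ?thesis
    by (simp add: fk_sum_def sum_distrib_left)
qed

text \<open>The measure with odds \<open>r\<close>, weighted by \<open>s ^ card (cluster X z)\<close>, still dominates the measure
  with odds \<open>r q\<close> on increasing functions of the cluster of \<open>z\<close>. The proof reveals the edges
  that touch the known part of the cluster one at a time. Opening such an edge costs the weight of
  the cluster of its other endpoint, and this is at least \<open>q\<close> on average because only clusters in
  smaller free graphs are involved. Holley's inequality does not apply directly: given the states of
  all other edges, the cost of an edge has no such bound. The order of exploration matters.

  A random-cluster edge counts half if it joins two clusters, so the comparison of the odds of an
  edge needs a lower bound on the probability that its endpoints are connected without it. That is
  again an increasing function of the cluster, to which the induction hypothesis applies. This is
  why the statement is about all such functions at once.\<close>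

theorem exploration_domination:
  fixes r s q :: real and z :: "'d site" and \<phi> :: "'d site set \<Rightarrow> real"
  assumes r: "0 < r" and s: "0 < s" and q: "0 < q" "q \<le> 1" and z: "z \<in> V"
    and lower: "\<And>U y. U \<subseteq> E \<Longrightarrow> y \<in> V \<Longrightarrow>
      q * fk_sum V r {} U (\<lambda>_. 1) \<le> fk_sum V r {} U (\<lambda>X. s ^ card (cluster X y))"
    and "L \<subseteq> M" "M \<subseteq> E" and "\<And>e. e \<in> L \<Longrightarrow> endpoints e \<subseteq> cluster L z"
    and "\<And>C. 0 \<le> \<phi> C" and "\<And>C D. C \<subseteq> D \<Longrightarrow> \<phi> C \<le> \<phi> D"
  shows "fk_mean V (r * q) L M (\<lambda>X. \<phi> (cluster X z))
    \<le> fk_sum V r L M (\<lambda>X. s ^ card (cluster X z) * \<phi> (cluster X z))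
      / fk_sum V r L M (\<lambda>X. s ^ card (cluster X z))"
  using assms(7-)
proof (induction "card (M - L)" arbitrary: L M \<phi> rule: less_induct)
  case less
  note LM = less.prems(1,2) and L_in = less.prems(3) and \<phi> = less.prems(4,5)
  have rq: "0 < r * q" using r q by simp
  define S where "S = fk_sum V (r * q)"
  define T where "T = (\<lambda>L M f. fk_sum V r L M (\<lambda>X. s ^ card (cluster X z) * f X))"
  have S_pos: "0 < S L' M' (\<lambda>_. 1)" and T_pos: "0 < T L' M' (\<lambda>_. 1)"
    if "L' \<subseteq> M'" "M' \<subseteq> E" for L' M'
    unfolding S_def T_def using that rq r s by (auto intro!: fk_sum_pos)
  have IH: "S L' M' (\<lambda>X. \<psi> (cluster X z)) / S L' M' (\<lambda>_. 1)
      \<le> T L' M' (\<lambda>X. \<psi> (cluster X z)) / T L' M' (\<lambda>_. 1)"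
    if "card (M' - L') < card (M - L)" "L' \<subseteq> M'" "M' \<subseteq> E"
      "\<And>e. e \<in> L' \<Longrightarrow> endpoints e \<subseteq> cluster L' z"
      "\<And>C. 0 \<le> \<psi> C" "\<And>C D. C \<subseteq> D \<Longrightarrow> \<psi> C \<le> \<psi> D" for L' M' \<psi>
    using less.hyps[of M' L' \<psi>] that unfolding S_def T_def fk_mean_def by simp
  show ?case
  proof (cases "\<exists>e\<in>M - L. endpoints e \<inter> cluster L z \<noteq> {}")
    case False
    \<comment> \<open>The cluster of \<open>z\<close> is completely explored.\<close>
    have eq: "\<phi> (cluster X z) = \<phi> (cluster L z)" if "L \<subseteq> X" "X \<subseteq> M" for X
      using that False by (intro arg_cong[where f = \<phi>] cluster_eqI) auto
    have "S L M (\<lambda>X. \<phi> (cluster X z)) = S L M (\<lambda>X. \<phi> (cluster L z) * 1)"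
      unfolding S_def mult_1_right by (intro fk_sum_cong eq)
    moreover have "T L M (\<lambda>X. \<phi> (cluster X z))
        = fk_sum V r L M (\<lambda>X. \<phi> (cluster L z) * s ^ card (cluster X z))"
      unfolding T_def mult.commute[of "\<phi> (cluster L z)"]
      by (intro fk_sum_cong arg_cong2[where f = "(*)"] refl eq)
    ultimately show ?thesis
      using S_pos[OF LM] T_pos[OF LM] unfolding fk_mean_def S_def T_def fk_sum_cmult by simp
  next
    case True
    then obtain e where e: "e \<in> M" "e \<notin> L" and touch: "endpoints e \<inter> cluster L z \<noteq> {}"
      by auto
    obtain x y where xy: "endpoints e = {x, y}" and x: "x \<in> cluster L z"
    proof -
      obtain u v where uv: "endpoints e = {u, v}" by (rule endpoints_doubleton)
      with touch consider "u \<in> cluster L z" | "v \<in> cluster L z" by auto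
      then show thesis
        by cases (use that[of u v] that[of v u] uv in \<open>simp_all add: insert_commute\<close>)
    qed
    have y: "y \<in> V" using endpoints_V[of e] e LM xy by auto
    define M0 where "M0 = M - {e}"
    define L1 where "L1 = insert e L"
    have M0: "L \<subseteq> M0" "M0 \<subseteq> E" and L1: "L1 \<subseteq> M" "M \<subseteq> E"
      using LM e by (auto simp: M0_def L1_def)
    have fin: "finite (M - L)" using LM finite_sub by blast
    have small: "card (M0 - L) < card (M - L)" "card (M - L1) < card (M - L)"
      unfolding M0_def L1_def by (rule psubset_card_mono; use fin e in auto)+
    have L1_in: "endpoints f \<subseteq> cluster L1 z" if "f \<in> L1" for f
      using that L_in[of f] xy x unfolding L1_def cluster_insert[OF xy x] by auto
    have xX: "x \<in> cluster X z" if "L \<subseteq> X" for X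
      using x cluster_mono[OF that] by blast
    have joined: "(x, y) \<in> conn X \<longleftrightarrow> y \<in> cluster X z" if "L \<subseteq> X" for X
      using xX[OF that] conn_trans[of z x X y] conn_trans[of x z X y] conn_sym[of z x X]
      unfolding mem_cluster by blast
    define half where "half X = (if y \<in> cluster X z then 1 else 1 / 2 :: real)" for X
    let ?in = "\<lambda>X. of_bool (y \<in> cluster X z) :: real"
    have half: "half X = 1 / 2 * (1 + ?in X)" for X
      by (simp add: half_def)
    \<comment> \<open>Opening \<open>e\<close> removes a cluster unless \<open>y\<close> is already in the cluster of \<open>z\<close>.\<close>
    have "S L1 M (\<lambda>_. 1) = r * q * S L M0 half"
      unfolding S_def L1_def M0_def half_def
        fk_sum_open[OF LM(2) e xy]
      by (auto intro!: fk_sum_cong arg_cong[where f = "\<lambda>t. r * q * t"] simp: joined)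
    then have A1: "S L1 M (\<lambda>_. 1) = r * q / 2 * (S L M0 (\<lambda>_. 1) + S L M0 ?in)"
      unfolding S_def half fk_sum_cmult fk_sum_add by simp
    \<comment> \<open>In the weighted measure it also adds all of the cluster of \<open>y\<close>.\<close>
    have "T L1 M (\<lambda>_. 1) = r * fk_sum V r L M0 (\<lambda>X. ?in X * s ^ card (cluster X z)
        + 1 / 2 * (of_bool (y \<notin> cluster X z) * s ^ card (cluster X z) * s ^ card (cluster X y)))"
    proof -
      have "(if (x, y) \<in> conn X then 1 else 1 / 2) * s ^ card (cluster (insert e X) z)
        = ?in X * s ^ card (cluster X z)
          + 1 / 2 * (of_bool (y \<notin> cluster X z) * s ^ card (cluster X z) * s ^ card (cluster X y))"
        if X: "L \<subseteq> X" "X \<subseteq> M - {e}" for X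
      proof (cases "y \<in> cluster X z")
        case True
        then have "cluster (insert e X) z = cluster X z"
          unfolding cluster_insert[OF xy xX[OF X(1)]]
          using conn_trans[of z y X] by (auto simp: mem_cluster)
        then show ?thesis using True joined[OF X(1)] by simp
      next
        case False
        have "X \<subseteq> E" using X LM by auto
        then have "card (cluster (insert e X) z) = card (cluster X z) + card (cluster X y)"
          unfolding cluster_insert[OF xy xX[OF X(1)]]
          using disjoint_clusters[OF False] finite_cluster z y by (intro card_Un_disjoint) auto
        then show ?thesis using False joined[OF X(1)] by (simp add: power_add)
      qed
      then show ?thesis
        unfolding T_def L1_def M0_def fk_sum_open[OF LM(2) e xy] mult_1_right
        by (intro arg_cong[where f = "\<lambda>t. r * t"] fk_sum_cong)
    qed
    then have T1: "T L1 M (\<lambda>_. 1) = r * (fk_sum V r L M0 (\<lambda>X. ?in X * s ^ card (cluster X z))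
        + 1 / 2 * fk_sum V r L M0
            (\<lambda>X. of_bool (y \<notin> cluster X z) * s ^ card (cluster X z) * s ^ card (cluster X y)))"
      unfolding fk_sum_add fk_sum_cmult .
    have in_out: "T L M0 (\<lambda>_. 1) = T L M0 ?in
        + fk_sum V r L M0 (\<lambda>X. of_bool (y \<notin> cluster X z) * s ^ card (cluster X z))"
      unfolding T_def fk_sum_add[symmetric] by (intro fk_sum_cong) auto
    have T_in: "fk_sum V r L M0 (\<lambda>X. ?in X * s ^ card (cluster X z)) = T L M0 ?in"
      unfolding T_def by (simp add: mult.commute)
    have out: "q * fk_sum V r L M0 (\<lambda>X. of_bool (y \<notin> cluster X z) * s ^ card (cluster X z))
        \<le> fk_sum V r L M0
            (\<lambda>X. of_bool (y \<notin> cluster X z) * s ^ card (cluster X z) * s ^ card (cluster X y))"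
      by (rule tilt_outside_cluster) (use M0 L_in r s y lower in auto)
    have "0 \<le> T L M0 ?in"
      unfolding T_def using r s by (intro fk_sum_nonneg) auto
    then have "q * T L M0 ?in \<le> T L M0 ?in"
      using q by (simp add: mult_left_le_one_le)
    with out have "r * (q * T L M0 ?in
        + 1 / 2 * (q * fk_sum V r L M0 (\<lambda>X. of_bool (y \<notin> cluster X z) * s ^ card (cluster X z))))
      \<le> T L1 M (\<lambda>_. 1)"
      unfolding T1 T_in using r by (intro mult_left_mono add_mono) auto
    then have B1: "r * q / 2 * (T L M0 (\<lambda>_. 1) + T L M0 ?in) \<le> T L1 M (\<lambda>_. 1)"
      unfolding in_out by (simp add: algebra_simps)
    \<comment> \<open>Both odds are now increasing in the probability that \<open>y\<close> is reached without \<open>e\<close>.\<close>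
    have "S L M0 ?in / S L M0 (\<lambda>_. 1) \<le> T L M0 ?in / T L M0 (\<lambda>_. 1)"
      by (rule IH[where \<psi> = "\<lambda>C. of_bool (y \<in> C)"]) (use small M0 L_in in auto)
    then have "r * q / 2 * (1 + S L M0 ?in / S L M0 (\<lambda>_. 1))
        \<le> r * q / 2 * (1 + T L M0 ?in / T L M0 (\<lambda>_. 1))"
      using rq by (intro mult_left_mono) auto
    also have "\<dots> = r * q / 2 * (T L M0 (\<lambda>_. 1) + T L M0 ?in) / T L M0 (\<lambda>_. 1)"
      using T_pos[OF M0] by (simp add: field_simps)
    also have "\<dots> \<le> T L1 M (\<lambda>_. 1) / T L M0 (\<lambda>_. 1)"
      using B1 T_pos[OF M0] by (intro divide_right_mono) auto
    finally have odds: "S L1 M (\<lambda>_. 1) / S L M0 (\<lambda>_. 1) \<le> T L1 M (\<lambda>_. 1) / T L M0 (\<lambda>_. 1)"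
      unfolding A1 using S_pos[OF M0] by (simp add: field_simps)
    let ?f = "\<lambda>X. \<phi> (cluster X z)"
    have "(S L M0 ?f + S L1 M ?f) / (S L M0 (\<lambda>_. 1) + S L1 M (\<lambda>_. 1))
        \<le> (T L M0 ?f + T L1 M ?f) / (T L M0 (\<lambda>_. 1) + T L1 M (\<lambda>_. 1))"
    proof (rule weighted_average_le)
      show "S L M0 ?f / S L M0 (\<lambda>_. 1) \<le> T L M0 ?f / T L M0 (\<lambda>_. 1)"
        by (rule IH) (use small M0 L_in \<phi> in auto)
      show "S L1 M ?f / S L1 M (\<lambda>_. 1) \<le> T L1 M ?f / T L1 M (\<lambda>_. 1)"
        by (rule IH) (use small L1 L1_in \<phi> in auto)
      have "fk_mean V (r * q) L M0 ?f \<le> fk_mean V (r * q) L1 M ?f"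
      proof (rule fk_mean_mono)
        show "?f X \<le> ?f Y" if "X \<subseteq> Y" for X Y
          by (rule \<phi>(2)) (rule cluster_mono[OF that])
      qed (use S_pos[OF M0] S_pos[OF L1] rq LM \<phi> in \<open>auto simp: S_def M0_def L1_def\<close>)
      then show "S L M0 ?f / S L M0 (\<lambda>_. 1) \<le> S L1 M ?f / S L1 M (\<lambda>_. 1)"
        by (simp add: fk_mean_def S_def)
    qed (use S_pos T_pos M0 L1 odds in auto)
    then show ?thesis
      unfolding fk_mean_def S_def T_def M0_def L1_def
      by (simp add: fk_sum_split[OF LM e])
  qed
qed

end

section \<open>Tails of cluster sizes\<close>

context finite_graph
begin

text \<open>If clusters in all subgraphs have size at least \<open>k\<close> with probability at most \<open>\<epsilon>\<close>, then
  \<open>q = (1 - \<epsilon>) s ^ k\<close> is a lower bound for the mean of \<open>s ^ card (cluster X y)\<close>. In the weighted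
  measure that dominates, a cluster of size \<open>n\<close> has weight at most \<open>s ^ n\<close>, and the total
  weight is at least \<open>q\<close>.\<close>

theorem cluster_tail:
  fixes r s \<epsilon> :: real and k n :: nat
  assumes r: "0 < r" and s: "0 < s" "s \<le> 1" and \<epsilon>: "0 \<le> \<epsilon>" "\<epsilon> < 1" and z: "z \<in> V"
    and tail: "\<And>U y. U \<subseteq> E \<Longrightarrow> y \<in> V \<Longrightarrow>
      fk_mean V r {} U (\<lambda>X. of_bool (k \<le> card (cluster X y))) \<le> \<epsilon>"
  shows "fk_mean V (r * ((1 - \<epsilon>) * s ^ k)) {} E (\<lambda>X. of_bool (n \<le> card (cluster X z)))
    \<le> s ^ n / ((1 - \<epsilon>) * s ^ k)"
proof -
  define q where "q = (1 - \<epsilon>) * s ^ k"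
  have q: "0 < q" "q \<le> 1"
    using s \<epsilon> by (auto simp: q_def intro!: mult_le_one power_le_one)
  have lower: "q * fk_sum V r {} U (\<lambda>_. 1) \<le> fk_sum V r {} U (\<lambda>X. s ^ card (cluster X y))"
    if U: "U \<subseteq> E" and y: "y \<in> V" for U y
  proof -
    let ?A = "\<lambda>X. of_bool (k \<le> card (cluster X y)) :: real"
    have pos: "0 < fk_sum V r {} U (\<lambda>_. 1)"
      using fk_sum_pos[OF U, of "{}" r "\<lambda>_. 1"] r by simp
    have "fk_sum V r {} U ?A \<le> \<epsilon> * fk_sum V r {} U (\<lambda>_. 1)"
      using tail[OF U y] pos by (simp add: fk_mean_def divide_le_eq)
    then have "(1 - \<epsilon>) * fk_sum V r {} U (\<lambda>_. 1) \<le> fk_sum V r {} U (\<lambda>_. 1) + (- 1) * fk_sum V r {} U ?A"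
      by (simp add: algebra_simps)
    also have "\<dots> = fk_sum V r {} U (\<lambda>X. 1 + (- 1) * ?A X)"
      by (simp only: fk_sum_add fk_sum_cmult)
    finally have "s ^ k * ((1 - \<epsilon>) * fk_sum V r {} U (\<lambda>_. 1))
        \<le> s ^ k * fk_sum V r {} U (\<lambda>X. 1 + (- 1) * ?A X)"
      using s by (intro mult_left_mono) auto
    also have "\<dots> = fk_sum V r {} U (\<lambda>X. s ^ k * (1 + (- 1) * ?A X))"
      by (simp only: fk_sum_cmult)
    also have "\<dots> \<le> fk_sum V r {} U (\<lambda>X. s ^ card (cluster X y))"
      using r s by (intro fk_sum_mono) (auto intro!: power_decreasing)
    finally show ?thesis by (simp add: q_def mult_ac)
  qed
  let ?T = "fk_sum V r {} E (\<lambda>X. s ^ card (cluster X z))"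
  have pos: "0 < fk_sum V r {} E (\<lambda>_. 1)"
    using fk_sum_pos[of E "{}" r "\<lambda>_. 1"] r by simp
  have T: "q * fk_sum V r {} E (\<lambda>_. 1) \<le> ?T"
    using lower[of E z] z by simp
  have T_pos: "0 < ?T"
    using T pos q by (smt (verit) mult_pos_pos)
  have "fk_mean V (r * q) {} E (\<lambda>X. of_bool (n \<le> card (cluster X z)))
    \<le> fk_sum V r {} E (\<lambda>X. s ^ card (cluster X z) * of_bool (n \<le> card (cluster X z))) / ?T"
  proof -
    \<comment> \<open>Infinite sets are given large size, so that the function is increasing.\<close>
    define \<phi> where "\<phi> C = (of_bool (infinite C \<or> n \<le> card C) :: real)" for C :: "'d site set"
    have \<phi>_mono: "\<phi> C \<le> \<phi> D" if "C \<subseteq> D" for C D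
      using card_mono[of D C] finite_subset[of C D] that by (auto simp: \<phi>_def)
    have eq: "\<phi> (cluster X z) = of_bool (n \<le> card (cluster X z))" if "X \<subseteq> E" for X
      using finite_cluster[OF that z] by (simp add: \<phi>_def)
    have "fk_mean V (r * q) {} E (\<lambda>X. \<phi> (cluster X z))
      \<le> fk_sum V r {} E (\<lambda>X. s ^ card (cluster X z) * \<phi> (cluster X z)) / ?T"
      using r s q z lower \<phi>_mono by (intro exploration_domination) (auto simp: \<phi>_def)
    then show ?thesis
      unfolding fk_mean_def by (simp add: eq cong: fk_sum_cong)
  qed
  also have "\<dots> \<le> (s ^ n * fk_sum V r {} E (\<lambda>_. 1)) / ?T"
  proof (rule divide_right_mono)
    show "fk_sum V r {} E (\<lambda>X. s ^ card (cluster X z) * of_bool (n \<le> card (cluster X z)))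
        \<le> s ^ n * fk_sum V r {} E (\<lambda>_. 1)"
      unfolding fk_sum_cmult[symmetric] using r s
      by (intro fk_sum_mono) (auto intro!: power_decreasing)
  qed (use T_pos in simp)
  also have "\<dots> \<le> (s ^ n * fk_sum V r {} E (\<lambda>_. 1)) / (q * fk_sum V r {} E (\<lambda>_. 1))"
    using T pos q s by (intro divide_left_mono) (auto intro!: mult_pos_pos T_pos)
  also have "\<dots> = s ^ n / q"
    using pos by simp
  finally show ?thesis by (simp add: q_def)
qed

lemma cluster_isolated:
  assumes "\<And>e. e \<in> X \<Longrightarrow> z \<notin> endpoints e"
  shows "cluster X z = {z}"
  using cluster_eqI[of "{}" X z] assms by (auto simp: cluster_def conn_empty Image_def)

text \<open>Closing the edges at \<open>z\<close> does not decrease the number of clusters. So a configuration with given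
  states elsewhere and the edges of \<open>W\<close> open at \<open>z\<close> has at most \<open>r ^ card W\<close> times the weight of
  the one where \<open>z\<close> is isolated, and these factors sum to at most \<open>(1 + r) ^ D\<close>.\<close>

lemma isolation_probability:
  assumes r: "0 < r" and D: "card {e \<in> E. z \<in> endpoints e} \<le> D"
  shows "fk_mean V r {} E (\<lambda>X. of_bool (cluster X z \<noteq> {z})) \<le> 1 - 1 / (1 + r) ^ D"
proof -
  define F where "F = {e \<in> E. z \<in> endpoints e}"
  have F: "finite F" "F \<subseteq> E" using finite_E by (auto simp: F_def)
  have Z: "0 < fk_sum V r {} E (\<lambda>_. 1)"
    using fk_sum_pos[of E "{}" r "\<lambda>_. 1"] r by simp
  have interval: "{{}..M} = Pow M" for M :: "'d edge set" by auto
  let ?I = "fk_sum V r {} E (\<lambda>X. of_bool (cluster X z = {z}))"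
  have bij: "bij_betw (\<lambda>(Y, W). Y \<union> W) (Pow (E - F) \<times> Pow F) (Pow E)"
    by (rule bij_betw_byWitness[where f' = "\<lambda>X. (X - F, X \<inter> F)"]) (use F in auto)
  have weight: "fk_weight V r (Y \<union> W) \<le> r ^ card W * fk_weight V r Y"
    if "Y \<subseteq> E - F" "W \<subseteq> F" for Y W
  proof -
    have fin: "finite Y" "finite W" using that F finite_sub[of Y] finite_subset by auto
    have "clusters V (Y \<union> W) \<le> clusters V Y"
      using fin finite_V endpoints_V F that by (intro clusters_antimono) blast+
    moreover have "card (Y \<union> W) = card Y + card W"
      using fin that by (intro card_Un_disjoint) auto
    ultimately show ?thesis
      using r by (simp add: fk_weight_def power_add mult_ac power_increasing)
  qed
  have "fk_sum V r {} E (\<lambda>_. 1) = (\<Sum>(Y, W)\<in>Pow (E - F) \<times> Pow F. fk_weight V r (Y \<union> W))"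
    unfolding fk_sum_def interval mult_1_right
    by (subst sum.reindex_bij_betw[OF bij, symmetric]) (simp add: case_prod_unfold)
  also have "\<dots> \<le> (\<Sum>(Y, W)\<in>Pow (E - F) \<times> Pow F. r ^ card W * fk_weight V r Y)"
    by (intro sum_mono) (use weight in auto)
  also have "\<dots> = (\<Sum>W\<in>Pow F. r ^ card W) * (\<Sum>Y\<in>Pow (E - F). fk_weight V r Y)"
    by (simp add: sum.cartesian_product[symmetric] sum_product sum.swap[of _ "Pow (E - F)"])
  also have "(\<Sum>W\<in>Pow F. r ^ card W) = (1 + r) ^ card F"
    using prod_add[OF F(1), of "\<lambda>_. r" "\<lambda>_. 1"] by (simp add: add.commute)
  also have "(1 + r) ^ card F * (\<Sum>Y\<in>Pow (E - F). fk_weight V r Y) \<le> (1 + r) ^ D * ?I"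
  proof (intro mult_mono)
    show "(1 + r) ^ card F \<le> (1 + r) ^ D"
      using r D by (intro power_increasing) (auto simp: F_def)
    have "(\<Sum>Y\<in>Pow (E - F). fk_weight V r Y)
        = (\<Sum>Y\<in>Pow (E - F). fk_weight V r Y * of_bool (cluster Y z = {z}))"
    proof (rule sum.cong)
      fix Y assume "Y \<in> Pow (E - F)"
      then have "cluster Y z = {z}"
        unfolding F_def by (intro cluster_isolated) blast
      then show "fk_weight V r Y = fk_weight V r Y * of_bool (cluster Y z = {z})" by simp
    qed simp
    also have "\<dots> \<le> ?I"
      unfolding fk_sum_def interval using finite_E r
      by (intro sum_mono2) (auto intro: fk_weight_nonneg)
    finally show "(\<Sum>Y\<in>Pow (E - F). fk_weight V r Y) \<le> ?I" .
  qed (use r in \<open>auto intro!: sum_nonneg fk_weight_nonneg\<close>)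
  finally have I: "1 / (1 + r) ^ D \<le> ?I / fk_sum V r {} E (\<lambda>_. 1)"
    using r Z by (simp add: field_simps)
  have "fk_sum V r {} E (\<lambda>_. 1) = ?I + fk_sum V r {} E (\<lambda>X. of_bool (cluster X z \<noteq> {z}))"
    unfolding fk_sum_add[symmetric] by (intro fk_sum_cong) auto
  then show ?thesis
    using I Z unfolding fk_mean_def by (simp add: field_simps)
qed

end

section \<open>Translations\<close>

definition shift :: "'d::finite site \<Rightarrow> 'd edge \<Rightarrow> 'd edge" where
  "shift v e = (fst e + v, snd e)"

lemma inj_shift: "inj (shift v)"
  by (auto simp: inj_def shift_def prod_eq_iff)

lemma endpoints_shift: "endpoints (shift v e) = (\<lambda>x. x + v) ` endpoints e"
  by (auto simp: endpoints_def shift_def algebra_simps)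

lemma conn_shift_imp: "(x, y) \<in> conn X \<Longrightarrow> (x + v, y + v) \<in> conn (shift v ` X)"
proof -
  assume "(x, y) \<in> conn X"
  then have "(x, y) \<in> (open_adj (\<lambda>e. e \<in> X))\<^sup>*" by (simp add: conn_def)
  then show ?thesis
  proof (induction rule: rtrancl_induct)
    case (step y w)
    then obtain e where "e \<in> X" "endpoints e = {y, w}" by (auto simp: open_adj_def)
    then have "(y + v, w + v) \<in> conn (shift v ` X)"
      by (intro conn_edge[of "shift v e"]) (auto simp: endpoints_shift)
    with step.IH show ?case by (rule conn_trans)
  qed simp
qed

lemma shift_shift: "shift (- v) ` shift v ` X = X"
  by (force simp: shift_def image_image)

lemma conn_shift: "(x + v, y + v) \<in> conn (shift v ` X) \<longleftrightarrow> (x, y) \<in> conn X"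
  using conn_shift_imp[of x y X v] conn_shift_imp[of "x + v" "y + v" "shift v ` X" "- v"]
  by (auto simp: shift_shift)

lemma cluster_shift: "cluster (shift v ` X) (x + v) = (\<lambda>y. y + v) ` cluster X x"
proof (intro set_eqI iffI)
  fix w assume "w \<in> cluster (shift v ` X) (x + v)"
  then have "(x, w - v) \<in> conn X"
    using conn_shift[of x v "w - v" X] by (simp add: mem_cluster)
  then show "w \<in> (\<lambda>y. y + v) ` cluster X x"
    by (intro image_eqI[of _ _ "w - v"]) (auto simp: mem_cluster)
qed (auto simp: mem_cluster conn_shift)

lemma card_cluster_shift: "card (cluster (shift v ` X) (x + v)) = card (cluster X x)"
  unfolding cluster_shift by (intro card_image) (auto simp: inj_on_def)

lemma finite_subgraph_shift:
  "finite_subgraph (V, E) \<Longrightarrow> finite_subgraph ((\<lambda>x. x + v) ` V, shift v ` E)"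
  by (auto simp: finite_subgraph_def endpoints_shift)

lemma clusters_shift:
  assumes "finite_subgraph (V, X)"
  shows "clusters ((\<lambda>x. x + v) ` V) (shift v ` X) = clusters V X"
proof -
  have "finite X" and V: "finite V" and "\<And>e. e \<in> X \<Longrightarrow> endpoints e \<subseteq> V"
    using assms by (auto simp: finite_subgraph_def)
  then show ?thesis
  proof (induction X rule: finite_induct)
    case empty
    then show ?case by (simp add: clusters_empty card_image)
  next
    case (insert e X)
    obtain x y where e: "endpoints e = {x, y}" by (rule endpoints_doubleton)
    have eV: "endpoints e \<subseteq> V" using insert.prems by auto
    have e': "endpoints (shift v e) = {x + v, y + v}" by (simp add: endpoints_shift e)
    have eV': "endpoints (shift v e) \<subseteq> (\<lambda>x. x + v) ` V" using eV by (auto simp: endpoints_shift)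
    have V': "finite ((\<lambda>x. x + v) ` V)" using V by simp
    show ?case
      using clusters_insert[OF V e eV, of X] clusters_insert[OF V' e' eV', of "shift v ` X"] insert
      by (auto simp: conn_shift split: if_splits)
  qed
qed

lemma fk_sum_shift:
  assumes "finite_subgraph (V, E)"
  shows "fk_sum ((\<lambda>x. x + v) ` V) r {} (shift v ` E) f = fk_sum V r {} E (\<lambda>X. f (shift v ` X))"
proof -
  have interval: "{{}..M} = Pow M" for M :: "'d edge set" by auto
  have bij: "bij_betw (\<lambda>X. shift v ` X) (Pow E) (Pow (shift v ` E))"
    by (rule bij_betw_Pow) (rule inj_on_imp_bij_betw[OF inj_on_subset[OF inj_shift]], simp)
  have weight: "fk_weight ((\<lambda>x. x + v) ` V) r (shift v ` X) = fk_weight V r X" if "X \<subseteq> E" for X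
  proof -
    have "finite_subgraph (V, X)"
      using assms that by (auto simp: finite_subgraph_def intro: finite_subset)
    moreover have "card (shift v ` X) = card X"
      by (rule card_image) (rule inj_on_subset[OF inj_shift], simp)
    ultimately show ?thesis
      by (simp add: fk_weight_def clusters_shift)
  qed
  show ?thesis
    unfolding fk_sum_def interval
    by (subst sum.reindex_bij_betw[OF bij, symmetric]) (intro sum.cong, auto simp: weight)
qed

lemma fk_mean_shift:
  "finite_subgraph (V, E) \<Longrightarrow>
    fk_mean ((\<lambda>x. x + v) ` V) r {} (shift v ` E) f = fk_mean V r {} E (\<lambda>X. f (shift v ` X))"
  by (simp add: fk_mean_def fk_sum_shift)

section \<open>Clusters and distance\<close>

text \<open>Along a path each coordinate changes by at most one per step, so it takes every intermediate
  value.\<close>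

lemma conn_intermediate_value:
  fixes x y :: "'d::finite site" and i :: 'd and t :: int
  assumes "(x, y) \<in> (open_adj \<omega>)\<^sup>*" and "min (x $ i) (y $ i) \<le> t" "t \<le> max (x $ i) (y $ i)"
  shows "\<exists>w. (x, w) \<in> (open_adj \<omega>)\<^sup>* \<and> w $ i = t"
  using assms
proof (induction arbitrary: t rule: rtrancl_induct)
  case base
  then show ?case by (intro exI[of _ x]) auto
next
  case (step y w)
  from step.hyps(2) obtain e where "endpoints e = {y, w}" by (auto simp: open_adj_def)
  then have "w = y + axis (snd e) 1 \<or> y = w + axis (snd e) 1"
    by (auto simp: endpoints_def doubleton_eq_iff)
  then have close: "\<bar>w $ i - y $ i\<bar> \<le> 1"
    by (auto simp: axis_def)
  show ?case
  proof (cases "min (x $ i) (y $ i) \<le> t \<and> t \<le> max (x $ i) (y $ i)")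
    case True
    then show ?thesis using step.IH by blast
  next
    case False
    then have "t = w $ i" using close step.prems by (auto simp: min_def max_def split: if_splits)
    moreover have "(x, w) \<in> (open_adj \<omega>)\<^sup>*" using step.hyps by auto
    ultimately show ?thesis by blast
  qed
qed

lemma coordinate_le_card_cluster:
  assumes "finite (cluster X 0)" "x \<in> cluster X 0"
  shows "\<bar>x $ i\<bar> < int (card (cluster X 0))"
proof -
  have "{min 0 (x $ i)..max 0 (x $ i)} \<subseteq> (\<lambda>w. w $ i) ` cluster X 0"
  proof
    fix t assume t: "t \<in> {min 0 (x $ i)..max 0 (x $ i)}"
    then obtain w where "(0, w) \<in> (open_adj (\<lambda>e. e \<in> X))\<^sup>*" "w $ i = t"
      using conn_intermediate_value[of 0 x "\<lambda>e. e \<in> X" i t] assms(2)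
      by (auto simp: mem_cluster conn_def)
    then show "t \<in> (\<lambda>w. w $ i) ` cluster X 0"
      by (auto simp: mem_cluster conn_def)
  qed
  then have "card {min 0 (x $ i)..max 0 (x $ i)} \<le> card (cluster X 0)"
    using assms(1) by (rule surj_card_le[rotated])
  then show ?thesis by (auto simp: min_def max_def split: if_splits)
qed

section \<open>Finite-volume measures as random-cluster averages\<close>

lemma integral_proportional_measure:
  assumes "finite A" "\<And>a. a \<in> A \<Longrightarrow> 0 \<le> w a"
  shows "(\<integral>a. g a \<partial>proportional_measure A w) = (\<Sum>a\<in>A. w a * g a) / (\<Sum>a\<in>A. w a :: real)"
  unfolding proportional_measure_def
  using assms by (subst lebesgue_integral_point_measure_finite)
    (auto simp: sum_divide_distrib intro!: divide_nonneg_nonneg sum_nonneg)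

lemma clusters_num_clusters: "num_clusters V (\<lambda>e. e \<in> X) = clusters V X"
  by (simp add: clusters_def num_clusters_def conn_def)

context finite_graph
begin

lemma configs_bij: "bij_betw (\<lambda>X e. e \<in> X) (Pow E) {\<omega>. \<forall>e. \<omega> e \<longrightarrow> e \<in> E}"
  by (rule bij_betw_byWitness[where f' = Collect]) auto

lemma finite_configs: "finite {\<omega>. \<forall>e. \<omega> e \<longrightarrow> e \<in> E}"
  using bij_betw_finite[OF configs_bij] finite_E by simp

lemma integral_random_cluster_sum:
  fixes f :: "'d config \<Rightarrow> real"
  assumes "0 \<le> p" "p \<le> 1"
  defines "w \<equiv> \<lambda>X. 2 ^ clusters V X * p ^ card X * (1 - p) ^ card (E - X)"
  shows "(\<integral>\<omega>. f \<omega> \<partial>random_cluster p (V, E))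
    = (\<Sum>X\<in>Pow E. w X * f (\<lambda>e. e \<in> X)) / (\<Sum>X\<in>Pow E. w X)"
proof -
  let ?w = "\<lambda>\<omega>. 2 ^ num_clusters V \<omega> * p ^ card {e \<in> E. \<omega> e} * (1 - p) ^ card {e \<in> E. \<not> \<omega> e}"
  have w: "?w (\<lambda>e. e \<in> X) = w X" if "X \<in> Pow E" for X
  proof -
    have "{e \<in> E. e \<in> X} = X" "{e \<in> E. e \<notin> X} = E - X" using that by auto
    then show ?thesis by (simp add: w_def clusters_num_clusters)
  qed
  have "(\<integral>\<omega>. f \<omega> \<partial>random_cluster p (V, E))
      = (\<Sum>\<omega> | \<forall>e. \<omega> e \<longrightarrow> e \<in> E. ?w \<omega> * f \<omega>) / (\<Sum>\<omega> | \<forall>e. \<omega> e \<longrightarrow> e \<in> E. ?w \<omega>)"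
    unfolding random_cluster_def split using finite_configs assms
    by (intro integral_proportional_measure) auto
  also have "\<dots> = (\<Sum>X\<in>Pow E. ?w (\<lambda>e. e \<in> X) * f (\<lambda>e. e \<in> X)) / (\<Sum>X\<in>Pow E. ?w (\<lambda>e. e \<in> X))"
    unfolding sum.reindex_bij_betw[OF configs_bij, symmetric] ..
  also have "\<dots> = (\<Sum>X\<in>Pow E. w X * f (\<lambda>e. e \<in> X)) / (\<Sum>X\<in>Pow E. w X)"
    by (intro arg_cong2[where f = "(/)"] sum.cong refl) (simp_all only: w)
  finally show ?thesis .
qed

lemma integral_random_cluster:
  fixes f :: "'d config \<Rightarrow> real"
  assumes "0 \<le> p" "p < 1"
  shows "(\<integral>\<omega>. f \<omega> \<partial>random_cluster p (V, E))
    = fk_mean V (p / (1 - p)) {} E (\<lambda>X. f (\<lambda>e. e \<in> X))"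
proof -
  have w: "2 ^ clusters V X * p ^ card X * (1 - p) ^ card (E - X)
      = (1 - p) ^ card E * fk_weight V (p / (1 - p)) X" if "X \<in> Pow E" for X
  proof -
    have "card E = card X + card (E - X)"
      using that finite_E card_mono[of E X] finite_sub[of X] by (simp add: card_Diff_subset)
    then show ?thesis
      using assms by (simp add: fk_weight_def power_add power_divide)
  qed
  have interval: "{{}..M} = Pow M" for M :: "'d edge set" by auto
  have "(\<integral>\<omega>. f \<omega> \<partial>random_cluster p (V, E))
    = (\<Sum>X\<in>Pow E. (1 - p) ^ card E * fk_weight V (p / (1 - p)) X * f (\<lambda>e. e \<in> X))
      / (\<Sum>X\<in>Pow E. (1 - p) ^ card E * fk_weight V (p / (1 - p)) X)"
    using assms unfolding integral_random_cluster_sum[OF assms(1) less_imp_le[OF assms(2)]]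
    by (intro arg_cong2[where f = "(/)"] sum.cong refl) (simp_all only: w)
  then show ?thesis
    using assms unfolding fk_mean_def fk_sum_def interval mult.assoc sum_distrib_left[symmetric]
    by simp
qed

text \<open>For \<open>p = 1\<close> the odds are infinite and the measure is concentrated on the configuration where all
  edges are open.\<close>

lemma integral_random_cluster_1:
  fixes f :: "'d config \<Rightarrow> real"
  shows "(\<integral>\<omega>. f \<omega> \<partial>random_cluster 1 (V, E)) = f (\<lambda>e. e \<in> E)"
proof -
  have only: "(\<Sum>X\<in>Pow E. 2 ^ clusters V X * 1 ^ card X * (1 - 1) ^ card (E - X) * g X)
      = 2 ^ clusters V E * g E" for g :: "'d edge set \<Rightarrow> real"
  proof -
    have "(\<Sum>X\<in>Pow E. 2 ^ clusters V X * 1 ^ card X * (1 - 1) ^ card (E - X) * g X)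
        = (\<Sum>X\<in>{E}. 2 ^ clusters V X * 1 ^ card X * (1 - 1) ^ card (E - X) * g X)"
      using finite_E by (intro sum.mono_neutral_right) auto
    then show ?thesis by simp
  qed
  show ?thesis
    using integral_random_cluster_sum[of 1 f] only[of "\<lambda>X. f (\<lambda>e. e \<in> X)"] only[of "\<lambda>_. 1"] by simp
qed

end

text \<open>For \<open>p' < 1\<close> this is the comparison of finite averages on the common vertex set \<open>V'\<close>: isolated
  additional vertices multiply all weights by the same constant.\<close>

lemma random_cluster_mono:
  fixes f :: "'d::finite config \<Rightarrow> real"
  assumes G: "finite_subgraph (V, E)" and G': "finite_subgraph (V', E')"
    and sub: "V \<subseteq> V'" "E \<subseteq> E'" and p: "0 \<le> p" "p \<le> p'" "p' \<le> 1"
    and f0: "\<And>\<omega>. 0 \<le> f \<omega>" and f: "\<And>\<omega> \<omega>'. \<omega> \<le> \<omega>' \<Longrightarrow> f \<omega> \<le> f \<omega>'"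
  shows "(\<integral>\<omega>. f \<omega> \<partial>random_cluster p (V, E)) \<le> (\<integral>\<omega>. f \<omega> \<partial>random_cluster p' (V', E'))"
proof -
  interpret G: finite_graph V E by (unfold_locales) (rule G)
  interpret G': finite_graph V' E' by (unfold_locales) (rule G')
  let ?g = "\<lambda>X. f (\<lambda>e. e \<in> X)"
  have g: "?g X \<le> ?g Y" if "X \<subseteq> Y" for X Y
    using that by (intro f) (auto simp: le_fun_def)
  show ?thesis
  proof (cases "p' = 1")
    case True
    have "(\<integral>\<omega>. f \<omega> \<partial>random_cluster p (V, E)) \<le> ?g E"
    proof (cases "p = 1")
      case True
      then show ?thesis by (simp add: G.integral_random_cluster_1)
    next
      case False
      then have "p < 1" using p by simp
      then show ?thesis
        unfolding G.integral_random_cluster[OF p(1) \<open>p < 1\<close>]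
        using p g by (intro G.fk_mean_le_max G.fk_sum_pos_empty) auto
    qed
    also have "\<dots> \<le> ?g E'" by (rule g[OF sub(2)])
    finally show ?thesis using True by (simp add: G'.integral_random_cluster_1)
  next
    case False
    then have lt: "p < 1" "p' < 1" using p by auto
    have odds: "0 \<le> p / (1 - p)" "p / (1 - p) \<le> p' / (1 - p')"
      using p lt by (auto intro!: frac_le)
    have V_in: "finite_subgraph (V', E)"
      using G G' sub by (auto simp: finite_subgraph_def)
    interpret H: finite_graph V' E by (unfold_locales) (rule V_in)
    \<comment> \<open>The vertices of \<open>V' - V\<close> are isolated in \<open>(V', E)\<close>.\<close>
    have extra: "clusters V' X = clusters V X + card (V' - V)" if "X \<subseteq> E" for X
    proof -
      have "finite X" using that G.finite_E finite_subset by auto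
      then show ?thesis using that
      proof (induction X rule: finite_induct)
        case empty
        then show ?case
          using sub H.finite_V card_mono[of V' V] G.finite_V by (simp add: clusters_empty card_Diff_subset)
      next
        case (insert e X)
        obtain x y where e: "endpoints e = {x, y}" by (rule endpoints_doubleton)
        have eV: "endpoints e \<subseteq> V" "endpoints e \<subseteq> V'"
          using insert.prems G.endpoints_V[of e] sub by auto
        show ?case
          using clusters_insert[OF G.finite_V e eV(1), of X] clusters_insert[OF H.finite_V e eV(2), of X]
            insert by (auto split: if_splits)
      qed
    qed
    have "fk_sum V' r {} E h = 2 ^ card (V' - V) * fk_sum V r {} E h" for r h
      unfolding fk_sum_def sum_distrib_left
      by (intro sum.cong) (auto simp: fk_weight_def extra power_add)
    then have "fk_mean V (p / (1 - p)) {} E ?g = fk_mean V' (p / (1 - p)) {} E ?g"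
      by (simp add: fk_mean_def)
    also have "\<dots> \<le> fk_mean V' (p' / (1 - p')) {} E' ?g"
      using sub odds f0 g
      by (intro G'.fk_mean_mono G'.fk_sum_pos_empty H.fk_sum_pos_empty) auto
    finally show ?thesis
      using p lt by (simp add: G.integral_random_cluster G'.integral_random_cluster)
  qed
qed

section \<open>The Edwards--Sokal identity\<close>

lemma endpoints_distinct: "endpoints e = {x, y} \<Longrightarrow> x \<noteq> y"
  by (auto simp: endpoints_def doubleton_eq_iff axis_eq_0_iff)

lemma prod_endpoints:
  fixes \<sigma> :: "'d::finite site \<Rightarrow> real"
  shows "endpoints e = {x, y} \<Longrightarrow> (\<Prod>v\<in>endpoints e. \<sigma> v) = \<sigma> x * \<sigma> y"
  using endpoints_distinct[of e x y] by simp

context finite_graph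
begin

abbreviation "spins \<equiv> (V \<rightarrow>\<^sub>E {-1, 1 :: real})"

text \<open>These are the spin configurations that are constant on every cluster of \<open>X\<close>.\<close>

definition satisfied :: "'d edge set \<Rightarrow> ('d site \<Rightarrow> real) set" where
  "satisfied X = {\<sigma> \<in> spins. \<forall>e\<in>X. (\<Prod>v\<in>endpoints e. \<sigma> v) = 1}"

lemma finite_spins: "finite spins"
  using finite_V by (intro finite_PiE) auto

lemma finite_satisfied: "finite (satisfied X)"
  by (rule finite_subset[OF _ finite_spins]) (auto simp: satisfied_def)

lemma spin_cases: "\<sigma> \<in> spins \<Longrightarrow> x \<in> V \<Longrightarrow> \<sigma> x = -1 \<or> \<sigma> x = 1"
  by (auto dest!: PiE_mem)

lemma spin_square: "\<sigma> \<in> spins \<Longrightarrow> x \<in> V \<Longrightarrow> \<sigma> x * \<sigma> x = 1"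
  using spin_cases[of \<sigma> x] by auto

lemma satisfied_conn:
  assumes X: "X \<subseteq> E" and \<sigma>: "\<sigma> \<in> satisfied X" and a: "a \<in> V" and "(a, b) \<in> conn X"
  shows "\<sigma> a = \<sigma> b"
proof -
  have "(a, b) \<in> (open_adj (\<lambda>e. e \<in> X))\<^sup>*"
    using assms by (simp add: conn_def)
  then show ?thesis
  proof (induction rule: rtrancl_induct)
    case (step v w)
    then obtain e where e: "e \<in> X" "endpoints e = {v, w}" by (auto simp: open_adj_def)
    then have "v \<in> V" "w \<in> V" using endpoints_V[of e] X by auto
    moreover have "\<sigma> v * \<sigma> w = 1" using e \<sigma> prod_endpoints[OF e(2), of \<sigma>] by (auto simp: satisfied_def)
    ultimately show ?case
      using step.IH \<sigma> spin_cases[of \<sigma> v] spin_cases[of \<sigma> w] by (auto simp: satisfied_def)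
  qed simp
qed

text \<open>The two endpoints of an edge in \<open>X\<close> are flipped together.\<close>

lemma flip_cluster:
  assumes X: "X \<subseteq> E" and \<sigma>: "\<sigma> \<in> satisfied X" and a: "a \<in> V"
  shows "(\<lambda>v. if v \<in> cluster X a then - \<sigma> v else \<sigma> v) \<in> satisfied X"
proof -
  let ?\<tau> = "\<lambda>v. if v \<in> cluster X a then - \<sigma> v else \<sigma> v"
  have sub: "cluster X a \<subseteq> V" by (rule cluster_subset[OF X a])
  have "?\<tau> \<in> spins"
  proof (rule PiE_I)
    show "?\<tau> v \<in> {-1, 1}" if "v \<in> V" for v
      using \<sigma> spin_cases[OF _ that, of \<sigma>] by (auto simp: satisfied_def)
    show "?\<tau> v = undefined" if "v \<notin> V" for v
      using \<sigma> sub that PiE_arb[of \<sigma> V _ v] by (auto simp: satisfied_def)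
  qed
  moreover have "(\<Prod>v\<in>endpoints e. ?\<tau> v) = 1" if e: "e \<in> X" for e
  proof -
    obtain x y where xy: "endpoints e = {x, y}" by (rule endpoints_doubleton)
    have "(x, y) \<in> conn X" "(y, x) \<in> conn X"
      using conn_edge[OF e xy] by (auto intro: conn_sym)
    then have "x \<in> cluster X a \<longleftrightarrow> y \<in> cluster X a"
      unfolding mem_cluster using conn_trans by blast
    moreover have "\<sigma> x * \<sigma> y = 1"
      using \<sigma> e prod_endpoints[OF xy, of \<sigma>] by (auto simp: satisfied_def)
    ultimately show ?thesis
      unfolding prod_endpoints[OF xy] by simp
  qed
  ultimately show ?thesis by (auto simp: satisfied_def)
qed

text \<open>Spins in different clusters are uncorrelated, because flipping the cluster of \<open>a\<close> changes the sign
  of \<open>\<sigma> a * \<sigma> b\<close>.\<close>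

lemma satisfied_correlation:
  assumes X: "X \<subseteq> E" and ab: "a \<in> V" "b \<in> V"
  shows "(\<Sum>\<sigma>\<in>satisfied X. \<sigma> a * \<sigma> b) = of_bool ((a, b) \<in> conn X) * card (satisfied X)"
proof (cases "(a, b) \<in> conn X")
  case True
  have "\<sigma> a * \<sigma> b = 1" if "\<sigma> \<in> satisfied X" for \<sigma>
    using satisfied_conn[OF X that ab(1) True] spin_square[of \<sigma> b] that ab
    by (auto simp: satisfied_def)
  then show ?thesis using True by simp
next
  case False
  let ?flip = "\<lambda>\<sigma> v. if v \<in> cluster X a then - \<sigma> v else \<sigma> v :: real"
  have "(\<Sum>\<sigma>\<in>satisfied X. \<sigma> a * \<sigma> b) = (\<Sum>\<sigma>\<in>satisfied X. - (\<sigma> a * \<sigma> b))"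
    by (rule sum.reindex_bij_witness[of _ ?flip ?flip])
      (use False flip_cluster[OF X _ ab(1)] in \<open>auto simp: mem_cluster fun_eq_iff\<close>)
  then show ?thesis using False by (simp add: sum_negf)
qed

text \<open>Of the spin configurations that satisfy \<open>X\<close>, exactly half satisfy an additional edge that joins
  two clusters of \<open>X\<close>.\<close>

lemma card_satisfied: "X \<subseteq> E \<Longrightarrow> card (satisfied X) = 2 ^ clusters V X"
proof -
  assume X: "X \<subseteq> E"
  from finite_sub[OF X] X have "real (card (satisfied X)) = 2 ^ clusters V X"
  proof (induction X rule: finite_induct)
    case empty
    have "card spins = 2 ^ card V"
      using finite_V by (subst card_PiE) (auto simp: numeral_2_eq_2)
    then show ?case by (simp add: satisfied_def clusters_empty)
  next
    case (insert e X)
    obtain x y where e: "endpoints e = {x, y}" by (rule endpoints_doubleton)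
    have X: "X \<subseteq> E" and eV: "endpoints e \<subseteq> V"
      using insert.prems endpoints_V[of e] by auto
    then have xy: "x \<in> V" "y \<in> V" using e by auto
    have new: "satisfied (insert e X) = {\<sigma> \<in> satisfied X. \<sigma> x * \<sigma> y = 1}"
      unfolding satisfied_def using prod_endpoints[OF e] by auto
    have half: "of_bool (\<sigma> x * \<sigma> y = 1) = (1 + \<sigma> x * \<sigma> y) / 2" if "\<sigma> \<in> satisfied X" for \<sigma>
      using that spin_cases[of \<sigma> x] spin_cases[of \<sigma> y] xy by (auto simp: satisfied_def)
    have "real (card (satisfied (insert e X))) = (\<Sum>\<sigma>\<in>satisfied X. of_bool (\<sigma> x * \<sigma> y = 1))"
      unfolding new using finite_satisfied by (simp add: Collect_conj_eq Int_commute)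
    also have "\<dots> = (\<Sum>\<sigma>\<in>satisfied X. (1 + \<sigma> x * \<sigma> y) / 2)"
      by (rule sum.cong) (auto simp: half)
    also have "\<dots> = (card (satisfied X) + of_bool ((x, y) \<in> conn X) * card (satisfied X)) / 2"
      by (simp add: sum_divide_distrib[symmetric] sum.distrib satisfied_correlation[OF X xy])
    finally show ?case
      using insert.IH[OF X] clusters_insert[OF finite_V e eV, of X]
      by (cases "(x, y) \<in> conn X") auto
  qed
  then show ?thesis
    by (metis of_nat_eq_iff of_nat_numeral of_nat_power)
qed

text \<open>For \<open>t \<in> {-1, 1}\<close> one has \<open>exp (\<beta> t) = exp (- \<beta>) (1 + r of_bool (t = 1))\<close> with
  \<open>r = exp (2 \<beta>) - 1\<close>. Expanding the product over the edges gives a sum over edge sets \<open>X\<close>, in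
  which only the spin configurations that are constant on the clusters of \<open>X\<close> contribute.\<close>

lemma edwards_sokal_sum:
  assumes \<beta>: "0 \<le> \<beta>" and ab: "a \<in> V" "b \<in> V"
  shows "(\<Sum>\<sigma>\<in>spins. exp (\<beta> * (\<Sum>e\<in>E. \<Prod>v\<in>endpoints e. \<sigma> v)) * (\<sigma> a * \<sigma> b))
    = exp (- \<beta>) ^ card E * fk_sum V (exp (2 * \<beta>) - 1) {} E (\<lambda>X. of_bool ((a, b) \<in> conn X))"
proof -
  define r where "r = exp (2 * \<beta>) - 1"
  let ?s = "\<lambda>\<sigma> e. \<Prod>v\<in>endpoints e. \<sigma> v :: real"
  have interval: "{{}..M} = Pow M" for M :: "'d edge set" by auto
  have expand: "exp (\<beta> * (\<Sum>e\<in>E. ?s \<sigma> e))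
      = exp (- \<beta>) ^ card E * (\<Sum>X\<in>Pow E. r ^ card X * of_bool (\<sigma> \<in> satisfied X))"
    if \<sigma>: "\<sigma> \<in> spins" for \<sigma>
  proof -
    have "exp (\<beta> * ?s \<sigma> e) = exp (- \<beta>) * (r * of_bool (?s \<sigma> e = 1) + 1)" if "e \<in> E" for e
    proof -
      obtain x y where e: "endpoints e = {x, y}" by (rule endpoints_doubleton)
      have "x \<in> V" "y \<in> V" using endpoints_V[OF that] e by auto
      then have "?s \<sigma> e = -1 \<or> ?s \<sigma> e = 1"
        unfolding prod_endpoints[OF e] using spin_cases[OF \<sigma>, of x] spin_cases[OF \<sigma>, of y] by auto
      then show ?thesis
        by (auto simp: r_def exp_add[symmetric] algebra_simps)
    qed
    then have "exp (\<beta> * (\<Sum>e\<in>E. ?s \<sigma> e)) = (\<Prod>e\<in>E. exp (- \<beta>) * (r * of_bool (?s \<sigma> e = 1) + 1))"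
      by (simp add: sum_distrib_left exp_sum finite_E)
    also have "\<dots> = exp (- \<beta>) ^ card E * (\<Sum>X\<in>Pow E. \<Prod>e\<in>X. r * of_bool (?s \<sigma> e = 1))"
      by (simp add: prod.distrib prod_add finite_E)
    also have "(\<Sum>X\<in>Pow E. \<Prod>e\<in>X. r * of_bool (?s \<sigma> e = 1))
        = (\<Sum>X\<in>Pow E. r ^ card X * of_bool (\<sigma> \<in> satisfied X))"
    proof (rule sum.cong)
      fix X assume "X \<in> Pow E"
      then have "finite X" using finite_sub by auto
      have "(\<Prod>e\<in>X. of_bool (?s \<sigma> e = 1) :: real) = of_bool (\<sigma> \<in> satisfied X)"
        using \<open>finite X\<close> \<sigma> by (auto simp: satisfied_def)
      then show "(\<Prod>e\<in>X. r * of_bool (?s \<sigma> e = 1)) = r ^ card X * of_bool (\<sigma> \<in> satisfied X)"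
        by (simp add: prod.distrib)
    qed simp
    finally show ?thesis .
  qed
  have "(\<Sum>\<sigma>\<in>spins. exp (\<beta> * (\<Sum>e\<in>E. ?s \<sigma> e)) * (\<sigma> a * \<sigma> b))
      = (\<Sum>\<sigma>\<in>spins. \<Sum>X\<in>Pow E. exp (- \<beta>) ^ card E * (r ^ card X * (of_bool (\<sigma> \<in> satisfied X) * (\<sigma> a * \<sigma> b))))"
  proof (rule sum.cong)
    fix \<sigma> :: "'d site \<Rightarrow> real" assume "\<sigma> \<in> spins"
    from expand[OF this]
    show "exp (\<beta> * (\<Sum>e\<in>E. ?s \<sigma> e)) * (\<sigma> a * \<sigma> b)
        = (\<Sum>X\<in>Pow E. exp (- \<beta>) ^ card E * (r ^ card X * (of_bool (\<sigma> \<in> satisfied X) * (\<sigma> a * \<sigma> b))))"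
      by (simp only:) (simp only: sum_distrib_left sum_distrib_right mult.assoc)
  qed simp
  also have "\<dots> = (\<Sum>X\<in>Pow E. exp (- \<beta>) ^ card E * (r ^ card X * (\<Sum>\<sigma>\<in>spins. of_bool (\<sigma> \<in> satisfied X) * (\<sigma> a * \<sigma> b))))"
    by (subst sum.swap) (simp add: sum_distrib_left)
  also have "\<dots> = (\<Sum>X\<in>Pow E. exp (- \<beta>) ^ card E * (fk_weight V r X * of_bool ((a, b) \<in> conn X)))"
  proof (intro sum.cong refl)
    fix X assume "X \<in> Pow E"
    then have X: "X \<subseteq> E" by simp
    have "(\<Sum>\<sigma>\<in>spins. of_bool (\<sigma> \<in> satisfied X) * (\<sigma> a * \<sigma> b)) = (\<Sum>\<sigma>\<in>satisfied X. \<sigma> a * \<sigma> b)"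
      using finite_spins by (intro sum.mono_neutral_cong_right) (auto simp: satisfied_def)
    then show "exp (- \<beta>) ^ card E * (r ^ card X * (\<Sum>\<sigma>\<in>spins. of_bool (\<sigma> \<in> satisfied X) * (\<sigma> a * \<sigma> b)))
        = exp (- \<beta>) ^ card E * (fk_weight V r X * of_bool ((a, b) \<in> conn X))"
      by (simp add: satisfied_correlation[OF X ab] card_satisfied[OF X] fk_weight_def)
  qed
  finally show ?thesis
    by (simp add: fk_sum_def interval sum_distrib_left r_def)
qed

end

definition inner_edges :: "'d::finite site set \<Rightarrow> 'd edge set" where
  "inner_edges \<Lambda> = {e. endpoints e \<subseteq> \<Lambda>}"

lemma finite_subgraph_inner_edges: "finite \<Lambda> \<Longrightarrow> finite_subgraph (\<Lambda>, inner_edges \<Lambda>)"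
proof -
  assume fin: "finite \<Lambda>"
  have "inner_edges \<Lambda> \<subseteq> \<Lambda> \<times> UNIV"
    by (auto simp: inner_edges_def endpoints_def)
  then have "finite (inner_edges \<Lambda>)"
    by (rule finite_subset) (use fin in simp)
  then show ?thesis
    using fin by (auto simp: finite_subgraph_def inner_edges_def)
qed

theorem edwards_sokal:
  fixes a b :: "'d::finite site"
  assumes \<beta>: "0 \<le> \<beta>" and \<Lambda>: "finite \<Lambda>" "a \<in> \<Lambda>" "b \<in> \<Lambda>"
  shows "(\<integral>\<sigma>. \<sigma> a * \<sigma> b \<partial>ising_measure \<Lambda> \<beta>)
    = (\<integral>\<omega>. of_bool ((a, b) \<in> (open_adj \<omega>)\<^sup>*) \<partial>random_cluster (1 - exp (- 2 * \<beta>)) (\<Lambda>, inner_edges \<Lambda>))"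
proof -
  interpret finite_graph \<Lambda> "inner_edges \<Lambda>"
    by unfold_locales (rule finite_subgraph_inner_edges[OF \<Lambda>(1)])
  let ?w = "\<lambda>\<sigma>. exp (\<beta> * (\<Sum>e\<in>inner_edges \<Lambda>. \<Prod>v\<in>endpoints e. \<sigma> v))"
  have "(\<integral>\<sigma>. \<sigma> a * \<sigma> b \<partial>ising_measure \<Lambda> \<beta>)
      = (\<Sum>\<sigma>\<in>spins. ?w \<sigma> * (\<sigma> a * \<sigma> b)) / (\<Sum>\<sigma>\<in>spins. ?w \<sigma>)"
    unfolding ising_measure_def inner_edges_def
    using finite_spins by (intro integral_proportional_measure) auto
  also have "(\<Sum>\<sigma>\<in>spins. ?w \<sigma>) = (\<Sum>\<sigma>\<in>spins. ?w \<sigma> * (\<sigma> a * \<sigma> a))"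
    by (intro sum.cong) (simp_all add: spin_square \<Lambda>)
  also have "(\<Sum>\<sigma>\<in>spins. ?w \<sigma> * (\<sigma> a * \<sigma> b)) / (\<Sum>\<sigma>\<in>spins. ?w \<sigma> * (\<sigma> a * \<sigma> a))
      = fk_mean \<Lambda> (exp (2 * \<beta>) - 1) {} (inner_edges \<Lambda>) (\<lambda>X. of_bool ((a, b) \<in> conn X))"
    unfolding edwards_sokal_sum[OF \<beta> \<Lambda>(2) \<Lambda>(3)] edwards_sokal_sum[OF \<beta> \<Lambda>(2) \<Lambda>(2)]
    by (simp add: fk_mean_def)
  also have "exp (2 * \<beta>) - 1 = (1 - exp (- 2 * \<beta>)) / (1 - (1 - exp (- 2 * \<beta>)))"
    by (simp add: exp_minus field_simps)
  finally show ?thesis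
    using \<beta> by (subst integral_random_cluster) (auto simp: conn_def)
qed

section \<open>The infinite-volume measure\<close>

lemma eventually_subgraphs:
  assumes "finite_subgraph G"
    and "\<And>H. finite_subgraph H \<Longrightarrow> fst G \<subseteq> fst H \<Longrightarrow> snd G \<subseteq> snd H \<Longrightarrow> P H"
  shows "eventually P subgraphs_at_top"
proof -
  have "subgraphs_at_top \<le> principal {H. finite_subgraph H \<and> fst G \<subseteq> fst H \<and> snd G \<subseteq> snd H}"
    unfolding subgraphs_at_top_def using assms(1) by (intro INF_lower) simp
  then show ?thesis
    by (rule filter_leD) (use assms(2) in \<open>auto simp: eventually_principal\<close>)
qed

lemma finite_subgraph_empty: "finite_subgraph ({}, {})"
  by (simp add: finite_subgraph_def)

lemma eventually_finite_subgraph: "eventually finite_subgraph subgraphs_at_top"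
  by (rule eventually_subgraphs[OF finite_subgraph_empty])

lemma subgraphs_at_top_neq_bot: "(subgraphs_at_top :: ('d::finite site set \<times> 'd edge set) filter) \<noteq> bot"
proof
  let ?F = "\<lambda>G :: 'd site set \<times> 'd edge set.
    principal {H. finite_subgraph H \<and> fst G \<subseteq> fst H \<and> snd G \<subseteq> snd H}"
  assume "(subgraphs_at_top :: ('d site set \<times> 'd edge set) filter) = bot"
  then have "eventually (\<lambda>_. False) (INF G\<in>Collect finite_subgraph. ?F G)"
    unfolding subgraphs_at_top_def by (simp add: eventually_False)
  then have "\<exists>G\<in>Collect finite_subgraph. eventually (\<lambda>_. False) (?F G)"
  proof (subst (asm) eventually_INF_base)
    show "Collect finite_subgraph \<noteq> {}" using finite_subgraph_empty by auto
    fix G H :: "'d site set \<times> 'd edge set"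
    assume "G \<in> Collect finite_subgraph" "H \<in> Collect finite_subgraph"
    then have "finite_subgraph (fst G \<union> fst H, snd G \<union> snd H)"
      by (auto simp: finite_subgraph_def)
    then show "\<exists>K\<in>Collect finite_subgraph. ?F K \<le> inf (?F G) (?F H)"
      by (intro bexI[of _ "(fst G \<union> fst H, snd G \<union> snd H)"]) auto
  qed auto
  then show False by (auto simp: eventually_principal)
qed

lemma tendsto_subgraphs_mono:
  fixes u :: "'d::finite site set \<times> 'd edge set \<Rightarrow> real"
  assumes mono: "\<And>G H. finite_subgraph G \<Longrightarrow> finite_subgraph H \<Longrightarrow> fst G \<subseteq> fst H \<Longrightarrow> snd G \<subseteq> snd H \<Longrightarrow> u G \<le> u H"
    and bound: "\<And>G. finite_subgraph G \<Longrightarrow> u G \<le> c"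
  shows "(u \<longlongrightarrow> (SUP G\<in>Collect finite_subgraph. u G)) subgraphs_at_top"
proof (rule order_tendstoI)
  have bdd: "bdd_above (u ` Collect finite_subgraph)"
    using bound by (auto intro!: bdd_aboveI)
  have ne: "Collect finite_subgraph \<noteq> ({} :: ('d site set \<times> 'd edge set) set)"
    using finite_subgraph_empty by auto
  fix a
  { assume "a < (SUP G\<in>Collect finite_subgraph. u G)"
    then obtain G where "finite_subgraph G" "a < u G"
      using less_cSUP_iff[OF ne bdd] by auto
    then show "eventually (\<lambda>H. a < u H) subgraphs_at_top"
      by (intro eventually_subgraphs[of G]) (assumption, rule less_le_trans, assumption, rule mono) }
  { assume a: "(SUP G\<in>Collect finite_subgraph. u G) < a"
    have "u H < a" if "finite_subgraph H" for H
      using cSUP_upper[OF _ bdd, of H] that a by simp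
    then show "eventually (\<lambda>H. u H < a) subgraphs_at_top"
      using eventually_finite_subgraph by (auto elim: eventually_mono) }
qed

lemma random_cluster_prob:
  fixes G :: "'d::finite site set \<times> 'd edge set" and f :: "'d config \<Rightarrow> real"
  assumes G: "finite_subgraph G" and p: "0 \<le> p" "p \<le> 1"
  shows "prob_space (random_cluster p G)" and "integrable (random_cluster p G) f"
proof -
  obtain V E where G_eq: "G = (V, E)" by (cases G)
  interpret finite_graph V E by unfold_locales (use G G_eq in simp)
  let ?A = "{\<omega>. \<forall>e. \<omega> e \<longrightarrow> e \<in> E}"
  let ?w = "\<lambda>\<omega>. 2 ^ num_clusters V \<omega> * p ^ card {e \<in> E. \<omega> e} * (1 - p) ^ card {e \<in> E. \<not> \<omega> e}"
  have nonneg: "0 \<le> ?w \<omega>" for \<omega> using p by simp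
  \<comment> \<open>For \<open>p = 1\<close> only the fully open configuration has positive weight.\<close>
  have "0 < ?w (\<lambda>e. p = 1 \<and> e \<in> E)"
    using p by (cases "p = 1") (auto simp: zero_less_power)
  moreover have "(\<lambda>e. p = 1 \<and> e \<in> E) \<in> ?A" by auto
  ultimately have Z: "0 < (\<Sum>\<omega>\<in>?A. ?w \<omega>)"
    using nonneg finite_configs by (intro sum_pos2[of _ "\<lambda>e. p = 1 \<and> e \<in> E"]) auto
  have m: "random_cluster p G = point_measure ?A (\<lambda>\<omega>. ennreal (?w \<omega> / (\<Sum>\<omega>\<in>?A. ?w \<omega>)))"
    by (simp add: G_eq random_cluster_def proportional_measure_def)
  have "(\<Sum>\<omega>\<in>?A. ennreal (?w \<omega> / (\<Sum>\<omega>\<in>?A. ?w \<omega>))) = ennreal (\<Sum>\<omega>\<in>?A. ?w \<omega> / (\<Sum>\<omega>\<in>?A. ?w \<omega>))"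
    using nonneg Z by (intro sum_ennreal) (auto intro!: divide_nonneg_pos)
  also have "\<dots> = 1"
    using Z by (simp add: sum_divide_distrib[symmetric] del: times_divide_eq_left)
  finally show "prob_space (random_cluster p G)"
    unfolding m using finite_configs
    by (intro prob_spaceI) (simp add: space_point_measure emeasure_point_measure_finite)
  show "integrable (random_cluster p G) f"
    unfolding m using finite_configs by (intro integrable_point_measure_finite)
qed

definition depends_on :: "('d::finite config \<Rightarrow> 'b) \<Rightarrow> 'd edge set \<Rightarrow> bool" where
  "depends_on f J \<longleftrightarrow> (\<forall>\<omega>. f \<omega> = f (\<lambda>e. e \<in> J \<and> \<omega> e))"

abbreviation trace :: "'d::finite edge set \<Rightarrow> 'd config \<Rightarrow> 'd edge set" where
  "trace J \<omega> \<equiv> {e \<in> J. \<omega> e}"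

lemma depends_on_trace_eq: "J \<subseteq> H \<Longrightarrow> depends_on (\<lambda>\<omega>. h (trace J \<omega>)) H"
proof -
  assume "J \<subseteq> H"
  then have "trace J \<omega> = trace J (\<lambda>e. e \<in> H \<and> \<omega> e)" for \<omega> :: "'a config" by blast
  then show ?thesis unfolding depends_on_def by simp
qed

lemma depends_on_trace: "depends_on f J \<Longrightarrow> f \<omega> = f (\<lambda>e. e \<in> trace J \<omega>)"
  unfolding depends_on_def by simp

lemma depends_on_expand:
  fixes f :: "'d::finite config \<Rightarrow> real"
  assumes "depends_on f J" "finite J"
  shows "f \<omega> = (\<Sum>T\<in>Pow J. f (\<lambda>e. e \<in> T) * of_bool (trace J \<omega> = T))"
proof -
  have "(\<Sum>T\<in>Pow J. f (\<lambda>e. e \<in> T) * of_bool (trace J \<omega> = T))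
      = (\<Sum>T\<in>{trace J \<omega>}. f (\<lambda>e. e \<in> T) * of_bool (trace J \<omega> = T))"
    using assms(2) by (intro sum.mono_neutral_right) auto
  then show ?thesis
    using depends_on_trace[OF assms(1), of \<omega>] by simp
qed

text \<open>Probabilities of increasing events converge by monotonicity. The other cylinder events follow by
  subtraction, one closed edge at a time.\<close>

lemma cylinder_convergent:
  fixes T D :: "'d::finite edge set"
  assumes p: "0 \<le> p" "p \<le> 1" and "finite D"
  shows "\<exists>l. ((\<lambda>G. \<integral>\<omega>. of_bool ((\<forall>e\<in>T. \<omega> e) \<and> (\<forall>e\<in>D. \<not> \<omega> e)) \<partial>random_cluster p G) \<longlongrightarrow> (l::real)) subgraphs_at_top"
  using \<open>finite D\<close>
proof (induction D arbitrary: T rule: finite_induct)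
  case empty
  let ?f = "\<lambda>\<omega> :: 'd config. of_bool (\<forall>e\<in>T. \<omega> e) :: real"
  have "((\<lambda>G. \<integral>\<omega>. ?f \<omega> \<partial>random_cluster p G) \<longlongrightarrow>
      (SUP G\<in>Collect finite_subgraph. \<integral>\<omega>. ?f \<omega> \<partial>random_cluster p G)) subgraphs_at_top"
  proof (rule tendsto_subgraphs_mono)
    fix G H :: "'d site set \<times> 'd edge set"
    assume GH: "finite_subgraph G" "finite_subgraph H" "fst G \<subseteq> fst H" "snd G \<subseteq> snd H"
    show "(\<integral>\<omega>. ?f \<omega> \<partial>random_cluster p G) \<le> (\<integral>\<omega>. ?f \<omega> \<partial>random_cluster p H)"
    proof -
      have "(\<integral>\<omega>. ?f \<omega> \<partial>random_cluster p (fst G, snd G)) \<le> (\<integral>\<omega>. ?f \<omega> \<partial>random_cluster p (fst H, snd H))"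
      proof (rule random_cluster_mono)
        fix \<omega> \<omega>' :: "'d config" assume "\<omega> \<le> \<omega>'"
        then have "(\<forall>e\<in>T. \<omega> e) \<longrightarrow> (\<forall>e\<in>T. \<omega>' e)"
          unfolding le_fun_def le_bool_def by blast
        then show "?f \<omega> \<le> ?f \<omega>'" by (simp add: of_bool_def)
      qed (use GH p in auto)
      then show ?thesis by simp
    qed
  next
    fix G :: "'d site set \<times> 'd edge set" assume G: "finite_subgraph G"
    interpret prob_space "random_cluster p G" by (rule random_cluster_prob[OF G p])
    show "(\<integral>\<omega>. ?f \<omega> \<partial>random_cluster p G) \<le> 1"
      by (rule integral_le_const) (auto intro: random_cluster_prob[OF G p])
  qed
  then show ?case by auto
next
  case (insert e D)
  let ?f = "\<lambda>T D \<omega>. of_bool ((\<forall>e\<in>T. \<omega> e) \<and> (\<forall>e\<in>D. \<not> \<omega> e)) :: real"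
  obtain l1 l2 where l: "((\<lambda>G. \<integral>\<omega>. ?f T D \<omega> \<partial>random_cluster p G) \<longlongrightarrow> l1) subgraphs_at_top"
      "((\<lambda>G. \<integral>\<omega>. ?f (insert e T) D \<omega> \<partial>random_cluster p G) \<longlongrightarrow> l2) subgraphs_at_top"
    using insert.IH by meson
  have "(\<integral>\<omega>. ?f T D \<omega> \<partial>random_cluster p G) - (\<integral>\<omega>. ?f (insert e T) D \<omega> \<partial>random_cluster p G)
      = (\<integral>\<omega>. ?f T (insert e D) \<omega> \<partial>random_cluster p G)" if "finite_subgraph G" for G
    unfolding Bochner_Integration.integral_diff[OF random_cluster_prob(2)[OF that p] random_cluster_prob(2)[OF that p], symmetric]
    by (intro Bochner_Integration.integral_cong refl) auto
  then have "eventually (\<lambda>G. (\<integral>\<omega>. ?f T D \<omega> \<partial>random_cluster p G) - (\<integral>\<omega>. ?f (insert e T) D \<omega> \<partial>random_cluster p G)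
      = (\<integral>\<omega>. ?f T (insert e D) \<omega> \<partial>random_cluster p G)) subgraphs_at_top"
    using eventually_finite_subgraph by (auto elim: eventually_mono)
  from Lim_transform_eventually[OF tendsto_diff[OF l] this] show ?case by blast
qed

definition cyl_prob :: "real \<Rightarrow> 'd::finite edge set \<Rightarrow> 'd edge set \<Rightarrow> real" where
  "cyl_prob p J T = Lim subgraphs_at_top (\<lambda>G. \<integral>\<omega>. of_bool (trace J \<omega> = T) \<partial>random_cluster p G)"

lemma tendsto_cyl_prob:
  assumes p: "0 \<le> p" "p \<le> 1" and J: "finite J" "T \<subseteq> J"
  shows "((\<lambda>G. \<integral>\<omega>. of_bool (trace J \<omega> = T) \<partial>random_cluster p G) \<longlongrightarrow> cyl_prob p J T) subgraphs_at_top"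
proof -
  have eq: "trace J \<omega> = T \<longleftrightarrow> (\<forall>e\<in>T. \<omega> e) \<and> (\<forall>e\<in>J - T. \<not> \<omega> e)" for \<omega>
    using J by auto
  obtain l where "((\<lambda>G. \<integral>\<omega>. of_bool (trace J \<omega> = T) \<partial>random_cluster p G) \<longlongrightarrow> (l::real)) subgraphs_at_top"
    unfolding eq using cylinder_convergent[OF p, of "J - T" T] J by blast
  then show ?thesis
    unfolding cyl_prob_def using tendsto_Lim[OF subgraphs_at_top_neq_bot] by fastforce
qed

lemma tendsto_depends_on:
  fixes f :: "'d::finite config \<Rightarrow> real"
  assumes p: "0 \<le> p" "p \<le> 1" and f: "depends_on f J" "finite J"
  shows "((\<lambda>G. \<integral>\<omega>. f \<omega> \<partial>random_cluster p G) \<longlongrightarrow> (\<Sum>T\<in>Pow J. f (\<lambda>e. e \<in> T) * cyl_prob p J T)) subgraphs_at_top"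
proof -
  have lim: "((\<lambda>G. \<Sum>T\<in>Pow J. f (\<lambda>e. e \<in> T) * (\<integral>\<omega>. of_bool (trace J \<omega> = T) \<partial>random_cluster p G))
      \<longlongrightarrow> (\<Sum>T\<in>Pow J. f (\<lambda>e. e \<in> T) * cyl_prob p J T)) subgraphs_at_top"
    by (intro tendsto_sum tendsto_mult tendsto_const tendsto_cyl_prob p f) auto
  have "(\<Sum>T\<in>Pow J. f (\<lambda>e. e \<in> T) * (\<integral>\<omega>. of_bool (trace J \<omega> = T) \<partial>random_cluster p G))
      = (\<integral>\<omega>. f \<omega> \<partial>random_cluster p G)" if "finite_subgraph G" for G
  proof -
    have "(\<integral>\<omega>. f \<omega> \<partial>random_cluster p G)
        = (\<integral>\<omega>. (\<Sum>T\<in>Pow J. f (\<lambda>e. e \<in> T) * of_bool (trace J \<omega> = T)) \<partial>random_cluster p G)"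
      by (intro Bochner_Integration.integral_cong refl depends_on_expand f)
    also have "\<dots> = (\<Sum>T\<in>Pow J. (\<integral>\<omega>. f (\<lambda>e. e \<in> T) * of_bool (trace J \<omega> = T) \<partial>random_cluster p G))"
      by (intro Bochner_Integration.integral_sum random_cluster_prob(2)[OF that p])
    finally show ?thesis by simp
  qed
  then have "eventually (\<lambda>G. (\<Sum>T\<in>Pow J. f (\<lambda>e. e \<in> T) * (\<integral>\<omega>. of_bool (trace J \<omega> = T) \<partial>random_cluster p G))
      = (\<integral>\<omega>. f \<omega> \<partial>random_cluster p G)) subgraphs_at_top"
    using eventually_finite_subgraph by (auto elim: eventually_mono)
  from Lim_transform_eventually[OF lim this] show ?thesis .
qed

lemma cyl_prob_nonneg:
  assumes "0 \<le> p" "p \<le> 1" "finite J" "T \<subseteq> J"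
  shows "0 \<le> cyl_prob p J T"
  by (rule tendsto_lowerbound[OF tendsto_cyl_prob[OF assms] _ subgraphs_at_top_neq_bot]) simp

lemma sum_cyl_prob:
  fixes J :: "'d::finite edge set"
  assumes p: "0 \<le> p" "p \<le> 1" and J: "finite J"
  shows "(\<Sum>T\<in>Pow J. cyl_prob p J T) = 1"
proof -
  have "depends_on (\<lambda>_ :: 'd config. 1 :: real) J" by (simp add: depends_on_def)
  from tendsto_depends_on[OF p this J]
  have "((\<lambda>G. integral\<^sup>L (random_cluster p G) (\<lambda>_ :: 'd config. 1)) \<longlongrightarrow> (\<Sum>T\<in>Pow J. 1 * cyl_prob p J T)) subgraphs_at_top" .
  moreover have "eventually (\<lambda>G. (integral\<^sup>L (random_cluster p G) (\<lambda>_ :: 'd config. 1)) = (1::real)) subgraphs_at_top"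
    using eventually_finite_subgraph
    by (rule eventually_mono) (use random_cluster_prob(1)[OF _ p] prob_space.prob_space in force)
  then have "((\<lambda>G. integral\<^sup>L (random_cluster p G) (\<lambda>_ :: 'd config. 1)) \<longlongrightarrow> (1::real)) subgraphs_at_top"
    by (rule tendsto_eventually)
  ultimately show ?thesis
    using tendsto_unique[OF subgraphs_at_top_neq_bot] by simp
qed

lemma cyl_prob_consistent:
  fixes J H :: "'d::finite edge set"
  assumes p: "0 \<le> p" "p \<le> 1" and J: "finite H" "J \<subseteq> H" "T \<subseteq> J"
  shows "(\<Sum>S | S \<in> Pow H \<and> S \<inter> J = T. cyl_prob p H S) = cyl_prob p J T"
proof -
  have fin: "finite J" using J finite_subset by auto
  let ?f = "\<lambda>\<omega>. of_bool (trace J \<omega> = T) :: real"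
  have "depends_on ?f H"
    by (rule depends_on_trace_eq[OF J(2)])
  then have "((\<lambda>G. \<integral>\<omega>. ?f \<omega> \<partial>random_cluster p G) \<longlongrightarrow> (\<Sum>S\<in>Pow H. ?f (\<lambda>e. e \<in> S) * cyl_prob p H S)) subgraphs_at_top"
    using J by (intro tendsto_depends_on p) auto
  moreover have "(\<Sum>S\<in>Pow H. ?f (\<lambda>e. e \<in> S) * cyl_prob p H S) = (\<Sum>S | S \<in> Pow H \<and> S \<inter> J = T. cyl_prob p H S)"
  proof (rule sum.mono_neutral_cong_right)
    have "trace J (\<lambda>e. e \<in> S) = S \<inter> J" for S by auto
    then show "\<forall>i\<in>Pow H - {S. S \<in> Pow H \<and> S \<inter> J = T}. ?f (\<lambda>e. e \<in> i) * cyl_prob p H i = 0"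
      and "\<And>x. x \<in> {S. S \<in> Pow H \<and> S \<inter> J = T} \<Longrightarrow> ?f (\<lambda>e. e \<in> x) * cyl_prob p H x = cyl_prob p H x"
      by auto
  qed (use J in auto)
  ultimately show ?thesis
    using tendsto_unique[OF subgraphs_at_top_neq_bot _ tendsto_cyl_prob[OF p fin J(3)]] by simp
qed

text \<open>With this instance the Borel sigma-algebra on configurations is the product sigma-algebra.\<close>

instance bool :: second_countable_topology
proof
  show "\<exists>B::bool set set. countable B \<and> open = generate_topology B"
    by (intro exI[of _ "range lessThan \<union> range greaterThan"]) (auto simp: open_bool_def)
qed

lemma open_depends_on:
  fixes Q :: "'d::finite config \<Rightarrow> bool"
  assumes "depends_on Q J" "finite J"
  shows "open {\<omega>. Q \<omega>}"
proof -
  have "{\<omega>. Q \<omega>} = (\<Union>T\<in>{T. Q (\<lambda>e. e \<in> T)}. {\<omega>. \<forall>e\<in>J. \<omega> e \<in> {e \<in> T}})"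
  proof (intro set_eqI iffI)
    fix \<omega> assume "\<omega> \<in> {\<omega>. Q \<omega>}"
    then have "Q (\<lambda>e. e \<in> trace J \<omega>)" using depends_on_trace[OF assms(1)] by simp
    then show "\<omega> \<in> (\<Union>T\<in>{T. Q (\<lambda>e. e \<in> T)}. {\<omega>. \<forall>e\<in>J. \<omega> e \<in> {e \<in> T}})"
      by (intro UN_I[of "trace J \<omega>"]) auto
  next
    fix \<omega> assume "\<omega> \<in> (\<Union>T\<in>{T. Q (\<lambda>e. e \<in> T)}. {\<omega>. \<forall>e\<in>J. \<omega> e \<in> {e \<in> T}})"
    then obtain T where T: "Q (\<lambda>e. e \<in> T)" "\<And>e. e \<in> J \<Longrightarrow> \<omega> e = (e \<in> T)" by auto
    then have "Q (\<lambda>e. e \<in> trace J (\<lambda>e. e \<in> T))" using depends_on_trace[OF assms(1)] by metis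
    moreover have "trace J (\<lambda>e. e \<in> T) = trace J \<omega>" using T(2) by auto
    ultimately show "\<omega> \<in> {\<omega>. Q \<omega>}" using depends_on_trace[OF assms(1)] by (metis mem_Collect_eq)
  qed
  also have "open \<dots>"
    by (intro open_UN ballI product_topology_basis'[where x = "\<lambda>e. e"] assms(2)) (rule Topological_Spaces.open_discrete)
  finally show ?thesis .
qed

lemma continuous_depends_on:
  fixes f :: "'d::finite config \<Rightarrow> real"
  assumes "depends_on f J" "finite J"
  shows "continuous_on UNIV f"
proof -
  have "open (f -` B)" for B
  proof -
    have "depends_on (\<lambda>\<omega>. f \<omega> \<in> B) J"
      using assms(1) unfolding depends_on_def by metis
    from open_depends_on[OF this assms(2)] show ?thesis by (simp add: vimage_def)
  qed
  then show ?thesis by (simp add: continuous_on_open_vimage)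
qed

lemma bounded_depends_on:
  fixes f :: "'d::finite config \<Rightarrow> real"
  assumes "depends_on f J" "finite J"
  shows "bounded (range f)"
proof -
  have "f \<omega> \<in> (\<lambda>T. f (\<lambda>e. e \<in> T)) ` Pow J" for \<omega>
    by (rule image_eqI[where x = "trace J \<omega>"]) (rule depends_on_trace[OF assms(1)], auto)
  then have "range f \<subseteq> (\<lambda>T. f (\<lambda>e. e \<in> T)) ` Pow J"
    by auto
  then show ?thesis
    using assms(2) by (meson finite_Pow_iff finite_imageI finite_imp_bounded finite_subset)
qed

text \<open>The limiting cylinder probabilities are consistent, so Kolmogorov's extension theorem applies. It
  concerns Polish spaces, so the state of an edge is first encoded as a real number, with \<open>1\<close> for
  open.\<close>

lemma infinite_volume_exists:
  fixes p :: real
  assumes p: "0 \<le> p" "p \<le> 1"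
  obtains M :: "'d::finite config measure" where "prob_space M" "sets M = sets borel"
    "\<And>J T. finite J \<Longrightarrow> T \<subseteq> J \<Longrightarrow> measure M {\<omega>. trace J \<omega> = T} = cyl_prob p J T"
proof -
  define pm where "pm J = point_measure (Pow J) (\<lambda>T. ennreal (cyl_prob p J T))" for J :: "'d edge set"
  define ind where "ind J T = (\<lambda>e\<in>J. of_bool (e \<in> T) :: real)" for J T :: "'d edge set"
  define P where "P J = distr (pm J) (PiM J (\<lambda>_. borel)) (ind J)" for J :: "'d edge set"
  have ind_meas: "ind J \<in> measurable (pm J) (PiM J (\<lambda>_. borel))" for J
    by (auto simp: pm_def ind_def space_PiM)
  have pm_singleton: "emeasure (pm J) {T} = cyl_prob p J T" if "finite J" "T \<subseteq> J" for J T
    using that unfolding pm_def by (subst emeasure_point_measure_finite) auto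
  have "polish_projective UNIV P"
  proof (intro polish_projective.intro projective_family.intro)
    fix J H :: "'d edge set" assume JH: "J \<subseteq> H" "finite H"
    have fJ: "finite J" using JH finite_subset by auto
    have pm_J: "distr (pm H) (count_space (Pow J)) (\<lambda>T. T \<inter> J) = pm J"
    proof (rule measure_eqI_finite)
      fix T assume "T \<in> Pow J"
      then have T: "T \<subseteq> J" by simp
      have "emeasure (distr (pm H) (count_space (Pow J)) (\<lambda>T. T \<inter> J)) {T}
          = emeasure (pm H) {S. S \<in> Pow H \<and> S \<inter> J = T}"
        using T by (subst emeasure_distr)
          (auto simp: pm_def space_point_measure intro!: arg_cong2[where f = emeasure])
      also have "\<dots> = (\<Sum>S | S \<in> Pow H \<and> S \<inter> J = T. ennreal (cyl_prob p H S))"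
        unfolding pm_def using JH by (subst emeasure_point_measure_finite) auto
      also have "\<dots> = ennreal (\<Sum>S | S \<in> Pow H \<and> S \<inter> J = T. cyl_prob p H S)"
        using JH p by (intro sum_ennreal cyl_prob_nonneg) auto
      also have "\<dots> = emeasure (pm J) {T}"
        using cyl_prob_consistent[OF p JH(2,1) T] pm_singleton[OF fJ T] by simp
      finally show "emeasure (distr (pm H) (count_space (Pow J)) (\<lambda>T. T \<inter> J)) {T} = emeasure (pm J) {T}" .
    qed (use fJ in \<open>auto simp: pm_def sets_point_measure\<close>)
    have "distr (P H) (PiM J (\<lambda>_. borel)) (\<lambda>f. restrict f J)
        = distr (pm H) (PiM J (\<lambda>_. borel)) ((\<lambda>f. restrict f J) \<circ> ind H)"
      unfolding P_def using JH by (intro distr_distr ind_meas measurable_restrict_subset) auto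
    also have "(\<lambda>f. restrict f J) \<circ> ind H = ind J \<circ> (\<lambda>T. T \<inter> J)"
      using JH(1) by (auto simp: ind_def fun_eq_iff restrict_def)
    also have "distr (pm H) (PiM J (\<lambda>_. borel)) (ind J \<circ> (\<lambda>T. T \<inter> J))
        = distr (distr (pm H) (count_space (Pow J)) (\<lambda>T. T \<inter> J)) (PiM J (\<lambda>_. borel)) (ind J)"
      by (intro distr_distr[symmetric]) (auto simp: pm_def ind_def space_PiM)
    finally show "P J = distr (P H) (PiM J (\<lambda>_. borel)) (\<lambda>f. restrict f J)"
      by (simp only: pm_J P_def)
  next
    fix J :: "'d edge set" assume J: "finite J"
    have "(\<Sum>T\<in>Pow J. ennreal (cyl_prob p J T)) = ennreal (\<Sum>T\<in>Pow J. cyl_prob p J T)"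
      by (intro sum_ennreal cyl_prob_nonneg p J) auto
    then have "emeasure (pm J) (space (pm J)) = 1"
      unfolding pm_def space_point_measure using J
      by (simp add: emeasure_point_measure_finite sum_cyl_prob[OF p J])
    then have "prob_space (pm J)" by (rule prob_spaceI)
    then show "prob_space (P J)"
      unfolding P_def by (rule prob_space.prob_space_distr[OF _ ind_meas])
  qed
  then interpret polish_projective UNIV P .
  define open_config where "open_config f = (\<lambda>e. f e = 1)" for f :: "'d edge \<Rightarrow> real"
  define M where "M = distr lim borel open_config"
  have meas: "open_config \<in> measurable lim borel"
  proof (rule measurable_coordinatewise_then_product)
    fix e :: "'d edge"
    have "(\<lambda>f :: 'd edge \<Rightarrow> real. f e) \<in> measurable lim borel"
      by (simp add: measurable_cong_sets[OF sets_lim refl])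
    moreover have "(\<lambda>x :: real. x = 1) \<in> measurable borel borel"
    proof (rule measurableI)
      fix A :: "bool set"
      have "(\<lambda>x :: real. x = 1) \<in> measurable borel (count_space UNIV)"
        by measurable
      then show "(\<lambda>x :: real. x = 1) -` A \<inter> space borel \<in> sets borel"
        by (rule measurable_sets) simp
    qed simp
    ultimately show "(\<lambda>f. open_config f e) \<in> borel_measurable lim"
      unfolding open_config_def by (rule measurable_compose)
  qed
  show ?thesis
  proof (rule that)
    show "prob_space M"
      unfolding M_def by (rule P.prob_space_distr[OF meas])
    show "sets M = sets borel" by (simp add: M_def)
    fix J T :: "'d edge set" assume J: "finite J" "T \<subseteq> J"
    let ?X = "PiE J (\<lambda>e. if e \<in> T then {1 :: real} else - {1})"
    have "depends_on (\<lambda>\<omega>. trace J \<omega> = T) J"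
      by (rule depends_on_trace_eq) simp
    then have "{\<omega>. trace J \<omega> = T} \<in> sets borel"
      using J by (intro borel_open open_depends_on)
    then have "measure M {\<omega>. trace J \<omega> = T} = measure lim (open_config -` {\<omega>. trace J \<omega> = T} \<inter> space lim)"
      unfolding M_def using meas by (intro measure_distr)
    also have "open_config -` {\<omega>. trace J \<omega> = T} \<inter> space lim = emb UNIV J ?X"
      using J by (auto simp: prod_emb_def space_PiM open_config_def PiE_iff split: if_splits)
    also have "measure lim (emb UNIV J ?X) = measure (P J) ?X"
      using J by (intro measure_lim_emb sets_PiM_I_finite) auto
    also have "\<dots> = measure (pm J) (ind J -` ?X \<inter> space (pm J))"
      unfolding P_def using J by (intro measure_distr ind_meas sets_PiM_I_finite) auto
    also have "ind J -` ?X \<inter> space (pm J) = {T}"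
      using J by (auto simp: pm_def space_point_measure ind_def PiE_iff split: if_splits)
    also have "measure (pm J) {T} = cyl_prob p J T"
      using pm_singleton[OF J] cyl_prob_nonneg[OF p J] by (simp add: measure_def)
    finally show "measure M {\<omega>. trace J \<omega> = T} = cyl_prob p J T" .
  qed
qed

lemma compact_configs: "compact (UNIV :: 'd::finite config set)"
proof -
  have "compact_space (euclidean :: bool topology)"
    by (simp add: compact_space_def compactin_euclidean_iff finite_imp_compact)
  then have "compact_space (product_topology (\<lambda>_ :: 'd edge. euclidean :: bool topology) UNIV)"
    by (simp add: compact_space_product_topology)
  then show ?thesis
    by (simp add: euclidean_product_topology compact_space_def compactin_euclidean_iff)
qed

text \<open>By compactness, a continuous function of the configuration is uniformly close to a function of
  finitely many edges.\<close>

lemma continuous_local_approx: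
  fixes f :: "'d::finite config \<Rightarrow> real"
  assumes f: "continuous_on UNIV f" and \<epsilon>: "0 < \<epsilon>"
  obtains J where "finite J" "\<And>\<omega>. \<bar>f \<omega> - f (\<lambda>e. e \<in> J \<and> \<omega> e)\<bar> < \<epsilon>"
proof -
  have "\<exists>J. finite J \<and> (\<forall>\<omega>'. (\<forall>e\<in>J. \<omega>' e = \<omega> e) \<longrightarrow> \<bar>f \<omega>' - f \<omega>\<bar> < \<epsilon> / 2)" for \<omega>
  proof -
    have "open (f -` ball (f \<omega>) (\<epsilon> / 2))"
      using f by (simp add: continuous_on_open_vimage)
    then have "openin (product_topology (\<lambda>_. euclidean) UNIV) (f -` ball (f \<omega>) (\<epsilon> / 2))"
      by (simp only: open_fun_def)
    moreover have "\<omega> \<in> f -` ball (f \<omega>) (\<epsilon> / 2)" using \<epsilon> by simp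
    ultimately have "\<exists>X. \<omega> \<in> PiE UNIV X \<and> (\<forall>i. openin euclidean (X i))
        \<and> finite {i. X i \<noteq> topspace euclidean} \<and> PiE UNIV X \<subseteq> f -` ball (f \<omega>) (\<epsilon> / 2)"
      by (rule product_topology_open_contains_basis)
    then obtain X where X: "\<omega> \<in> PiE UNIV X" "finite {i. X i \<noteq> topspace euclidean}"
        "PiE UNIV X \<subseteq> f -` ball (f \<omega>) (\<epsilon> / 2)"
      by (elim exE conjE)
    have "\<bar>f \<omega>' - f \<omega>\<bar> < \<epsilon> / 2" if "\<forall>e\<in>{i. X i \<noteq> topspace euclidean}. \<omega>' e = \<omega> e" for \<omega>'
    proof -
      have "\<omega>' e \<in> X e" for e
      proof (cases "X e = topspace euclidean")
        case False
        then have "\<omega>' e = \<omega> e" using that by blast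
        then show ?thesis using PiE_mem[OF X(1), of e] by simp
      qed simp
      then have "\<omega>' \<in> PiE UNIV X" by auto
      then have "f \<omega>' \<in> ball (f \<omega>) (\<epsilon> / 2)" using X(3) by blast
      then show ?thesis by (simp add: dist_real_def abs_minus_commute)
    qed
    with X(2) show ?thesis by blast
  qed
  then obtain J where J: "\<And>\<omega>. finite (J \<omega>)"
      "\<And>\<omega> \<omega>'. (\<forall>e\<in>J \<omega>. \<omega>' e = \<omega> e) \<Longrightarrow> \<bar>f \<omega>' - f \<omega>\<bar> < \<epsilon> / 2"
    by metis
  define C where "C \<omega> = {\<omega>'. \<forall>e\<in>J \<omega>. \<omega>' e \<in> {\<omega> e}}" for \<omega>
  have "open (C \<omega>)" for \<omega>
    unfolding C_def
    by (intro product_topology_basis'[where x = "\<lambda>e. e"] J) (rule Topological_Spaces.open_discrete)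
  moreover have "UNIV \<subseteq> (\<Union>\<omega>\<in>UNIV. C \<omega>)"
    by (auto simp: C_def)
  ultimately obtain S where S: "finite S" "UNIV \<subseteq> (\<Union>\<omega>\<in>S. C \<omega>)"
    using compactE_image[OF compact_configs, of UNIV C] by metis
  show ?thesis
  proof (rule that)
    show "finite (\<Union>\<omega>\<in>S. J \<omega>)" using S J by simp
    fix \<omega>
    obtain \<eta> where \<eta>: "\<eta> \<in> S" "\<omega> \<in> C \<eta>" using S by auto
    have "\<bar>f \<omega> - f \<eta>\<bar> < \<epsilon> / 2"
      using \<eta> by (intro J) (simp add: C_def)
    moreover have "\<bar>f (\<lambda>e. e \<in> (\<Union>\<omega>\<in>S. J \<omega>) \<and> \<omega> e) - f \<eta>\<bar> < \<epsilon> / 2"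
      using \<eta> by (intro J) (auto simp: C_def)
    ultimately show "\<bar>f \<omega> - f (\<lambda>e. e \<in> (\<Union>\<omega>\<in>S. J \<omega>) \<and> \<omega> e)\<bar> < \<epsilon>"
      by linarith
  qed
qed

lemma (in prob_space) integral_close:
  fixes f g :: "'a \<Rightarrow> real"
  assumes "integrable M f" "integrable M g" "\<And>x. \<bar>f x - g x\<bar> \<le> c"
  shows "\<bar>(\<integral>x. f x \<partial>M) - (\<integral>x. g x \<partial>M)\<bar> \<le> c"
proof -
  have bounds: "f x - g x \<le> c" "- c \<le> f x - g x" for x
    using assms(3)[of x] by linarith+
  have "(\<integral>x. f x - g x \<partial>M) \<le> c"
    by (rule integral_le_const) (simp_all add: assms bounds)
  moreover have "- c \<le> (\<integral>x. f x - g x \<partial>M)"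
    by (rule integral_ge_const) (simp_all add: assms bounds)
  ultimately show ?thesis
    using assms by (simp add: abs_le_iff)
qed

lemma config_integrable:
  fixes f :: "'d::finite config \<Rightarrow> real"
  assumes "prob_space M" "sets M = sets borel" "continuous_on UNIV f" "bounded (range f)"
  shows "integrable M f"
proof -
  interpret prob_space M by fact
  obtain B where "\<And>\<omega>. norm (f \<omega>) \<le> B"
    using assms(4) by (auto simp: bounded_iff)
  moreover have "f \<in> borel_measurable M"
    using borel_measurable_continuous_onI[OF assms(3)] measurable_cong_sets[OF assms(2) refl] by blast
  ultimately show ?thesis
    by (intro integrable_const_bound[of _ B]) auto
qed

lemma integral_depends_on:
  fixes f :: "'d::finite config \<Rightarrow> real"
  assumes M: "prob_space M" "sets M = sets borel" and f: "depends_on f J" "finite J"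
  shows "(\<integral>\<omega>. f \<omega> \<partial>M) = (\<Sum>T\<in>Pow J. f (\<lambda>e. e \<in> T) * measure M {\<omega>. trace J \<omega> = T})"
proof -
  interpret prob_space M by fact
  have space: "space M = UNIV" using sets_eq_imp_space_eq[OF M(2)] by simp
  have meas: "{\<omega>. trace J \<omega> = T} \<in> sets M" for T
    unfolding M(2) by (intro borel_open open_depends_on[OF depends_on_trace_eq f(2)]) simp
  have ind: "of_bool (trace J \<omega> = T) = (indicator {\<omega>. trace J \<omega> = T} \<omega> :: real)" for \<omega> T
    by (simp add: indicator_def)
  have int: "integrable M (\<lambda>\<omega>. of_bool (trace J \<omega> = T) :: real)" for T
    unfolding ind using meas by (intro integrable_real_indicator) (auto simp: emeasure_eq_measure)
  have "(\<integral>\<omega>. f \<omega> \<partial>M) = (\<integral>\<omega>. (\<Sum>T\<in>Pow J. f (\<lambda>e. e \<in> T) * of_bool (trace J \<omega> = T)) \<partial>M)"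
    by (intro Bochner_Integration.integral_cong refl depends_on_expand f)
  also have "\<dots> = (\<Sum>T\<in>Pow J. \<integral>\<omega>. f (\<lambda>e. e \<in> T) * of_bool (trace J \<omega> = T) \<partial>M)"
    using int by (intro Bochner_Integration.integral_sum) auto
  also have "\<dots> = (\<Sum>T\<in>Pow J. f (\<lambda>e. e \<in> T) * measure M {\<omega>. trace J \<omega> = T})"
    using meas by (simp add: ind space)
  finally show ?thesis .
qed

lemma weakly_converges_cyl:
  fixes M :: "'d::finite config measure"
  assumes p: "0 \<le> p" "p \<le> 1" and M: "prob_space M" "sets M = sets borel"
    and cyl: "\<And>J T. finite J \<Longrightarrow> T \<subseteq> J \<Longrightarrow> measure M {\<omega>. trace J \<omega> = T} = cyl_prob p J T"
  shows "weakly_converges (random_cluster p) M subgraphs_at_top"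
  unfolding weakly_converges_def
proof (intro allI impI tendstoI)
  fix f :: "'d config \<Rightarrow> real" and \<epsilon> :: real
  assume f: "continuous_on UNIV f" "bounded (range f)" and \<epsilon>: "0 < \<epsilon>"
  obtain J where J: "finite J" "\<And>\<omega>. \<bar>f \<omega> - f (\<lambda>e. e \<in> J \<and> \<omega> e)\<bar> < \<epsilon> / 3"
    using continuous_local_approx[OF f(1), of "\<epsilon> / 3"] \<epsilon> by auto
  define g where "g \<omega> = f (\<lambda>e. e \<in> J \<and> \<omega> e)" for \<omega>
  have g: "depends_on g J" by (simp add: depends_on_def g_def)
  have close: "\<bar>f \<omega> - g \<omega>\<bar> \<le> \<epsilon> / 3" for \<omega>
    using J(2)[of \<omega>] by (simp add: g_def)
  have "((\<lambda>G. \<integral>\<omega>. g \<omega> \<partial>random_cluster p G) \<longlongrightarrow> (\<integral>\<omega>. g \<omega> \<partial>M)) subgraphs_at_top"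
  proof -
    have "(\<Sum>T\<in>Pow J. g (\<lambda>e. e \<in> T) * measure M {\<omega>. trace J \<omega> = T})
        = (\<Sum>T\<in>Pow J. g (\<lambda>e. e \<in> T) * cyl_prob p J T)"
      by (intro sum.cong refl) (simp add: cyl[OF J(1)])
    then show ?thesis
      using tendsto_depends_on[OF p g J(1)] unfolding integral_depends_on[OF M g J(1)] by simp
  qed
  then have "eventually (\<lambda>G. dist (\<integral>\<omega>. g \<omega> \<partial>random_cluster p G) (\<integral>\<omega>. g \<omega> \<partial>M) < \<epsilon> / 3) subgraphs_at_top"
    using \<epsilon> by (intro tendstoD) auto
  with eventually_finite_subgraph
  show "eventually (\<lambda>G. dist (\<integral>\<omega>. f \<omega> \<partial>random_cluster p G) (\<integral>\<omega>. f \<omega> \<partial>M) < \<epsilon>) subgraphs_at_top"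
  proof eventually_elim
    case (elim G)
    have "\<bar>(\<integral>\<omega>. f \<omega> \<partial>random_cluster p G) - (\<integral>\<omega>. g \<omega> \<partial>random_cluster p G)\<bar> \<le> \<epsilon> / 3"
      using random_cluster_prob[OF elim(1) p] close by (intro prob_space.integral_close) auto
    moreover have "\<bar>(\<integral>\<omega>. f \<omega> \<partial>M) - (\<integral>\<omega>. g \<omega> \<partial>M)\<bar> \<le> \<epsilon> / 3"
      by (intro prob_space.integral_close config_integrable M f close
          continuous_depends_on[OF g J(1)] bounded_depends_on[OF g J(1)])
    ultimately show ?case
      using elim(2) unfolding dist_real_def by linarith
  qed
qed

lemma weak_limit_unique:
  fixes M M' :: "'d::finite config measure"
  assumes M: "prob_space M" "sets M = sets borel" "weakly_converges \<mu> M F"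
    and M': "prob_space M'" "sets M' = sets borel" "weakly_converges \<mu> M' F" and F: "F \<noteq> bot"
  shows "M = M'"
proof (rule measure_eqI_PiM_infinite)
  show "sets M = sets (PiM UNIV (\<lambda>_. borel))" "sets M' = sets (PiM UNIV (\<lambda>_. borel))"
    using M(2) M'(2) by (simp_all add: sets_PiM_equal_borel)
  show "finite_measure M" using M(1) by (simp add: prob_space_def)
  interpret M: prob_space M by fact
  interpret M': prob_space M' by fact
  fix A :: "'d edge \<Rightarrow> bool set" and J :: "'d edge set" assume J: "finite J"
  let ?Q = "\<lambda>\<omega>. \<forall>e\<in>J. \<omega> e \<in> A e"
  have dep: "depends_on (\<lambda>\<omega>. of_bool (?Q \<omega>) :: real) J" "depends_on ?Q J"
    by (simp_all add: depends_on_def)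
  have emb: "prod_emb UNIV (\<lambda>_. borel) J (Pi\<^sub>E J A) = {\<omega>. ?Q \<omega>}"
    by (auto simp: prod_emb_def PiE_iff)
  have meas: "{\<omega>. ?Q \<omega>} \<in> sets borel"
    by (rule borel_open[OF open_depends_on[OF dep(2) J]])
  have lim: "((\<lambda>a. \<integral>\<omega>. of_bool (?Q \<omega>) \<partial>\<mu> a) \<longlongrightarrow> (\<integral>\<omega>. of_bool (?Q \<omega>) \<partial>K :: real)) F"
    if "weakly_converges \<mu> K F" for K
    using that continuous_depends_on[OF dep(1) J] bounded_depends_on[OF dep(1) J]
    unfolding weakly_converges_def by simp
  have "(\<integral>\<omega>. of_bool (?Q \<omega>) \<partial>M) = (\<integral>\<omega>. of_bool (?Q \<omega>) \<partial>M' :: real)"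
    by (rule tendsto_unique[OF F lim[OF M(3)] lim[OF M'(3)]])
  moreover have "of_bool (?Q \<omega>) = (indicator {\<omega>. ?Q \<omega>} \<omega> :: real)" for \<omega>
    by (simp add: indicator_def)
  ultimately have "measure M {\<omega>. ?Q \<omega>} = measure M' {\<omega>. ?Q \<omega>}"
    using meas M(2) M'(2) sets_eq_imp_space_eq[OF M(2)] sets_eq_imp_space_eq[OF M'(2)] by simp
  then show "emeasure M (prod_emb UNIV (\<lambda>_. borel) J (Pi\<^sub>E J A)) = emeasure M' (prod_emb UNIV (\<lambda>_. borel) J (Pi\<^sub>E J A))"
    unfolding emb by (simp add: M.emeasure_eq_measure M'.emeasure_eq_measure)
qed

text \<open>Existence and uniqueness of the weak limit give the definite description its meaning.\<close>

theorem infinite_random_cluster_spec: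
  fixes p :: real
  assumes p: "0 \<le> p" "p \<le> 1"
  shows "prob_space (infinite_random_cluster p :: 'd::finite config measure)"
    and "sets (infinite_random_cluster p :: 'd config measure) = sets borel"
    and "weakly_converges (random_cluster p) (infinite_random_cluster p :: 'd config measure) subgraphs_at_top"
proof -
  let ?P = "\<lambda>M :: 'd config measure. prob_space M \<and> sets M = sets borel \<and>
    weakly_converges (random_cluster p) M subgraphs_at_top"
  obtain M :: "'d config measure" where M: "prob_space M" "sets M = sets borel"
      "\<And>J T. finite J \<Longrightarrow> T \<subseteq> J \<Longrightarrow> measure M {\<omega>. trace J \<omega> = T} = cyl_prob p J T"
    using infinite_volume_exists[OF p] by blast
  have "?P (THE M. ?P M)"
  proof (rule theI)
    show "?P M" using weakly_converges_cyl[OF p M] M by simp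
    show "M' = M" if "?P M'" for M'
      using that \<open>?P M\<close> weak_limit_unique[of M' "random_cluster p" subgraphs_at_top M] subgraphs_at_top_neq_bot
      by blast
  qed
  then show "prob_space (infinite_random_cluster p :: 'd config measure)"
    and "sets (infinite_random_cluster p :: 'd config measure) = sets borel"
    and "weakly_converges (random_cluster p) (infinite_random_cluster p :: 'd config measure) subgraphs_at_top"
    unfolding infinite_random_cluster_def by blast+
qed

lemma tendsto_infinite_random_cluster:
  fixes f :: "'d::finite config \<Rightarrow> real"
  assumes p: "0 \<le> p" "p \<le> 1" and f: "depends_on f J" "finite J"
  shows "((\<lambda>G. \<integral>\<omega>. f \<omega> \<partial>random_cluster p G) \<longlongrightarrow> (\<integral>\<omega>. f \<omega> \<partial>infinite_random_cluster p)) subgraphs_at_top"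
  using infinite_random_cluster_spec(3)[OF p, where 'd = 'd] continuous_depends_on[OF f] bounded_depends_on[OF f]
  unfolding weakly_converges_def by simp

section \<open>Norms on the lattice\<close>

context
  fixes N :: "real ^ 'd::finite \<Rightarrow> real"
  assumes N: "is_norm N"
begin

lemma N_nonneg: "0 \<le> N v"
  and N_zero_iff: "N v = 0 \<longleftrightarrow> v = 0"
  and N_scale: "N (a *\<^sub>R v) = \<bar>a\<bar> * N v"
  and N_add: "N (v + w) \<le> N v + N w"
  using N by (auto simp: is_norm_def)

lemma N_sum: "finite I \<Longrightarrow> N (sum f I) \<le> (\<Sum>i\<in>I. N (f i))"
proof (induction I rule: finite_induct)
  case empty
  then show ?case using N_zero_iff[of 0] by simp
next
  case (insert i I)
  then show ?case using N_add[of "f i" "sum f I"] by simp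
qed

definition axis_total :: real where
  "axis_total = (\<Sum>i\<in>UNIV. N (axis i 1))"

lemma axis_total_pos: "0 < axis_total"
proof -
  have "0 < N (axis i 1)" for i
    using N_nonneg[of "axis i 1"] N_zero_iff[of "axis i 1"] by (simp add: axis_eq_0_iff less_le)
  then show ?thesis unfolding axis_total_def by (intro sum_pos) auto
qed

lemma N_le_coordinates:
  assumes "\<And>i. \<bar>v $ i\<bar> \<le> b"
  shows "N v \<le> axis_total * b"
proof -
  have "N v = N (\<Sum>i\<in>UNIV. (v $ i) *\<^sub>R axis i 1)"
    using basis_expansion[of v] by (simp add: scalar_mult_eq_scaleR)
  also have "\<dots> \<le> (\<Sum>i\<in>UNIV. N ((v $ i) *\<^sub>R axis i 1))"
    by (rule N_sum) simp
  also have "\<dots> \<le> (\<Sum>i\<in>UNIV. b * N (axis i 1))"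
    unfolding N_scale using assms N_nonneg by (intro sum_mono mult_right_mono) auto
  finally show ?thesis
    by (simp add: axis_total_def sum_distrib_left mult.commute)
qed

lemma N_lower_bound: obtains c where "0 < c" "\<And>v. c * norm v \<le> N v"
proof -
  have diff: "\<bar>N v - N w\<bar> \<le> axis_total * norm (v - w)" for v w
  proof -
    have "N (v - w) \<le> axis_total * norm (v - w)" "N (w - v) \<le> axis_total * norm (v - w)"
      using component_le_norm_cart[of "v - w"] component_le_norm_cart[of "w - v"]
      by (auto intro!: N_le_coordinates simp: norm_minus_commute)
    then show ?thesis using N_add[of "v - w" w] N_add[of "w - v" v] by simp
  qed
  have "axis_total-lipschitz_on UNIV N"
    using diff axis_total_pos by (intro lipschitz_onI) (auto simp: dist_norm)
  then have "continuous_on (sphere 0 1) N"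
    by (meson continuous_on_subset lipschitz_on_continuous_on subset_UNIV)
  moreover have "sphere (0 :: real ^ 'd) 1 \<noteq> {}"
    using norm_axis_1[of undefined] by (metis empty_iff mem_sphere_0)
  ultimately obtain u where u: "u \<in> sphere 0 1" "\<And>v. v \<in> sphere 0 1 \<Longrightarrow> N u \<le> N v"
    using continuous_attains_inf[of "sphere 0 1" N] by auto
  show ?thesis
  proof (rule that)
    have "u \<noteq> 0" using u(1) by auto
    then show "0 < N u" using N_nonneg[of u] N_zero_iff[of u] by (simp add: less_le)
    show "N u * norm v \<le> N v" for v
    proof (cases "v = 0")
      case True
      then show ?thesis by (simp add: N_nonneg)
    next
      case False
      then have "N u \<le> N ((1 / norm v) *\<^sub>R v)" by (intro u(2)) simp
      also have "\<dots> = N v / norm v" by (simp add: N_scale)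
      finally show ?thesis using False by (simp add: field_simps)
    qed
  qed
qed

lemma finite_N_ball: "finite {x :: 'd site. N (site_to_real x) \<le> R}"
proof -
  obtain c where c: "0 < c" "\<And>v. c * norm v \<le> N v" using N_lower_bound by blast
  define b where "b = \<lceil>R / c\<rceil>"
  have "{x :: 'd site. N (site_to_real x) \<le> R} \<subseteq> (\<lambda>f. \<chi> i. f i) ` (UNIV \<rightarrow>\<^sub>E {- b..b})"
  proof
    fix x :: "'d site" assume "x \<in> {x. N (site_to_real x) \<le> R}"
    then have "norm (site_to_real x) \<le> R / c"
      using c order_trans[OF c(2)] by (simp add: field_simps)
    then have "\<bar>real_of_int (x $ i)\<bar> \<le> R / c" for i
      using component_le_norm_cart[of "site_to_real x" i] by (simp add: site_to_real_def)
    then have "x $ i \<in> {- b..b}" for i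
      unfolding b_def by (smt (verit, ccfv_threshold) atLeastAtMost_iff le_of_int_ceiling of_int_le_iff of_int_minus)
    then show "x \<in> (\<lambda>f. \<chi> i. f i) ` (UNIV \<rightarrow>\<^sub>E {- b..b})"
      by (intro image_eqI[of _ _ "\<lambda>i. x $ i"]) (auto simp: vec_eq_iff)
  qed
  then show ?thesis
    by (rule finite_subset) (intro finite_imageI finite_PiE; simp)
qed

end

section \<open>Percolation in infinite volume\<close>

lemma finite_cluster_finite: "finite X \<Longrightarrow> finite (cluster X x)"
proof -
  assume "finite X"
  then have "finite_subgraph (insert x (\<Union>(endpoints ` X)), X)"
    by (auto simp: finite_subgraph_def endpoints_def)
  then interpret finite_graph "insert x (\<Union>(endpoints ` X))" X by unfold_locales
  show ?thesis by (rule finite_cluster) auto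
qed

lemma conn_finite_support:
  assumes "(x, y) \<in> (open_adj \<omega>)\<^sup>*"
  shows "\<exists>F. finite F \<and> F \<subseteq> Collect \<omega> \<and> (x, y) \<in> conn F"
  using assms
proof (induction rule: rtrancl_induct)
  case base
  show ?case by (intro exI[of _ "{}"]) simp
next
  case (step y z)
  then obtain F where F: "finite F" "F \<subseteq> Collect \<omega>" "(x, y) \<in> conn F" by blast
  obtain e where e: "\<omega> e" "endpoints e = {y, z}" using step.hyps(2) by (auto simp: open_adj_def)
  have "(x, y) \<in> conn (insert e F)" using F(3) conn_mono[of F "insert e F"] by auto
  moreover have "(y, z) \<in> conn (insert e F)" using e by (intro conn_edge[of e]) auto
  ultimately have "(x, z) \<in> conn (insert e F)" by (rule conn_trans)
  then show ?case using F e by (intro exI[of _ "insert e F"]) auto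
qed

text \<open>For finite \<open>E\<close> this event depends on finitely many edges and approximates \<open>large k\<close> below.\<close>

definition large_in :: "nat \<Rightarrow> 'd::finite edge set \<Rightarrow> 'd config set" where
  "large_in k E = {\<omega>. k \<le> card (cluster (trace E \<omega>) 0)}"

definition origin_cluster :: "'d::finite config \<Rightarrow> 'd site set" where
  "origin_cluster \<omega> = (open_adj \<omega>)\<^sup>* `` {0}"

text \<open>The cardinality of an infinite set is \<open>0\<close>, hence the separate case.\<close>

definition large :: "nat \<Rightarrow> 'd::finite config set" where
  "large k = {\<omega>. infinite (origin_cluster \<omega>) \<or> k \<le> card (origin_cluster \<omega>)}"

definition first_edges :: "nat \<Rightarrow> 'd::finite edge set" where
  "first_edges n = from_nat ` {..<n}"

lemma finite_first_edges: "finite (first_edges n)"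
  by (simp add: first_edges_def)

lemma first_edges_mono: "m \<le> n \<Longrightarrow> first_edges m \<subseteq> first_edges n"
  by (auto simp: first_edges_def)

lemma finite_subset_first_edges:
  fixes F :: "'d::finite edge set"
  assumes "finite F"
  obtains n where "F \<subseteq> first_edges n"
proof
  show "F \<subseteq> first_edges (Suc (Max (to_nat ` F)))"
  proof
    fix e assume "e \<in> F"
    then have "to_nat e \<le> Max (to_nat ` F)" using assms by (intro Max_ge) auto
    then show "e \<in> first_edges (Suc (Max (to_nat ` F)))"
      unfolding first_edges_def by (intro image_eqI[of _ _ "to_nat e"]) auto
  qed
qed

lemma large_in_depends_on: "depends_on (\<lambda>\<omega>. \<omega> \<in> large_in k E) E"
  unfolding large_in_def mem_Collect_eq by (rule depends_on_trace_eq) simp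

lemma large_in_mono:
  assumes "finite E'" "E \<subseteq> E'" "\<omega> \<le> \<omega>'" "\<omega> \<in> large_in k E"
  shows "\<omega>' \<in> large_in k E'"
proof -
  have "trace E \<omega> \<subseteq> trace E' \<omega>'" using assms(2,3) unfolding le_fun_def le_bool_def by blast
  then have "card (cluster (trace E \<omega>) 0) \<le> card (cluster (trace E' \<omega>') 0)"
    using assms(1) by (intro card_mono finite_cluster_finite cluster_mono) auto
  then show ?thesis using assms(4) by (simp add: large_in_def)
qed

text \<open>Finitely many edges suffice to connect the origin to \<open>k\<close> given sites of its cluster.\<close>

lemma large_eq_union: "large k = (\<Union>n. large_in k (first_edges n :: 'd::finite edge set))"
proof (intro set_eqI iffI)
  fix \<omega> :: "'d config" assume \<omega>: "\<omega> \<in> large k"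
  have "\<exists>S. S \<subseteq> origin_cluster \<omega> \<and> finite S \<and> card S = k"
  proof (cases "finite (origin_cluster \<omega>)")
    case True
    then have "k \<le> card (origin_cluster \<omega>)" using \<omega> by (simp add: large_def)
    then obtain S where "S \<subseteq> origin_cluster \<omega>" "card S = k" "finite S"
      by (rule obtain_subset_with_card_n)
    then show ?thesis by blast
  next
    case False
    then show ?thesis using infinite_arbitrarily_large[of "origin_cluster \<omega>" k] by blast
  qed
  then obtain S where S: "S \<subseteq> origin_cluster \<omega>" "finite S" "card S = k" by blast
  have "\<exists>F. finite F \<and> F \<subseteq> Collect \<omega> \<and> (0, y) \<in> conn F" if "y \<in> S" for y
    using S(1) that by (intro conn_finite_support) (auto simp: origin_cluster_def)
  then obtain F where F: "\<And>y. y \<in> S \<Longrightarrow> finite (F y)" "\<And>y. y \<in> S \<Longrightarrow> F y \<subseteq> Collect \<omega>"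
      "\<And>y. y \<in> S \<Longrightarrow> (0, y) \<in> conn (F y)" by metis
  have "finite (\<Union>(F ` S))" using S F by auto
  then obtain n where n: "\<Union>(F ` S) \<subseteq> first_edges n" by (rule finite_subset_first_edges)
  have "S \<subseteq> cluster (trace (first_edges n) \<omega>) 0"
  proof
    fix y assume y: "y \<in> S"
    have "F y \<subseteq> trace (first_edges n) \<omega>" using n F(2)[OF y] y by blast
    then show "y \<in> cluster (trace (first_edges n) \<omega>) 0"
      using F(3)[OF y] conn_mono unfolding mem_cluster by blast
  qed
  then have "card S \<le> card (cluster (trace (first_edges n) \<omega>) 0)"
    by (intro card_mono finite_cluster_finite) (simp add: finite_first_edges)
  then show "\<omega> \<in> (\<Union>n. large_in k (first_edges n))"
    using S(3) by (auto simp: large_in_def)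
next
  fix \<omega> :: "'d config" assume "\<omega> \<in> (\<Union>n. large_in k (first_edges n))"
  then obtain n where n: "k \<le> card (cluster (trace (first_edges n) \<omega>) 0)"
    by (auto simp: large_in_def)
  have "conn (trace (first_edges n) \<omega>) \<subseteq> (open_adj \<omega>)\<^sup>*"
    unfolding conn_def by (rule rtrancl_mono) (auto simp: open_adj_def)
  then have "cluster (trace (first_edges n) \<omega>) 0 \<subseteq> origin_cluster \<omega>"
    unfolding cluster_def origin_cluster_def by (rule Image_mono) simp
  then have "card (cluster (trace (first_edges n) \<omega>) 0) \<le> card (origin_cluster \<omega>)"
    if "finite (origin_cluster \<omega>)"
    using that by (intro card_mono)
  then show "\<omega> \<in> large k"
    unfolding large_def using n order_trans by blast
qed

text \<open>A norm is unbounded on every infinite set of sites, so that reaching arbitrarily large norm means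
  having an infinite cluster, for every choice of the norm.\<close>

lemma connected_to_infinity_eq:
  fixes N :: "real ^ 'd::finite \<Rightarrow> real"
  assumes N: "is_norm N"
  shows "connected_to_infinity N = (\<Inter>k. large k)"
proof (intro set_eqI iffI)
  fix \<omega> :: "'d config" assume \<omega>: "\<omega> \<in> connected_to_infinity N"
  have "infinite (origin_cluster \<omega>)"
  proof
    assume fin: "finite (origin_cluster \<omega>)"
    obtain x where "N (site_to_real x) > Max ((\<lambda>x. N (site_to_real x)) ` origin_cluster \<omega>)"
        "x \<in> origin_cluster \<omega>"
      using \<omega> unfolding connected_to_infinity_def origin_cluster_def by blast
    moreover from this(2) have "N (site_to_real x) \<le> Max ((\<lambda>x. N (site_to_real x)) ` origin_cluster \<omega>)"
      using fin by (intro Max_ge) auto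
    ultimately show False by simp
  qed
  then show "\<omega> \<in> (\<Inter>k. large k)" by (simp add: large_def)
next
  fix \<omega> :: "'d config" assume \<omega>: "\<omega> \<in> (\<Inter>k. large k)"
  then have "\<omega> \<in> large (Suc (card (origin_cluster \<omega>)))" by blast
  then have inf: "infinite (origin_cluster \<omega>)" by (simp add: large_def)
  show "\<omega> \<in> connected_to_infinity N"
    unfolding connected_to_infinity_def
  proof (intro CollectI allI)
    fix R
    have "\<not> origin_cluster \<omega> \<subseteq> {x. N (site_to_real x) \<le> R}"
      using inf finite_N_ball[OF N] finite_subset by blast
    then obtain x where "x \<in> origin_cluster \<omega>" "x \<notin> {x. N (site_to_real x) \<le> R}"
      by blast
    then show "\<exists>x. R < N (site_to_real x) \<and> (0, x) \<in> (open_adj \<omega>)\<^sup>*"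
      unfolding origin_cluster_def by (intro exI[of _ x]) auto
  qed
qed

context
  fixes p :: real
  assumes p: "0 \<le> p" "p \<le> 1"
begin

lemma tendsto_large_in:
  fixes E :: "'d::finite edge set"
  assumes "finite E"
  shows "((\<lambda>G. \<integral>\<omega>. of_bool (\<omega> \<in> large_in k E) \<partial>random_cluster p G)
    \<longlongrightarrow> measure (infinite_random_cluster p) (large_in k E)) subgraphs_at_top"
proof -
  have dep: "depends_on (\<lambda>\<omega>. of_bool (\<omega> \<in> large_in k E) :: real) E"
    unfolding large_in_def mem_Collect_eq by (rule depends_on_trace_eq) simp
  have "(\<integral>\<omega>. of_bool (\<omega> \<in> large_in k E) \<partial>infinite_random_cluster p)
      = (measure (infinite_random_cluster p) (large_in k E) :: real)"
  proof -
    have "of_bool (\<omega> \<in> large_in k E) = (indicator (large_in k E) \<omega> :: real)" for \<omega>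
      by (simp add: indicator_def)
    then show ?thesis
      using sets_eq_imp_space_eq[OF infinite_random_cluster_spec(2)[OF p, where 'd = 'd]] by simp
  qed
  then show ?thesis
    using tendsto_infinite_random_cluster[OF p dep assms] by simp
qed

lemma large_in_sets: "finite E \<Longrightarrow> large_in k E \<in> sets (infinite_random_cluster p)"
  unfolding infinite_random_cluster_spec(2)[OF p]
  using borel_open[OF open_depends_on[OF large_in_depends_on[of k E]]] by simp

lemma large_sets: "large k \<in> sets (infinite_random_cluster p)"
  unfolding large_eq_union by (intro sets.countable_UN) (auto intro: large_in_sets finite_first_edges)

lemma large_limit:
  "(\<lambda>n. measure (infinite_random_cluster p) (large_in k (first_edges n) :: 'd::finite config set))
    \<longlonglongrightarrow> measure (infinite_random_cluster p) (large k :: 'd config set)"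
proof -
  interpret prob_space "infinite_random_cluster p :: 'd config measure" by (rule infinite_random_cluster_spec(1)[OF p])
  show ?thesis
    unfolding large_eq_union
  proof (rule finite_Lim_measure_incseq)
    show "range (\<lambda>n. large_in k (first_edges n)) \<subseteq> sets (infinite_random_cluster p :: 'd config measure)"
      by (auto intro: large_in_sets finite_first_edges)
    show "incseq (\<lambda>n. large_in k (first_edges n) :: 'd config set)"
      by (intro incseq_SucI subsetI) (rule large_in_mono[OF finite_first_edges first_edges_mono], auto)
  qed
qed

lemma percolation_limit:
  fixes N :: "real ^ 'd::finite \<Rightarrow> real"
  assumes N: "is_norm N"
  shows "(\<lambda>k. measure (infinite_random_cluster p) (large k :: 'd config set))
    \<longlonglongrightarrow> measure (infinite_random_cluster p) (connected_to_infinity N)"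
proof -
  interpret prob_space "infinite_random_cluster p :: 'd config measure"
    by (rule infinite_random_cluster_spec(1)[OF p])
  show ?thesis
    unfolding connected_to_infinity_eq[OF N]
  proof (rule finite_Lim_measure_decseq)
    show "range large \<subseteq> sets (infinite_random_cluster p :: 'd config measure)"
      by (auto intro: large_sets)
    show "decseq (large :: nat \<Rightarrow> 'd config set)"
      by (rule decseq_SucI) (auto simp: large_def)
  qed
qed

text \<open>With free boundary conditions the finite-volume probabilities increase to their limit.\<close>

lemma finite_volume_large_le:
  fixes E :: "'d::finite edge set"
  assumes G: "finite_subgraph (V, E)"
  shows "(\<integral>\<omega>. of_bool (\<omega> \<in> large_in k E) \<partial>random_cluster p (V, E))
    \<le> measure (infinite_random_cluster p) (large k :: 'd config set)"
proof -
  interpret prob_space "infinite_random_cluster p :: 'd config measure"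
    by (rule infinite_random_cluster_spec(1)[OF p])
  have fin: "finite E" using G by (simp add: finite_subgraph_def)
  have "(\<integral>\<omega>. of_bool (\<omega> \<in> large_in k E) \<partial>random_cluster p (V, E)) 
      \<le> measure (infinite_random_cluster p) (large_in k E)"
  proof (rule tendsto_lowerbound[OF tendsto_large_in[OF fin] _ subgraphs_at_top_neq_bot])
    show "eventually (\<lambda>H. (\<integral>\<omega>. of_bool (\<omega> \<in> large_in k E) \<partial>random_cluster p (V, E))
        \<le> (\<integral>\<omega>. of_bool (\<omega> \<in> large_in k E) \<partial>random_cluster p H :: real)) subgraphs_at_top"
    proof (rule eventually_subgraphs[OF G])
      fix H :: "'d site set \<times> 'd edge set"
      assume H: "finite_subgraph H" "fst (V, E) \<subseteq> fst H" "snd (V, E) \<subseteq> snd H"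
      have "(\<integral>\<omega>. of_bool (\<omega> \<in> large_in k E) \<partial>random_cluster p (V, E))
          \<le> (\<integral>\<omega>. of_bool (\<omega> \<in> large_in k E) \<partial>random_cluster p (fst H, snd H) :: real)"
      proof (rule random_cluster_mono)
        fix \<omega> \<omega>' :: "'d config" assume "\<omega> \<le> \<omega>'"
        from large_in_mono[OF fin order_refl this]
        show "of_bool (\<omega> \<in> large_in k E) \<le> (of_bool (\<omega>' \<in> large_in k E) :: real)"
          by (simp add: of_bool_def)
      qed (use H G p in auto)
      then show "(\<integral>\<omega>. of_bool (\<omega> \<in> large_in k E) \<partial>random_cluster p (V, E))
          \<le> (\<integral>\<omega>. of_bool (\<omega> \<in> large_in k E) \<partial>random_cluster p H :: real)"
        by simp
    qed
  qed
  also have "\<dots> \<le> measure (infinite_random_cluster p) (large k :: 'd config set)"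
  proof (rule finite_measure_mono)
    obtain n where "E \<subseteq> first_edges n" by (rule finite_subset_first_edges[OF fin])
    then have "large_in k E \<subseteq> large_in k (first_edges n)"
      by (intro subsetI) (rule large_in_mono[OF finite_first_edges _ order_refl])
    then show "large_in k E \<subseteq> large k"
      unfolding large_eq_union by (rule order_trans) (intro UN_upper UNIV_I)
  qed (rule large_sets)
  finally show ?thesis .
qed

end

lemma percolation_mono:
  fixes N :: "real ^ 'd::finite \<Rightarrow> real"
  assumes N: "is_norm N" and p: "0 \<le> p" "p \<le> p'" "p' \<le> 1"
  shows "measure (infinite_random_cluster p) (connected_to_infinity N)
    \<le> measure (infinite_random_cluster p') (connected_to_infinity N)"
proof -
  have p1: "p \<le> 1" and p0': "0 \<le> p'" using p by auto
  have large_in: "measure (infinite_random_cluster p) (large_in k E)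
      \<le> measure (infinite_random_cluster p') (large_in k E)" if fin: "finite E" for k and E :: "'d edge set"
  proof (rule tendsto_le[OF subgraphs_at_top_neq_bot tendsto_large_in[OF p0' p(3) fin] tendsto_large_in[OF p(1) p1 fin]])
    show "eventually (\<lambda>H. (\<integral>\<omega>. of_bool (\<omega> \<in> large_in k E) \<partial>random_cluster p H)
        \<le> (\<integral>\<omega>. of_bool (\<omega> \<in> large_in k E) \<partial>random_cluster p' H :: real)) subgraphs_at_top"
      using eventually_finite_subgraph
    proof eventually_elim
      case (elim H)
      have "(\<integral>\<omega>. of_bool (\<omega> \<in> large_in k E) \<partial>random_cluster p (fst H, snd H))
          \<le> (\<integral>\<omega>. of_bool (\<omega> \<in> large_in k E) \<partial>random_cluster p' (fst H, snd H) :: real)"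
      proof (rule random_cluster_mono)
        fix \<omega> \<omega>' :: "'d config" assume "\<omega> \<le> \<omega>'"
        from large_in_mono[OF fin order_refl this]
        show "of_bool (\<omega> \<in> large_in k E) \<le> (of_bool (\<omega>' \<in> large_in k E) :: real)"
          by (simp add: of_bool_def)
      qed (use elim p in auto)
      then show ?case by simp
    qed
  qed
  have "measure (infinite_random_cluster p) (large k :: 'd config set)
      \<le> measure (infinite_random_cluster p') (large k :: 'd config set)" for k
    by (intro LIMSEQ_le[OF large_limit[OF p(1) p1] large_limit[OF p0' p(3)]]
        exI allI impI large_in finite_first_edges)
  then show ?thesis
    by (intro LIMSEQ_le[OF percolation_limit[OF p(1) p1 N] percolation_limit[OF p0' p(3) N]]) auto
qed

text \<open>By monotonicity the parameters without percolation form an initial segment of the unit interval;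
  its supremum is the critical point.\<close>

lemma critical_p_spec:
  fixes N :: "real ^ 'd::finite \<Rightarrow> real"
  assumes N: "is_norm N"
  shows "critical_p N \<in> {0..1}"
    and "0 \<le> p \<Longrightarrow> p < critical_p N \<Longrightarrow> measure (infinite_random_cluster p) (connected_to_infinity N) = 0"
proof -
  define \<theta> where "\<theta> p = measure (infinite_random_cluster p) (connected_to_infinity N)" for p
  let ?P = "\<lambda>pc. pc \<in> {0..1} \<and> (\<forall>p\<in>{0..1}. (p < pc \<longrightarrow> \<theta> p = 0) \<and> (p > pc \<longrightarrow> \<theta> p > 0))"
  have mono: "\<theta> p \<le> \<theta> p'" if "0 \<le> p" "p \<le> p'" "p' \<le> 1" for p p'
    unfolding \<theta>_def by (rule percolation_mono[OF N that])
  have nonneg: "0 \<le> \<theta> p" for p by (simp add: \<theta>_def)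
  define S where "S = insert 0 {p \<in> {0..1}. \<theta> p = 0}"
  have S: "0 \<in> S" "S \<subseteq> {0..1}" by (auto simp: S_def)
  then have bdd: "bdd_above S" by (meson bdd_above_Icc bdd_above_mono)
  have sup: "?P (Sup S)"
  proof (intro conjI ballI impI)
    show "Sup S \<in> {0..1}"
      using S cSup_upper[OF S(1) bdd] by (auto intro!: cSup_least)
    fix p :: real assume p: "p \<in> {0..1}"
    { assume "p < Sup S"
      then obtain p' where "p' \<in> S" "p < p'" using less_cSup_iff[of S p] S bdd by auto
      then have "\<theta> p \<le> 0" using p mono[of p p'] by (auto simp: S_def)
      then show "\<theta> p = 0" using nonneg[of p] by simp }
    { assume "Sup S < p"
      then have "p \<notin> S" using cSup_upper[OF _ bdd] by force
      then have "\<theta> p \<noteq> 0" using p by (simp add: S_def)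
      then show "0 < \<theta> p" using nonneg[of p] by simp }
  qed
  have unique: "a = b" if a: "?P a" and b: "?P b" for a b
  proof -
    have False if "?P a" "?P b" "a < b" for a b
    proof -
      have "(a + b) / 2 \<in> {0..1}" "a < (a + b) / 2" "(a + b) / 2 < b" using that by auto
      then show False
        using bspec[OF conjunct2[OF that(1)], of "(a + b) / 2"] bspec[OF conjunct2[OF that(2)], of "(a + b) / 2"]
        by simp
    qed
    from this[OF a b] this[OF b a] show ?thesis by (cases a b rule: linorder_cases) auto
  qed
  have "?P (THE pc. ?P pc)"
    by (rule theI[of ?P, OF sup]) (rule unique[OF _ sup])
  then have P: "?P (critical_p N)" unfolding critical_p_def \<theta>_def .
  then show "critical_p N \<in> {0..1}" by blast
  show "measure (infinite_random_cluster p) (connected_to_infinity N) = 0" if "0 \<le> p" "p < critical_p N"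
  proof -
    have "p \<in> {0..1}" using that P by auto
    then show ?thesis using P that(2) unfolding \<theta>_def by blast
  qed
qed

section \<open>Exponential decay\<close>

text \<open>Without percolation at \<open>p2\<close>, clusters are large with small probability there, and by monotonicity
  and translation invariance this is uniform over all finite graphs and all their vertices. So the
  factor that \<open>cluster_tail\<close> loses in the odds can be brought as close to \<open>1\<close> as needed.\<close>

lemma uniform_cluster_tail:
  assumes p: "0 < p1" "p1 < p2" "p2 < 1"
    and no_perc: "(\<lambda>k. measure (infinite_random_cluster p2) (large k :: 'd::finite config set)) \<longlonglongrightarrow> 0"
  obtains s A :: real where "0 < s" "s < 1" "1 \<le> A"
    "\<And>V (E :: 'd edge set) n. finite_subgraph (V, E) \<Longrightarrow> 0 \<in> V \<Longrightarrow>
      fk_mean V (p1 / (1 - p1)) {} E (\<lambda>X. of_bool (n \<le> card (cluster X 0))) \<le> A * s ^ n"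
proof -
  define r1 r2 where "r1 = p1 / (1 - p1)" and "r2 = p2 / (1 - p2)"
  have r: "0 < r1" "r1 < r2"
    using p by (auto simp: r1_def r2_def intro!: frac_less)
  define u where "u = sqrt (r1 / r2)"
  have u: "0 < u" "u < 1" "u * u = r1 / r2"
    using r by (auto simp: u_def real_sqrt_lt_1_iff)
  define \<epsilon> where "\<epsilon> = 1 - u"
  have \<epsilon>: "0 < \<epsilon>" "\<epsilon> < 1" using u by (auto simp: \<epsilon>_def)
  have "eventually (\<lambda>k. measure (infinite_random_cluster p2) (large k :: 'd config set) < \<epsilon>) sequentially"
    using no_perc \<epsilon>(1) by (rule order_tendstoD)
  with eventually_gt_at_top[of 0]
  have "eventually (\<lambda>k. 0 < k \<and> measure (infinite_random_cluster p2) (large k :: 'd config set) < \<epsilon>) sequentially"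
    by eventually_elim simp
  then obtain k where k: "0 < k" "measure (infinite_random_cluster p2) (large k :: 'd config set) < \<epsilon>"
    using eventually_happens'[OF sequentially_bot] by blast
  define s where "s = root k u"
  have s: "0 < s" "s < 1" "s ^ k = u"
    using u k(1) by (auto simp: s_def real_root_lt_1_iff)
  \<comment> \<open>The constants are chosen so that the loss factor is exactly \<open>r1 / r2\<close>.\<close>
  have factor: "(1 - \<epsilon>) * s ^ k = r1 / r2"
    using u s by (simp add: \<epsilon>_def)
  show ?thesis
  proof (rule that)
    show "0 < s" "s < 1" by fact+
    show "1 \<le> r2 / r1" using r by simp
    fix V and E :: "'d edge set" and n
    assume G: "finite_subgraph (V, E)" and V: "0 \<in> V"
    interpret finite_graph V E by unfold_locales (rule G)
    have "fk_mean V (r2 * ((1 - \<epsilon>) * s ^ k)) {} E (\<lambda>X. of_bool (n \<le> card (cluster X 0)))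
        \<le> s ^ n / ((1 - \<epsilon>) * s ^ k)"
    proof (rule cluster_tail)
      fix U y assume U: "U \<subseteq> E" and y: "y \<in> V"
      have GU: "finite_subgraph (V, U)"
        using G U by (auto simp: finite_subgraph_def intro: finite_subset)
      let ?V = "(\<lambda>x. x + - y) ` V" and ?U = "shift (- y) ` U"
      have GU': "finite_subgraph (?V, ?U)"
        by (rule finite_subgraph_shift[OF GU])
      interpret S: finite_graph ?V ?U by unfold_locales (rule GU')
      have "fk_mean V r2 {} U (\<lambda>X. of_bool (k \<le> card (cluster X y)))
          = fk_mean V r2 {} U (\<lambda>X. of_bool (k \<le> card (cluster (shift (- y) ` X) 0)))"
        using card_cluster_shift[of "- y" _ y] by simp
      also have "\<dots> = fk_mean ?V r2 {} ?U (\<lambda>X. of_bool (k \<le> card (cluster X 0)))"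
        by (rule fk_mean_shift[OF GU, symmetric])
      also have "\<dots> = fk_mean ?V r2 {} ?U (\<lambda>X. of_bool ((\<lambda>e. e \<in> X) \<in> large_in k ?U))"
      proof -
        have "trace ?U (\<lambda>e. e \<in> X) = X" if "X \<subseteq> ?U" for X using that by auto
        then show ?thesis
          unfolding fk_mean_def large_in_def by (simp cong: fk_sum_cong)
      qed
      also have "\<dots> = (\<integral>\<omega>. of_bool (\<omega> \<in> large_in k ?U) \<partial>random_cluster p2 (?V, ?U))"
        unfolding r2_def using p by (intro S.integral_random_cluster[symmetric]) auto
      also have "\<dots> \<le> measure (infinite_random_cluster p2) (large k :: 'd config set)"
        using p by (intro finite_volume_large_le GU') auto
      finally show "fk_mean V r2 {} U (\<lambda>X. of_bool (k \<le> card (cluster X y))) \<le> \<epsilon>"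
        using k(2) by simp
    qed (use r s \<epsilon> V in auto)
    then show "fk_mean V (p1 / (1 - p1)) {} E (\<lambda>X. of_bool (n \<le> card (cluster X 0))) \<le> r2 / r1 * s ^ n"
      unfolding factor using r by (simp add: r1_def[symmetric] mult.commute)
  qed
qed

text \<open>Correlations increase with the volume, so the infinite-volume correlation is their supremum.\<close>

lemma two_point_le:
  fixes x :: "'d::finite site"
  assumes \<beta>: "0 \<le> \<beta>"
    and bound: "\<And>\<Lambda>. finite \<Lambda> \<Longrightarrow> 0 \<in> \<Lambda> \<Longrightarrow> x \<in> \<Lambda> \<Longrightarrow> (\<integral>\<sigma>. \<sigma> 0 * \<sigma> x \<partial>ising_measure \<Lambda> \<beta>) \<le> b"
  shows "two_point \<beta> 0 x \<le> b"
proof -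
  define u where "u \<Lambda> = (\<integral>\<sigma>. \<sigma> 0 * \<sigma> x \<partial>ising_measure \<Lambda> \<beta>)" for \<Lambda>
  define S where "S = {\<Lambda> :: 'd site set. finite \<Lambda> \<and> 0 \<in> \<Lambda> \<and> x \<in> \<Lambda>}"
  have S: "{0, x} \<in> S" by (simp add: S_def)
  have mono: "u \<Lambda> \<le> u \<Lambda>'" if "\<Lambda> \<in> S" "\<Lambda>' \<in> S" "\<Lambda> \<subseteq> \<Lambda>'" for \<Lambda> \<Lambda>'
  proof -
    let ?f = "\<lambda>\<omega> :: 'd config. of_bool ((0, x) \<in> (open_adj \<omega>)\<^sup>*) :: real"
    have "(\<integral>\<omega>. ?f \<omega> \<partial>random_cluster (1 - exp (- 2 * \<beta>)) (\<Lambda>, inner_edges \<Lambda>))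
        \<le> (\<integral>\<omega>. ?f \<omega> \<partial>random_cluster (1 - exp (- 2 * \<beta>)) (\<Lambda>', inner_edges \<Lambda>'))"
    proof (rule random_cluster_mono)
      fix \<omega> \<omega>' :: "'d config" assume "\<omega> \<le> \<omega>'"
      then have "open_adj \<omega> \<subseteq> open_adj \<omega>'"
        unfolding open_adj_def le_fun_def le_bool_def by blast
      from rtrancl_mono[OF this] show "?f \<omega> \<le> ?f \<omega>'" by (auto simp: of_bool_def)
    qed (use that \<beta> in \<open>auto simp: S_def inner_edges_def intro: finite_subgraph_inner_edges[unfolded inner_edges_def]\<close>)
    then show ?thesis
      using that \<beta> by (simp add: u_def S_def edwards_sokal)
  qed
  have bdd: "bdd_above (u ` S)"
    using bound by (auto intro!: bdd_aboveI simp: S_def u_def)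
  have "(u \<longlongrightarrow> (SUP \<Lambda>\<in>S. u \<Lambda>)) (finite_subsets_at_top UNIV)"
  proof (rule order_tendstoI)
    fix a
    { assume "a < (SUP \<Lambda>\<in>S. u \<Lambda>)"
      then obtain \<Lambda> where \<Lambda>: "\<Lambda> \<in> S" "a < u \<Lambda>"
        using less_cSUP_iff[OF _ bdd] S by blast
      have "a < u \<Lambda>'" if "finite \<Lambda>'" "\<Lambda> \<subseteq> \<Lambda>'" for \<Lambda>'
      proof -
        have "\<Lambda>' \<in> S" using \<Lambda>(1) that by (auto simp: S_def)
        then show ?thesis using mono[OF \<Lambda>(1) _ that(2)] \<Lambda>(2) by fastforce
      qed
      then show "eventually (\<lambda>\<Lambda>. a < u \<Lambda>) (finite_subsets_at_top UNIV)"
        unfolding eventually_finite_subsets_at_top using \<Lambda>(1)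
        by (intro exI[of _ \<Lambda>]) (auto simp: S_def) }
    { assume a: "(SUP \<Lambda>\<in>S. u \<Lambda>) < a"
      have "u \<Lambda> < a" if "finite \<Lambda>" "{0, x} \<subseteq> \<Lambda>" for \<Lambda>
        using cSUP_upper[OF _ bdd, of \<Lambda>] that a by (simp add: S_def)
      then show "eventually (\<lambda>\<Lambda>. u \<Lambda> < a) (finite_subsets_at_top UNIV)"
        unfolding eventually_finite_subsets_at_top
        by (intro exI[of _ "{0, x}"]) auto }
  qed
  then have "two_point \<beta> 0 x = (SUP \<Lambda>\<in>S. u \<Lambda>)"
    unfolding two_point_def u_def by (intro tendsto_Lim) auto
  also have "\<dots> \<le> b"
    using S bound by (intro cSUP_least) (auto simp: S_def u_def)
  finally show ?thesis .
qed

text \<open>The prefactor only matters for small \<open>y\<close>, where the bound \<open>\<rho> < 1\<close> takes over.\<close>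

lemma absorb_prefactor:
  fixes \<rho> A t :: real
  assumes "0 < \<rho>" "\<rho> < 1" "1 \<le> A" "0 < t"
  obtains c where "0 < c" "\<And>y. 0 \<le> y \<Longrightarrow> min \<rho> (A * exp (- t * y)) \<le> exp (- c * y)"
proof -
  define y0 where "y0 = 2 * ln A / t + 1"
  have y0: "0 < y0" using assms by (auto simp: y0_def intro!: add_nonneg_pos)
  define c where "c = min (t / 2) (- ln \<rho> / y0)"
  show ?thesis
  proof (rule that)
    have rate: "0 < - ln \<rho> / y0" using assms y0 by (intro divide_pos_pos) auto
    then show "0 < c" using assms by (simp add: c_def)
    fix y :: real assume y: "0 \<le> y"
    show "min \<rho> (A * exp (- t * y)) \<le> exp (- c * y)"
    proof (cases "y0 \<le> y")
      case True
      then have "2 * ln A / t \<le> y" by (simp add: y0_def)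
      then have "ln A \<le> t * y / 2" using assms by (simp add: field_simps)
      moreover have "c * y \<le> t / 2 * y" using y unfolding c_def by (intro mult_right_mono min.cobounded1)
      ultimately have "ln A + - t * y \<le> - c * y" by simp
      then have "exp (ln A) * exp (- t * y) \<le> exp (- c * y)"
        by (simp only: exp_add[symmetric] exp_le_cancel_iff)
      then show ?thesis using assms by (intro min.coboundedI2) simp
    next
      case False
      have "c * y \<le> - ln \<rho> / y0 * y0"
        using False y rate unfolding c_def by (intro mult_mono min.cobounded2) auto
      then have "exp (ln \<rho>) \<le> exp (- c * y)" using y0 by simp
      then show ?thesis using assms by simp
    qed
  qed
qed

lemma finite_edges_at_origin: "finite {e :: 'd::finite edge. 0 \<in> endpoints e}"
proof -
  have "{e :: 'd edge. 0 \<in> endpoints e} \<subseteq> {0} \<times> UNIV \<union> range (\<lambda>i. (- axis i 1, i))"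
  proof
    fix e :: "'d edge" assume "e \<in> {e. 0 \<in> endpoints e}"
    then have "fst e = 0 \<or> fst e = - axis (snd e) 1"
      by (auto simp: endpoints_def eq_neg_iff_add_eq_0)
    then show "e \<in> {0} \<times> UNIV \<union> range (\<lambda>i. (- axis i 1, i))"
      by (cases e) auto
  qed
  then show ?thesis by (rule finite_subset) auto
qed

theorem corollary2:
  fixes N :: "real ^ 'd \<Rightarrow> real" and \<beta> :: real
  assumes "is_norm N"
    and "0 \<le> \<beta>" and "ereal \<beta> < critical_beta N"
  shows "\<exists>c>0. \<forall>x :: int ^ 'd. two_point \<beta> 0 x \<le> exp (- c * N (site_to_real x))"
proof -
  note N = assms(1) and \<beta> = assms(2)
  define pc p where "pc = critical_p N" and "p = 1 - exp (- 2 * \<beta>)"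
  have pc: "0 \<le> pc" "pc \<le> 1" using critical_p_spec(1)[OF N] by (auto simp: pc_def)
  have p: "0 \<le> p" "p < 1" using \<beta> by (auto simp: p_def)
  have "p < pc"
  proof (cases "pc = 1")
    case False
    then have "\<beta> < - (1 / 2) * ln (1 - pc)"
      using assms(3) by (simp add: critical_beta_def pc_def)
    then have "ln (1 - pc) < - 2 * \<beta>" by simp
    then have "exp (ln (1 - pc)) < exp (- 2 * \<beta>)" by (simp only: exp_less_cancel_iff)
    then show ?thesis using False pc by (simp add: p_def)
  qed (use p in simp)
  define p1 p2 where "p1 = p + (pc - p) / 3" and "p2 = p + 2 * (pc - p) / 3"
  have p12: "0 < p1" "p < p1" "p1 < p2" "p2 < pc" "p1 < 1" "p2 < 1"
    using p pc \<open>p < pc\<close> by (auto simp: p1_def p2_def field_simps)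
  have "(\<lambda>k. measure (infinite_random_cluster p2) (large k :: 'd config set)) \<longlonglongrightarrow> 0"
    using percolation_limit[OF _ _ N, of p2] critical_p_spec(2)[OF N, of p2] p12 by (simp add: pc_def)
  then obtain s A where sA: "0 < s" "s < 1" "1 \<le> A"
    and tail: "\<And>V (E :: 'd edge set) n. finite_subgraph (V, E) \<Longrightarrow> 0 \<in> V \<Longrightarrow>
      fk_mean V (p1 / (1 - p1)) {} E (\<lambda>X. of_bool (n \<le> card (cluster X 0))) \<le> A * s ^ n"
    using uniform_cluster_tail[OF p12(1,3,6)] by blast
  define r where "r = p1 / (1 - p1)"
  have r: "0 < r" using p12 by (simp add: r_def)
  define D where "D = card {e :: 'd edge. 0 \<in> endpoints e}"
  define \<rho> where "\<rho> = max (1 / 2) (1 - 1 / (1 + r) ^ D)"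
  have \<rho>: "0 < \<rho>" "\<rho> < 1" using r by (auto simp: \<rho>_def)
  define K where "K = axis_total N"
  have K: "0 < K" using axis_total_pos[OF N] by (simp add: K_def)
  define t where "t = - ln s / K"
  have t: "0 < t" unfolding t_def using sA K by (intro divide_pos_pos) auto
  obtain c where c: "0 < c" "\<And>y. 0 \<le> y \<Longrightarrow> min \<rho> (A * exp (- t * y)) \<le> exp (- c * y)"
    using absorb_prefactor[OF \<rho> sA(3) t] by blast
  have bound: "(\<integral>\<sigma>. \<sigma> 0 * \<sigma> x \<partial>ising_measure \<Lambda> \<beta>) \<le> exp (- c * N (site_to_real x))"
    if \<Lambda>: "finite \<Lambda>" "0 \<in> \<Lambda>" "x \<in> \<Lambda>" for \<Lambda> and x :: "'d site"
  proof -
    have G: "finite_subgraph (\<Lambda>, inner_edges \<Lambda>)" by (rule finite_subgraph_inner_edges[OF \<Lambda>(1)])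
    interpret finite_graph \<Lambda> "inner_edges \<Lambda>" by unfold_locales (rule G)
    let ?f = "\<lambda>\<omega> :: 'd config. of_bool ((0, x) \<in> (open_adj \<omega>)\<^sup>*) :: real"
    let ?E = "inner_edges \<Lambda>"
    have Z: "0 < fk_sum \<Lambda> r {} ?E (\<lambda>_. 1)" using fk_sum_pos_empty[of ?E r] r by simp
    have mean_mono: "fk_mean \<Lambda> r {} ?E f \<le> fk_mean \<Lambda> r {} ?E g"
      if "\<And>X. X \<subseteq> ?E \<Longrightarrow> f X \<le> g X" for f g
      unfolding fk_mean_def using that Z r by (intro divide_right_mono fk_sum_mono) auto
    have "(\<integral>\<sigma>. \<sigma> 0 * \<sigma> x \<partial>ising_measure \<Lambda> \<beta>) = (\<integral>\<omega>. ?f \<omega> \<partial>random_cluster p (\<Lambda>, ?E))"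
      using edwards_sokal[OF \<beta> \<Lambda>] by (simp add: p_def)
    also have "\<dots> \<le> (\<integral>\<omega>. ?f \<omega> \<partial>random_cluster p1 (\<Lambda>, ?E))"
    proof (rule random_cluster_mono[OF G G])
      fix \<omega> \<omega>' :: "'d config" assume "\<omega> \<le> \<omega>'"
      then have "open_adj \<omega> \<subseteq> open_adj \<omega>'"
        unfolding open_adj_def le_fun_def le_bool_def by blast
      from rtrancl_mono[OF this] show "?f \<omega> \<le> ?f \<omega>'" by (auto simp: of_bool_def)
    qed (use p p12 in auto)
    also have "\<dots> = fk_mean \<Lambda> r {} ?E (\<lambda>X. of_bool (x \<in> cluster X 0))"
      unfolding r_def using p12
      by (subst integral_random_cluster) (auto simp: mem_cluster conn_def)
    also have "\<dots> \<le> exp (- c * N (site_to_real x))"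
    proof (cases "x = 0")
      case True
      have "site_to_real (0 :: 'd site) = 0" by (simp add: site_to_real_def vec_eq_iff)
      then have "N (site_to_real x) = 0" using True N_zero_iff[OF N] by simp
      then show ?thesis using r Z by (auto intro!: fk_mean_le_max)
    next
      case False
      let ?y = "N (site_to_real x)"
      have "fk_mean \<Lambda> r {} ?E (\<lambda>X. of_bool (x \<in> cluster X 0))
          \<le> fk_mean \<Lambda> r {} ?E (\<lambda>X. of_bool (cluster X 0 \<noteq> {0}))"
        using False by (intro mean_mono) (auto simp: of_bool_def)
      also have "\<dots> \<le> 1 - 1 / (1 + r) ^ D"
        unfolding D_def using r finite_edges_at_origin
        by (intro isolation_probability card_mono) auto
      finally have short: "fk_mean \<Lambda> r {} ?E (\<lambda>X. of_bool (x \<in> cluster X 0)) \<le> \<rho>"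
        by (simp add: \<rho>_def)
      define n where "n = nat \<lceil>?y / K\<rceil>"
      have far: "n \<le> card (cluster X 0)" if "X \<subseteq> ?E" "x \<in> cluster X 0" for X
      proof -
        have "\<bar>site_to_real x $ i\<bar> \<le> real (card (cluster X 0))" for i
          using coordinate_le_card_cluster[OF finite_cluster[OF that(1) \<Lambda>(2)] that(2), of i]
          by (simp add: site_to_real_def)
        then have "?y \<le> K * real (card (cluster X 0))"
          unfolding K_def by (rule N_le_coordinates[OF N])
        then have "?y / K \<le> real (card (cluster X 0))"
          using K by (simp add: field_simps)
        then show ?thesis by (simp add: n_def nat_le_iff ceiling_le_iff)
      qed
      have "fk_mean \<Lambda> r {} ?E (\<lambda>X. of_bool (x \<in> cluster X 0))
          \<le> fk_mean \<Lambda> r {} ?E (\<lambda>X. of_bool (n \<le> card (cluster X 0)))"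
        using far by (intro mean_mono) (auto simp: of_bool_def)
      also have "\<dots> \<le> A * s ^ n"
        unfolding r_def by (rule tail[OF G \<Lambda>(2)])
      also have "s ^ n \<le> exp (- t * ?y)"
      proof -
        have "?y / K \<le> real n"
          unfolding n_def by (rule real_nat_ceiling_ge)
        then have "ln s * real n \<le> ln s * (?y / K)"
          using sA by (intro mult_left_mono_neg) auto
        then have "exp (real n * ln s) \<le> exp (- t * ?y)" by (simp add: t_def mult.commute)
        then show ?thesis using sA by (simp add: exp_of_nat_mult)
      qed
      finally have "fk_mean \<Lambda> r {} ?E (\<lambda>X. of_bool (x \<in> cluster X 0)) \<le> A * exp (- t * ?y)"
        using sA by simp
      then show ?thesis
        using short c(2)[OF N_nonneg[OF N], of "site_to_real x"] by linarith
    qed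
    finally show ?thesis .
  qed
  show ?thesis
    using c(1) two_point_le[OF \<beta> bound] by blast
qed

end
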